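(* Let $\mathbf{L}$ be an invertible $(D\times D)$ matrix differential operator (MDO), and let $\mathbf{L}=\mathbf{U}\circ\mathbf{D}\circ\mathbf{V}$ be a factorization in which $\mathbf{U},\mathbf{V}$ are unimodular $(D\times D)$ MDOs and $\mathbf{D}=\mathbf{Diag}(\mathrm{D}_1,\ldots,\mathrm{D}_D)$ is a diagonal MDO with ordinary differential operators $\mathrm{D}_d$ on the diagonal. Then $\mathbf{L}$ has a unique causal Green's matrix $\mathbf{G}_{\mathbf{L}}$, and it can be written as $$\mathbf{G}_{\mathbf{L}}=\mathbf{V}^{-1}\circ\mathbf{D}^{-1}\circ\mathbf{U}^{-1}\{\mathbf{I}\delta\},$$ where $\mathbf{D}^{-1}$ is defined, for every $\boldsymbol{\phi}=(\phi_d)_{d=1}^D\in\mathcal{D}'(\mathbb{R},\mathbb{R}^D)$ with support bounded from below (and column by column on matrix-valued distributions), by $$[\mathbf{D}^{-1}\{\boldsymbol{\phi}\}]_d=g_{\mathrm{D}_d}\ast\phi_d,\qquad 1\le d\le D,$$ with $g_{\mathrm{D}_d}$ the unique causal Green's function of $\mathrm{D}_d$. In addition, the adjoint $\mathbf{G}_{\mathbf{L}}^{\star}$ of the Green's matrix satisfies $$\mathbf{G}_{\mathbf{L}}^{\star}(\cdot)=\mathbf{G}_{\mathbf{L}}^{\intercal}(-\cdot),$$ and it is the unique anti-causal Green's matrix of the adjoint operator $\mathbf{L}^{\star}$; in particular $\mathbf{L}^{\star}\{\mathbf{G}_{\mathbf{L}}^{\star}\}=\mathbf{I}\delta$.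
   Context: An ordinary differential operator (ODO) is $\mathrm{L}=\sum_{n=0}^{N}a_n\mathrm{D}^n$ with real constants $a_n$, where $\mathrm{D}^n$ is the $n$th derivative on $\mathcal{D}'(\mathbb{R})$ and $\mathrm{D}^0$ is the identity. A $(D\times D)$ MDO is a matrix $\mathbf{L}=(\mathrm{L}_{r,c})_{r,c=1}^D$ of ODOs; it acts on $\mathbf{G}\in\mathcal{D}'(\mathbb{R},\mathbb{R}^{D\times D'})$ by $[\mathbf{L}\{\mathbf{G}\}]_{r,c}=\sum_{d=1}^D\mathrm{L}_{r,d}\{\mathrm{G}_{d,c}\}$. MDOs are composed as matrices, with products of entries replaced by composition. The determinant is the ODO $\det(\mathbf{L})=\sum_{\sigma}\mathrm{sgn}(\sigma)\mathrm{L}_{1,\sigma(1)}\circ\cdots\circ\mathrm{L}_{D,\sigma(D)}$ (sum over permutations of $\{1,\ldots,D\}$), and $\mathbf{L}$ is called invertible if $\det(\mathbf{L})\ne0$. The adjoint $\mathbf{L}^\star$ has entries $[\mathbf{L}^\star]_{r,c}=\mathrm{L}_{c,r}^\star$, with $(\mathrm{D}^n)^\star=(-1)^n\mathrm{D}^n$. An MDO $\mathbf{V}$ is unimodular if there is an MDO $\mathbf{V}^{-1}$ with $\mathbf{V}\circ\mathbf{V}^{-1}=\mathbf{V}^{-1}\circ\mathbf{V}=\mathbf{I}$. (Every invertible MDO admits a factorization $\mathbf{U}\circ\mathbf{D}\circ\mathbf{V}$ as in the claim, with $\det(\mathbf{D})=\pm\det(\mathbf{L})$; this is the known Smith form.)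 A Green's matrix of $\mathbf{L}$ is $\mathbf{G}\in\mathcal{D}'(\mathbb{R},\mathbb{R}^{D\times D})$ with $\mathbf{L}\{\mathbf{G}\}=\mathbf{I}\delta$, where $\mathbf{I}$ is the identity matrix and $\delta$ the Dirac distribution. A distribution is causal if it is supported in $[0,\infty)$ and anti-causal if it is supported in $(-\infty,0]$. The causal Green's function $g_{\mathrm{L}}$ of a nonzero ODO $\mathrm{L}$ is the unique causal distribution with $\mathrm{L}\{g_{\mathrm{L}}\}=\delta$. Matrix convolution is $[\mathbf{G}\ast\mathbf{H}]_{i,j}=\sum_k\mathrm{G}_{i,k}\ast\mathrm{H}_{k,j}$. The adjoint $\mathbf{G}_{\mathbf{L}}^\star$ is the kernel such that $\langle\mathbf{G}_{\mathbf{L}}\ast\boldsymbol{\phi},\boldsymbol{\psi}\rangle=\langle\boldsymbol{\phi},\mathbf{G}_{\mathbf{L}}^\star\ast\boldsymbol{\psi}\rangle$ for all $\boldsymbol{\phi},\boldsymbol{\psi}\in\mathcal{D}(\mathbb{R},\mathbb{R}^D)$ (compactly supported smooth functions). *)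

theory Defs
  imports "HOL-Analysis.Analysis" "HOL-Computational_Algebra.Polynomial"
begin

section \<open>Test functions\<close>

definition smooth :: "(real \<Rightarrow> real) \<Rightarrow> bool" where
  "smooth f \<longleftrightarrow> (\<forall>n x. (deriv ^^ n) f differentiable (at x))"

definition fsupp :: "(real \<Rightarrow> real) \<Rightarrow> real set" where
  "fsupp f = closure {x. f x \<noteq> 0}"

lemma smooth_coinduct:
  assumes "f \<in> S" and "\<And>h x. h \<in> S \<Longrightarrow> h differentiable (at x)" and "\<And>h. h \<in> S \<Longrightarrow> deriv h \<in> S"
  shows "smooth f"
proof -
  have "(deriv ^^ n) f \<in> S" for n
    by (induction n) (use assms in auto)
  then show ?thesis
    unfolding smooth_def using assms(2) by blast
qed

lemma smooth_differentiable: "smooth f \<Longrightarrow> f differentiable (at x)"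
  unfolding smooth_def by (metis funpow_0)

lemma smooth_DERIV: "smooth f \<Longrightarrow> (f has_field_derivative deriv f x) (at x)"
  using smooth_differentiable DERIV_deriv_iff_real_differentiable by blast

lemma smooth_deriv: "smooth f \<Longrightarrow> smooth (deriv f)"
  unfolding smooth_def by (metis comp_apply funpow_Suc_right)

lemma smooth_funpow_deriv: "smooth f \<Longrightarrow> smooth ((deriv ^^ n) f)"
  by (induction n) (auto intro: smooth_deriv)

lemma smooth_zero: "smooth (\<lambda>x. 0)"
  by (rule smooth_coinduct[of _ "{\<lambda>x. 0}"]) auto

lemma deriv_add_smooth:
  assumes "smooth f" "smooth g" shows "deriv (\<lambda>x. f x + g x) = (\<lambda>x. deriv f x + deriv g x)"
  by (rule ext, rule DERIV_imp_deriv) (intro DERIV_add smooth_DERIV assms)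

lemma deriv_cmult_smooth:
  assumes "smooth f" shows "deriv (\<lambda>x. c * f x) = (\<lambda>x. c * deriv f x)"
  by (rule ext, rule DERIV_imp_deriv) (intro DERIV_cmult smooth_DERIV assms)

lemma deriv_affine_smooth:
  assumes "smooth f" shows "deriv (\<lambda>x. f (a + b * x)) = (\<lambda>x. b * deriv f (a + b * x))"
proof (rule ext, rule DERIV_imp_deriv)
  fix x
  have "((\<lambda>x. f (a + b * x)) has_field_derivative deriv f (a + b * x) * b) (at x)"
    by (rule DERIV_chain2[OF smooth_DERIV[OF assms]]) (auto intro!: derivative_eq_intros)
  then show "((\<lambda>x. f (a + b * x)) has_field_derivative b * deriv f (a + b * x)) (at x)"
    by (simp add: mult.commute)
qed

lemma smooth_add: assumes "smooth f" "smooth g" shows "smooth (\<lambda>x. f x + g x)"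
proof -
  define S where "S = (\<lambda>(f, g) x. f x + g x :: real) ` ({f. smooth f} \<times> {g. smooth g})"
  have SI: "(\<lambda>x. f x + g x) \<in> S" if "smooth f" "smooth g" for f g
    unfolding S_def by (rule image_eqI[of _ _ "(f, g)"]) (use that in auto)
  have SE: "\<exists>f g. smooth f \<and> smooth g \<and> h = (\<lambda>x. f x + g x)" if "h \<in> S" for h
    using that unfolding S_def by auto
  show ?thesis
  proof (rule smooth_coinduct[of _ S])
    fix h assume "h \<in> S"
    then obtain f g where h: "smooth f" "smooth g" "h = (\<lambda>x. f x + g x)" using SE by blast
    show "h differentiable at x" for x
      unfolding h(3) by (rule differentiable_add; rule smooth_differentiable; fact)
    show "deriv h \<in> S"
      unfolding h(3) deriv_add_smooth[OF h(1,2)] by (rule SI; rule smooth_deriv; fact)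
  qed (rule SI[OF assms])
qed

lemma smooth_affine: assumes "smooth f" shows "smooth (\<lambda>x. c * f (a + b * x))"
proof -
  define S where "S = (\<lambda>(c, f) x. c * f (a + b * x) :: real) ` (UNIV \<times> {f. smooth f})"
  have SI: "(\<lambda>x. c * f (a + b * x)) \<in> S" if "smooth f" for c f
    unfolding S_def by (rule image_eqI[of _ _ "(c, f)"]) (use that in auto)
  have SE: "\<exists>c f. smooth f \<and> h = (\<lambda>x. c * f (a + b * x))" if "h \<in> S" for h
    using that unfolding S_def by auto
  have D: "((\<lambda>x. c * f (a + b * x)) has_field_derivative (c * b) * deriv f (a + b * x)) (at x)"
    if "smooth f" for c f x
  proof -
    have "((\<lambda>x. f (a + b * x)) has_field_derivative deriv f (a + b * x) * b) (at x)"
      by (rule DERIV_chain2[OF smooth_DERIV[OF that]]) (auto intro!: derivative_eq_intros)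
    moreover have "c * (deriv f (a + b * x) * b) = (c * b) * deriv f (a + b * x)"
      by simp
    ultimately show ?thesis using DERIV_cmult[of _ _ x UNIV c] by metis
  qed
  show ?thesis
  proof (rule smooth_coinduct[of _ S])
    fix h assume "h \<in> S"
    then obtain c f where h: "smooth f" "h = (\<lambda>x. c * f (a + b * x))" using SE by blast
    show "h differentiable at x" for x
      unfolding h(2) real_differentiable_def using D[OF h(1)] by (rule exI)
    have "deriv h = (\<lambda>x. (c * b) * deriv f (a + b * x))"
      unfolding h(2) by (rule ext, rule DERIV_imp_deriv, rule D, fact)
    then show "deriv h \<in> S" by (simp only: SI smooth_deriv[OF h(1)])
  qed (rule SI[OF assms])
qed

lemma smooth_cmult: "smooth f \<Longrightarrow> smooth (\<lambda>x. c * f x)"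
  using smooth_affine[of f c 0 1] by simp

lemma funpow_deriv_add:
  assumes "smooth f" "smooth g"
  shows "(deriv ^^ n) (\<lambda>x. f x + g x) = (\<lambda>x. (deriv ^^ n) f x + (deriv ^^ n) g x)"
  by (induction n) (auto simp: deriv_add_smooth smooth_funpow_deriv assms)

lemma funpow_deriv_affine:
  assumes "smooth f"
  shows "(deriv ^^ n) (\<lambda>x. c * f (a + b * x)) = (\<lambda>x. c * b ^ n * (deriv ^^ n) f (a + b * x))"
proof (induction n)
  case (Suc n)
  have "smooth (\<lambda>x. (deriv ^^ n) f (a + b * x))"
    using smooth_affine[OF smooth_funpow_deriv[OF assms], of 1] by simp
  then have "deriv (\<lambda>x. (c * b ^ n) * (deriv ^^ n) f (a + b * x))
      = (\<lambda>x. (c * b ^ n) * (b * deriv ((deriv ^^ n) f) (a + b * x)))"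
    by (simp only: deriv_cmult_smooth deriv_affine_smooth smooth_funpow_deriv assms)
  then show ?case
    using Suc by (simp add: mult.assoc mult.left_commute)
qed simp

lemma compact_fsuppI:
  assumes "compact K" "\<And>x. x \<notin> K \<Longrightarrow> f x = 0" shows "compact (fsupp f)"
proof -
  have "fsupp f \<subseteq> K"
    unfolding fsupp_def by (rule closure_minimal) (use assms compact_imp_closed in auto)
  then show ?thesis
    using assms(1) by (metis closed_closure compact_Int_closed fsupp_def inf.absorb2)
qed

lemma not_in_fsupp: "x \<notin> fsupp f \<Longrightarrow> f x = 0"
  unfolding fsupp_def using subsetD[OF closure_subset, of x "{x. f x \<noteq> 0}"] by auto

lemma deriv_not_in_fsupp: assumes "x \<notin> fsupp f" shows "deriv f x = 0"
proof -
  have "open (- fsupp f)" unfolding fsupp_def by auto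
  then have "eventually (\<lambda>y. f y = 0) (nhds x)"
    using assms unfolding eventually_nhds by (intro exI[of _ "- fsupp f"]) (auto intro: not_in_fsupp[of _ f])
  then have "deriv f x = deriv (\<lambda>_. 0) x" by (rule deriv_cong_ev) simp
  then show ?thesis by simp
qed

typedef test_fun = "{\<phi>. smooth \<phi> \<and> compact (fsupp \<phi>)}"
  morphisms tapp Abs_test_fun
  by (rule exI[of _ "\<lambda>x. 0"]) (auto simp: smooth_zero fsupp_def)

setup_lifting type_definition_test_fun

lemma smooth_tapp [simp]: "smooth (tapp \<phi>)" and compact_fsupp_tapp [simp]: "compact (fsupp (tapp \<phi>))"
  using tapp[of \<phi>] by auto

lemma test_fun_eqI: "(\<And>x. tapp \<phi> x = tapp \<psi> x) \<Longrightarrow> \<phi> = \<psi>"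
  by (metis ext tapp_inject)

instantiation test_fun :: real_vector
begin

lift_definition zero_test_fun :: test_fun is "\<lambda>x. 0"
  by (auto simp: smooth_zero fsupp_def)

lift_definition plus_test_fun :: "test_fun \<Rightarrow> test_fun \<Rightarrow> test_fun" is "\<lambda>\<phi> \<psi> x. \<phi> x + \<psi> x"
proof -
  fix f g :: "real \<Rightarrow> real"
  assume fg: "smooth f \<and> compact (fsupp f)" "smooth g \<and> compact (fsupp g)"
  have "compact (fsupp (\<lambda>x. f x + g x))"
    by (rule compact_fsuppI[of "fsupp f \<union> fsupp g"]) (use fg in \<open>simp_all add: compact_Un not_in_fsupp[of _ f] not_in_fsupp[of _ g]\<close>)
  then show "smooth (\<lambda>x. f x + g x) \<and> compact (fsupp (\<lambda>x. f x + g x))"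
    using fg smooth_add[of f g] by simp
qed

lift_definition scaleR_test_fun :: "real \<Rightarrow> test_fun \<Rightarrow> test_fun" is "\<lambda>c \<phi> x. c * \<phi> x"
proof -
  fix c and f :: "real \<Rightarrow> real"
  assume f: "smooth f \<and> compact (fsupp f)"
  have "compact (fsupp (\<lambda>x. c * f x))"
    by (rule compact_fsuppI[of "fsupp f"]) (use f in \<open>simp_all add: not_in_fsupp[of _ f]\<close>)
  then show "smooth (\<lambda>x. c * f x) \<and> compact (fsupp (\<lambda>x. c * f x))"
    using f smooth_cmult[of f c] by simp
qed

definition uminus_test_fun :: "test_fun \<Rightarrow> test_fun" where "uminus_test_fun \<phi> = (-1) *\<^sub>R \<phi>"

definition minus_test_fun :: "test_fun \<Rightarrow> test_fun \<Rightarrow> test_fun" where "minus_test_fun \<phi> \<psi> = \<phi> + (- \<psi>)"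

instance
  by standard
    (auto intro!: test_fun_eqI simp: plus_test_fun.rep_eq zero_test_fun.rep_eq scaleR_test_fun.rep_eq
      uminus_test_fun_def minus_test_fun_def algebra_simps)

end

lemma tapp_zero [simp]: "tapp 0 = (\<lambda>x. 0)"
  and tapp_add [simp]: "tapp (\<phi> + \<psi>) = (\<lambda>x. tapp \<phi> x + tapp \<psi> x)"
  and tapp_scaleR [simp]: "tapp (c *\<^sub>R \<phi>) = (\<lambda>x. c * tapp \<phi> x)"
  by (simp_all add: zero_test_fun.rep_eq plus_test_fun.rep_eq scaleR_test_fun.rep_eq)

lift_definition tderiv :: "test_fun \<Rightarrow> test_fun" is deriv
  by (metis smooth_deriv compact_fsuppI deriv_not_in_fsupp)

lift_definition ttranslate :: "real \<Rightarrow> test_fun \<Rightarrow> test_fun" is "\<lambda>h \<phi> x. \<phi> (x + h)"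
proof -
  fix h and f :: "real \<Rightarrow> real"
  assume f: "smooth f \<and> compact (fsupp f)"
  have "compact ((\<lambda>x. -h + x) ` fsupp f)" using f compact_translation by blast
  moreover have "f (x + h) = 0" if "x \<notin> (\<lambda>x. -h + x) ` fsupp f" for x
  proof (rule not_in_fsupp[of "x + h" f])
    show "x + h \<notin> fsupp f" using that by (auto simp: image_iff)
  qed
  ultimately show "smooth (\<lambda>x. f (x + h)) \<and> compact (fsupp (\<lambda>x. f (x + h)))"
    using smooth_affine[of f 1 h 1] f compact_fsuppI[of _ "\<lambda>x. f (x + h)"] by (simp add: add.commute)
qed

lift_definition treflect :: "test_fun \<Rightarrow> test_fun" is "\<lambda>\<phi> x. \<phi> (- x)"
proof -
  fix f :: "real \<Rightarrow> real"
  assume f: "smooth f \<and> compact (fsupp f)"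
  have "compact (uminus ` fsupp f)" using f compact_negations by blast
  moreover have "f (- x) = 0" if "x \<notin> uminus ` fsupp f" for x
  proof (rule not_in_fsupp[of "- x" f])
    show "- x \<notin> fsupp f" using that by (auto simp: image_iff)
  qed
  ultimately show "smooth (\<lambda>x. f (- x)) \<and> compact (fsupp (\<lambda>x. f (- x)))"
    using smooth_affine[of f 1 0 "-1"] f compact_fsuppI[of _ "\<lambda>x. f (- x)"] by simp
qed

lemma tapp_tderiv: "tapp (tderiv \<phi>) = deriv (tapp \<phi>)"
  and tapp_ttranslate: "tapp (ttranslate h \<phi>) x = tapp \<phi> (x + h)"
  and tapp_treflect: "tapp (treflect \<phi>) x = tapp \<phi> (- x)"
  by (simp_all add: tderiv.rep_eq ttranslate.rep_eq treflect.rep_eq)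

definition sup_deriv :: "nat \<Rightarrow> test_fun \<Rightarrow> real" where
  "sup_deriv n \<phi> = (SUP x. \<bar>(deriv ^^ n) (tapp \<phi>) x\<bar>)"

lemma fsupp_tderiv: "fsupp (tapp (tderiv \<phi>)) \<subseteq> fsupp (tapp \<phi>)"
  unfolding fsupp_def[of "tapp (tderiv \<phi>)"]
proof (rule closure_minimal)
  show "{x. tapp (tderiv \<phi>) x \<noteq> 0} \<subseteq> fsupp (tapp \<phi>)"
    using deriv_not_in_fsupp[of _ "tapp \<phi>"] by (auto simp: tapp_tderiv)
qed (simp add: compact_imp_closed)

lemma tapp_bdd: "bdd_above (range (\<lambda>x. \<bar>tapp \<phi> x\<bar>))"
proof -
  have "continuous_on (fsupp (tapp \<phi>)) (tapp \<phi>)"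
    using smooth_DERIV[OF smooth_tapp] by (meson DERIV_isCont continuous_at_imp_continuous_on)
  then have "bounded (tapp \<phi> ` fsupp (tapp \<phi>))"
    using compact_continuous_image compact_imp_bounded compact_fsupp_tapp by blast
  then obtain B where "\<And>x. x \<in> fsupp (tapp \<phi>) \<Longrightarrow> \<bar>tapp \<phi> x\<bar> \<le> B"
    by (auto simp: bounded_iff)
  then have "\<bar>tapp \<phi> x\<bar> \<le> max B 0" for x
    by (cases "x \<in> fsupp (tapp \<phi>)") (force simp: not_in_fsupp[of _ "tapp \<phi>"])+
  then show ?thesis by (meson bdd_aboveI2)
qed

lemma tapp_funpow_tderiv: "tapp ((tderiv ^^ n) \<phi>) = (deriv ^^ n) (tapp \<phi>)"
  by (induction n) (auto simp: tapp_tderiv)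

lemma sup_deriv_bound: "\<bar>(deriv ^^ n) (tapp \<phi>) x\<bar> \<le> sup_deriv n \<phi>"
  unfolding sup_deriv_def using tapp_bdd[of "(tderiv ^^ n) \<phi>"]
  by (auto simp: tapp_funpow_tderiv intro: cSUP_upper2)

lemma sup_deriv_nonneg: "0 \<le> sup_deriv n \<phi>"
  using sup_deriv_bound[of n \<phi> 0] by linarith

lemma sup_deriv_tderiv: "sup_deriv n (tderiv \<phi>) = sup_deriv (Suc n) \<phi>"
  unfolding sup_deriv_def tapp_tderiv by (simp only: funpow_Suc_right comp_apply)

lemma sup_deriv_treflect: "sup_deriv n (treflect \<phi>) = sup_deriv n \<phi>"
proof -
  have "tapp (treflect \<phi>) = (\<lambda>x. 1 * tapp \<phi> (0 + (-1) * x))" by (auto simp: tapp_treflect)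
  then have "\<bar>(deriv ^^ n) (tapp (treflect \<phi>)) x\<bar> = \<bar>(deriv ^^ n) (tapp \<phi>) (- x)\<bar>" for x
    using fun_cong[OF funpow_deriv_affine[OF smooth_tapp[of \<phi>], where n = n and c = 1 and a = 0 and b = "-1"], of x]
    by (simp add: abs_mult power_abs)
  then have "range (\<lambda>x. \<bar>(deriv ^^ n) (tapp (treflect \<phi>)) x\<bar>)
      = (\<lambda>x. \<bar>(deriv ^^ n) (tapp \<phi>) x\<bar>) ` range uminus"
    unfolding image_image by simp
  then show ?thesis by (simp add: sup_deriv_def del: range_composition)
qed

lemma fsupp_treflect: "fsupp (tapp (treflect \<phi>)) \<subseteq> uminus ` fsupp (tapp \<phi>)"
  unfolding fsupp_def[of "tapp (treflect \<phi>)"]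
proof (rule closure_minimal)
  show "{x. tapp (treflect \<phi>) x \<noteq> 0} \<subseteq> uminus ` fsupp (tapp \<phi>)"
  proof
    fix x assume "x \<in> {x. tapp (treflect \<phi>) x \<noteq> 0}"
    then have "- x \<in> fsupp (tapp \<phi>)"
      using not_in_fsupp[of "- x" "tapp \<phi>"] by (auto simp: tapp_treflect)
    then show "x \<in> uminus ` fsupp (tapp \<phi>)"
      by (rule rev_image_eqI) simp
  qed
  show "closed (uminus ` fsupp (tapp \<phi>))"
    by (intro compact_imp_closed compact_negations compact_fsupp_tapp)
qed


section \<open>Distributions\<close>

definition dist_continuous :: "(test_fun \<Rightarrow> real) \<Rightarrow> bool" where
  "dist_continuous T \<longleftrightarrow> (\<forall>K. compact K \<longrightarrow>
     (\<exists>C N. \<forall>\<phi>. fsupp (tapp \<phi>) \<subseteq> K \<longrightarrow> \<bar>T \<phi>\<bar> \<le> C * (\<Sum>n\<le>N. sup_deriv n \<phi>)))"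

lemma dist_continuousE:
  assumes "dist_continuous T" "compact K"
  obtains C N where "C \<ge> 0"
    "\<And>\<phi> M. fsupp (tapp \<phi>) \<subseteq> K \<Longrightarrow> N \<le> M \<Longrightarrow> \<bar>T \<phi>\<bar> \<le> C * (\<Sum>n\<le>M. sup_deriv n \<phi>)"
proof -
  obtain C N where CN: "\<And>\<phi>. fsupp (tapp \<phi>) \<subseteq> K \<Longrightarrow> \<bar>T \<phi>\<bar> \<le> C * (\<Sum>n\<le>N. sup_deriv n \<phi>)"
    using assms unfolding dist_continuous_def by blast
  have "\<bar>T \<phi>\<bar> \<le> max C 0 * (\<Sum>n\<le>M. sup_deriv n \<phi>)" if "fsupp (tapp \<phi>) \<subseteq> K" "N \<le> M" for \<phi> M
  proof -
    have "\<bar>T \<phi>\<bar> \<le> C * (\<Sum>n\<le>N. sup_deriv n \<phi>)" by (rule CN[OF that(1)])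
    also have "\<dots> \<le> max C 0 * (\<Sum>n\<le>M. sup_deriv n \<phi>)"
      using that(2) by (intro mult_mono sum_mono2 sum_nonneg) (auto simp: sup_deriv_nonneg)
    finally show ?thesis .
  qed
  then show ?thesis using that[of "max C 0" N] by simp
qed

lemma dist_continuous_zero: "dist_continuous (\<lambda>\<phi>. 0)"
  unfolding dist_continuous_def by (intro allI impI exI[of _ 0]) simp

typedef distribution = "{T :: test_fun \<Rightarrow> real. linear T \<and> dist_continuous T}"
  morphisms dapp Abs_distribution
proof
  show "(\<lambda>\<phi>. 0) \<in> {T :: test_fun \<Rightarrow> real. linear T \<and> dist_continuous T}"
    by (simp add: linear_zero dist_continuous_zero)
qed

setup_lifting type_definition_distribution

lemma linear_dapp: "linear (dapp T)" and dist_continuous_dapp: "dist_continuous (dapp T)"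
  using dapp[of T] by auto

lemma distribution_eqI: "(\<And>\<phi>. dapp S \<phi> = dapp T \<phi>) \<Longrightarrow> S = T"
  by (metis ext dapp_inject)

instantiation distribution :: real_vector
begin

lift_definition zero_distribution :: distribution is "\<lambda>\<phi>. 0"
  by (simp add: linear_zero dist_continuous_zero)

lift_definition plus_distribution :: "distribution \<Rightarrow> distribution \<Rightarrow> distribution" is "\<lambda>S T \<phi>. S \<phi> + T \<phi>"
proof
  fix S T :: "test_fun \<Rightarrow> real"
  assume ST: "linear S \<and> dist_continuous S" "linear T \<and> dist_continuous T"
  show "linear (\<lambda>\<phi>. S \<phi> + T \<phi>)" using ST by (intro linear_compose_add) auto
  show "dist_continuous (\<lambda>\<phi>. S \<phi> + T \<phi>)"
    unfolding dist_continuous_def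
  proof (intro allI impI)
    fix K :: "real set" assume K: "compact K"
    obtain C N where 1: "\<And>\<phi> M. fsupp (tapp \<phi>) \<subseteq> K \<Longrightarrow> N \<le> M \<Longrightarrow> \<bar>S \<phi>\<bar> \<le> C * (\<Sum>n\<le>M. sup_deriv n \<phi>)"
      using dist_continuousE[of S K] ST K by metis
    obtain C' N' where 2: "\<And>\<phi> M. fsupp (tapp \<phi>) \<subseteq> K \<Longrightarrow> N' \<le> M \<Longrightarrow> \<bar>T \<phi>\<bar> \<le> C' * (\<Sum>n\<le>M. sup_deriv n \<phi>)"
      using dist_continuousE[of T K] ST K by metis
    have "\<bar>S \<phi> + T \<phi>\<bar> \<le> (C + C') * (\<Sum>n\<le>max N N'. sup_deriv n \<phi>)" if "fsupp (tapp \<phi>) \<subseteq> K" for \<phi>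
      using 1[OF that, of "max N N'"] 2[OF that, of "max N N'"] by (simp add: distrib_right)
    then show "\<exists>C N. \<forall>\<phi>. fsupp (tapp \<phi>) \<subseteq> K \<longrightarrow> \<bar>S \<phi> + T \<phi>\<bar> \<le> C * (\<Sum>n\<le>N. sup_deriv n \<phi>)"
      by blast
  qed
qed

lift_definition scaleR_distribution :: "real \<Rightarrow> distribution \<Rightarrow> distribution" is "\<lambda>c T \<phi>. c * T \<phi>"
proof
  fix c and T :: "test_fun \<Rightarrow> real"
  assume T: "linear T \<and> dist_continuous T"
  show "linear (\<lambda>\<phi>. c * T \<phi>)" using T linear_compose_scale_right[of T c] by simp
  show "dist_continuous (\<lambda>\<phi>. c * T \<phi>)"
    unfolding dist_continuous_def
  proof (intro allI impI)
    fix K :: "real set" assume K: "compact K"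
    obtain C N where 1: "\<And>\<phi>. fsupp (tapp \<phi>) \<subseteq> K \<Longrightarrow> \<bar>T \<phi>\<bar> \<le> C * (\<Sum>n\<le>N. sup_deriv n \<phi>)"
      using T K unfolding dist_continuous_def by blast
    have "\<bar>c * T \<phi>\<bar> \<le> (\<bar>c\<bar> * C) * (\<Sum>n\<le>N. sup_deriv n \<phi>)" if "fsupp (tapp \<phi>) \<subseteq> K" for \<phi>
      using mult_left_mono[OF 1[OF that], of "\<bar>c\<bar>"] by (simp add: abs_mult mult.assoc)
    then show "\<exists>C N. \<forall>\<phi>. fsupp (tapp \<phi>) \<subseteq> K \<longrightarrow> \<bar>c * T \<phi>\<bar> \<le> C * (\<Sum>n\<le>N. sup_deriv n \<phi>)"
      by blast
  qed
qed

definition uminus_distribution :: "distribution \<Rightarrow> distribution" where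
  "uminus_distribution T = (-1) *\<^sub>R T"

definition minus_distribution :: "distribution \<Rightarrow> distribution \<Rightarrow> distribution" where
  "minus_distribution S T = S + (- T)"

instance
  by standard
    (auto intro!: distribution_eqI simp: plus_distribution.rep_eq zero_distribution.rep_eq
      scaleR_distribution.rep_eq uminus_distribution_def minus_distribution_def algebra_simps)

end

lemma dapp_zero [simp]: "dapp 0 \<phi> = 0"
  and dapp_add [simp]: "dapp (S + T) \<phi> = dapp S \<phi> + dapp T \<phi>"
  and dapp_scaleR [simp]: "dapp (c *\<^sub>R T) \<phi> = c * dapp T \<phi>"
  by (simp_all add: zero_distribution.rep_eq plus_distribution.rep_eq scaleR_distribution.rep_eq)

lift_definition dderiv :: "distribution \<Rightarrow> distribution" is "\<lambda>T \<phi>. - T (tderiv \<phi>)"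
proof
  fix T :: "test_fun \<Rightarrow> real"
  assume T: "linear T \<and> dist_continuous T"
  have "tderiv (\<phi> + \<psi>) = tderiv \<phi> + tderiv \<psi>" "tderiv (c *\<^sub>R \<phi>) = c *\<^sub>R tderiv \<phi>" for \<phi> \<psi> c
    by (auto intro!: test_fun_eqI simp: tapp_tderiv deriv_add_smooth deriv_cmult_smooth)
  then show "linear (\<lambda>\<phi>. - T (tderiv \<phi>))"
    using T by (auto intro!: linearI simp: linear_add linear_scale)
  show "dist_continuous (\<lambda>\<phi>. - T (tderiv \<phi>))"
    unfolding dist_continuous_def
  proof (intro allI impI)
    fix K :: "real set" assume K: "compact K"
    obtain C N where 0: "C \<ge> 0"
      and 1: "\<And>\<phi> M. fsupp (tapp \<phi>) \<subseteq> K \<Longrightarrow> N \<le> M \<Longrightarrow> \<bar>T \<phi>\<bar> \<le> C * (\<Sum>n\<le>M. sup_deriv n \<phi>)"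
      using dist_continuousE[of T K] T K by metis
    have "\<bar>- T (tderiv \<phi>)\<bar> \<le> C * (\<Sum>n\<le>Suc N. sup_deriv n \<phi>)" if "fsupp (tapp \<phi>) \<subseteq> K" for \<phi>
    proof -
      have "\<bar>- T (tderiv \<phi>)\<bar> \<le> C * (\<Sum>n\<le>N. sup_deriv (Suc n) \<phi>)"
        using 1[of "tderiv \<phi>" N] that fsupp_tderiv[of \<phi>] by (auto simp: sup_deriv_tderiv)
      also have "\<dots> \<le> C * (\<Sum>n\<le>Suc N. sup_deriv n \<phi>)"
        unfolding sum.atMost_Suc_shift using 0 by (intro mult_left_mono) (auto simp: sup_deriv_nonneg)
      finally show ?thesis .
    qed
    then show "\<exists>C N. \<forall>\<phi>. fsupp (tapp \<phi>) \<subseteq> K \<longrightarrow> \<bar>- T (tderiv \<phi>)\<bar> \<le> C * (\<Sum>n\<le>N. sup_deriv n \<phi>)"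
      by blast
  qed
qed

lift_definition dreflect :: "distribution \<Rightarrow> distribution" is "\<lambda>T \<phi>. T (treflect \<phi>)"
proof
  fix T :: "test_fun \<Rightarrow> real"
  assume T: "linear T \<and> dist_continuous T"
  have "treflect (\<phi> + \<psi>) = treflect \<phi> + treflect \<psi>" "treflect (c *\<^sub>R \<phi>) = c *\<^sub>R treflect \<phi>" for \<phi> \<psi> c
    by (auto intro!: test_fun_eqI simp: tapp_treflect)
  then show "linear (\<lambda>\<phi>. T (treflect \<phi>))"
    using T by (auto intro!: linearI simp: linear_add linear_scale)
  show "dist_continuous (\<lambda>\<phi>. T (treflect \<phi>))"
    unfolding dist_continuous_def
  proof (intro allI impI)
    fix K :: "real set" assume "compact K"
    then have "compact (uminus ` K)" using compact_negations by blast
    then obtain C N where "\<And>\<phi>. fsupp (tapp \<phi>) \<subseteq> uminus ` K \<Longrightarrow> \<bar>T \<phi>\<bar> \<le> C * (\<Sum>n\<le>N. sup_deriv n \<phi>)"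
      using T unfolding dist_continuous_def by blast
    then have "\<bar>T (treflect \<phi>)\<bar> \<le> C * (\<Sum>n\<le>N. sup_deriv n \<phi>)" if "fsupp (tapp \<phi>) \<subseteq> K" for \<phi>
      using subset_trans[OF fsupp_treflect image_mono[OF that, of uminus]]
      by (metis (no_types, lifting) sum.cong sup_deriv_treflect)
    then show "\<exists>C N. \<forall>\<phi>. fsupp (tapp \<phi>) \<subseteq> K \<longrightarrow> \<bar>T (treflect \<phi>)\<bar> \<le> C * (\<Sum>n\<le>N. sup_deriv n \<phi>)"
      by blast
  qed
qed

lift_definition dirac :: distribution is "\<lambda>\<phi>. tapp \<phi> 0"
proof
  show "linear (\<lambda>\<phi>. tapp \<phi> 0)" by (auto intro!: linearI)
  show "dist_continuous (\<lambda>\<phi>. tapp \<phi> 0)"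
    unfolding dist_continuous_def using sup_deriv_bound[of 0 _ 0]
    by (intro allI impI exI[of _ 1] exI[of _ 0]) auto
qed

lemma dapp_dderiv: "dapp (dderiv T) \<phi> = - dapp T (tderiv \<phi>)"
  and dapp_dreflect: "dapp (dreflect T) \<phi> = dapp T (treflect \<phi>)"
  and dapp_dirac: "dapp dirac \<phi> = tapp \<phi> 0"
  by (simp_all add: dderiv.rep_eq dreflect.rep_eq dirac.rep_eq)

definition dsupp :: "distribution \<Rightarrow> real set" where
  "dsupp T = - \<Union>{W. open W \<and> (\<forall>\<phi>. fsupp (tapp \<phi>) \<subseteq> W \<longrightarrow> dapp T \<phi> = 0)}"

text \<open>The pairing of a distribution \<open>T\<close> with a function \<open>f\<close> that need not have compact support:
  the value of \<open>T\<close> on any test function that coincides with \<open>f\<close> near \<open>dsupp T\<close>. Such a test function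
  exists when \<open>f\<close> is smooth and \<open>dsupp T \<inter> fsupp f\<close> is compact, and the value does not depend on it.\<close>

definition dapp_ext :: "distribution \<Rightarrow> (real \<Rightarrow> real) \<Rightarrow> real" where
  "dapp_ext T f = (THE v. \<exists>\<eta> W. open W \<and> dsupp T \<subseteq> W \<and> (\<forall>x\<in>W. tapp \<eta> x = f x) \<and> v = dapp T \<eta>)"

text \<open>Convolution, by \<open>\<langle>S \<ast> T, \<phi>\<rangle> = \<langle>S(x), \<langle>T(y), \<phi>(x + y)\<rangle>\<rangle>\<close>. This is meaningful in particular if both
  supports are bounded from below, where \<open>x \<mapsto> \<langle>T, \<phi>(x + \<cdot>)\<rangle>\<close> has support bounded from above.\<close>

definition dconv :: "distribution \<Rightarrow> distribution \<Rightarrow> distribution" where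
  "dconv S T = (THE U. \<forall>\<phi>. dapp U \<phi> = dapp_ext S (\<lambda>x. dapp T (ttranslate x \<phi>)))"

text \<open>Convolution with a test function, the smooth function \<open>x \<mapsto> \<langle>T, \<phi>(x - \<cdot>)\<rangle>\<close>.\<close>

definition conv_test :: "distribution \<Rightarrow> test_fun \<Rightarrow> real \<Rightarrow> real" where
  "conv_test T \<phi> x = dapp T (ttranslate (- x) (treflect \<phi>))"


section \<open>Ordinary differential operators\<close>

text \<open>The operator with coefficients \<open>a\<^sub>n\<close> is encoded as the polynomial with these coefficients. Then
  composition is multiplication of polynomials (\<open>odo_app_mult\<close>), and a polynomial is determined by
  the operator on distributions that it represents (\<open>odo_app_inject\<close>).\<close>

type_synonym odo = "real poly"

definition odo_app :: "odo \<Rightarrow> distribution \<Rightarrow> distribution" where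
  "odo_app p T = (\<Sum>n\<le>degree p. coeff p n *\<^sub>R (dderiv ^^ n) T)"

lemma odo_app_altdef:
  assumes "degree p \<le> N" shows "odo_app p T = (\<Sum>n\<le>N. coeff p n *\<^sub>R (dderiv ^^ n) T)"
  unfolding odo_app_def
  by (rule sum.mono_neutral_left) (use assms in \<open>auto simp: coeff_eq_0\<close>)

lemma dderiv_add: "dderiv (S + T) = dderiv S + dderiv T"
  and dderiv_scaleR: "dderiv (c *\<^sub>R T) = c *\<^sub>R dderiv T"
  by (auto intro!: distribution_eqI simp: dapp_dderiv)

lemma odo_app_add: "odo_app (p + q) T = odo_app p T + odo_app q T"
proof -
  define N where "N = max (degree p) (degree q)"
  have "degree (p + q) \<le> N" "degree p \<le> N" "degree q \<le> N"
    by (auto simp: N_def degree_add_le_max)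
  then show ?thesis
    by (simp add: odo_app_altdef[of _ N] scaleR_add_left sum.distrib)
qed

lemma odo_app_smult: "odo_app (smult c p) T = c *\<^sub>R odo_app p T"
  by (simp add: odo_app_altdef[of _ "degree p"] degree_smult_le scaleR_sum_right)

lemma odo_app_diff: "odo_app (p - q) T = odo_app p T - odo_app q T"
  using odo_app_add[of "p - q" q T] by simp

lemma dderiv_odo_app: "dderiv (odo_app p T) = odo_app p (dderiv T)"
proof -
  have "dderiv 0 = 0" by (auto intro!: distribution_eqI simp: dapp_dderiv)
  then have "dderiv (\<Sum>n\<in>A. f n) = (\<Sum>n\<in>A. dderiv (f n))" for f :: "nat \<Rightarrow> distribution" and A
    by (induction A rule: infinite_finite_induct) (auto simp: dderiv_add)
  then show ?thesis
    by (simp add: odo_app_def dderiv_scaleR funpow_swap1)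
qed

lemma odo_app_pCons: "odo_app (pCons a p) T = a *\<^sub>R T + dderiv (odo_app p T)"
proof -
  have "odo_app (pCons a p) T = (\<Sum>n\<le>Suc (degree p). coeff (pCons a p) n *\<^sub>R (dderiv ^^ n) T)"
    by (rule odo_app_altdef) (rule degree_pCons_le)
  also have "\<dots> = a *\<^sub>R T + (\<Sum>n\<le>degree p. coeff p n *\<^sub>R (dderiv ^^ n) (dderiv T))"
    by (simp only: sum.atMost_Suc_shift coeff_pCons_0 coeff_pCons_Suc funpow_Suc_right comp_apply funpow_0)
  finally show ?thesis
    unfolding dderiv_odo_app by (simp only: odo_app_def[of p "dderiv T"])
qed

lemma odo_app_mult: "odo_app (p * q) T = odo_app p (odo_app q T)"
proof (induction p)
  case 0
  show ?case by (simp add: odo_app_def)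
next
  case (pCons a p)
  then show ?case by (simp add: odo_app_add odo_app_smult odo_app_pCons)
qed

text \<open>Existence of a nonzero test function, needed for \<open>odo_app_inject\<close>: the functions
  \<open>bump p k\<close> are closed under differentiation.\<close>

definition bump :: "real poly \<Rightarrow> nat \<Rightarrow> real \<Rightarrow> real" where
  "bump p k x = (if \<bar>x\<bar> < 1 then poly p x / (1 - x\<^sup>2) ^ k * exp (- 1 / (1 - x\<^sup>2)) else 0)"

lemma exp_inverse_bound: fixes u :: real assumes "u > 0" shows "exp (- 1 / u) \<le> fact m * u ^ m"
proof -
  have "(1 / u) ^ m /\<^sub>R fact m \<le> exp (1 / u)"
    unfolding exp_def using sum_le_suminf[of "\<lambda>n. (1 / u) ^ n /\<^sub>R fact n" "{m}"] assms
    by (simp add: summable_exp)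
  then show ?thesis
    using assms by (simp add: exp_minus field_simps)
qed

definition bump_deriv_poly :: "real poly \<Rightarrow> nat \<Rightarrow> real poly" where
  "bump_deriv_poly p k = pderiv p * [:1, 0, -1:]\<^sup>2 + smult (2 * real k) ([:0, 1:] * p * [:1, 0, -1:])
     - smult 2 ([:0, 1:] * p)"

lemma abs_less_1_imp_pos: "\<bar>x\<bar> < 1 \<Longrightarrow> 0 < 1 - x\<^sup>2" for x :: real
  by (simp add: abs_square_less_1)

lemma bump_has_derivative: "(bump p k has_field_derivative bump (bump_deriv_poly p k) (k + 2) x) (at x)"
proof -
  consider "\<bar>x\<bar> < 1" | "\<bar>x\<bar> > 1" | "\<bar>x\<bar> = 1" by linarith
  then show ?thesis
  proof cases
    case 1
    define u where "u = 1 - x\<^sup>2"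
    have u: "u > 0" using abs_less_1_imp_pos[OF 1] by (simp add: u_def)
    have "((\<lambda>x. poly p x / (1 - x\<^sup>2) ^ k * exp (- 1 / (1 - x\<^sup>2))) has_field_derivative
       (poly (pderiv p) x * u ^ k - poly p x * (real k * (- (2 * x) * u ^ (k - 1)))) / (u ^ k * u ^ k) * exp (- 1 / u)
        + poly p x / u ^ k * (exp (- 1 / u) * (- (2 * x) / u\<^sup>2))) (at x)"
    proof -
      have du: "((\<lambda>x. 1 - x\<^sup>2) has_field_derivative - (2 * x)) (at x)"
        by (auto intro!: derivative_eq_intros)
      have dk: "((\<lambda>x. (1 - x\<^sup>2) ^ k) has_field_derivative real k * (- (2 * x) * u ^ (k - 1))) (at x)"
        using DERIV_power[OF du, of k] by (simp add: u_def mult_ac)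
      have "((\<lambda>x. - 1 / (1 - x\<^sup>2)) has_field_derivative (- (2 * x) / u\<^sup>2)) (at x)"
        using DERIV_divide[OF DERIV_const[of "-1"] du] u by (simp add: u_def power2_eq_square)
      then have de: "((\<lambda>x. exp (- 1 / (1 - x\<^sup>2))) has_field_derivative exp (- 1 / u) * (- (2 * x) / u\<^sup>2)) (at x)"
        unfolding u_def by (rule DERIV_fun_exp)
      have "((\<lambda>x. poly p x / (1 - x\<^sup>2) ^ k) has_field_derivative
         (poly (pderiv p) x * u ^ k - poly p x * (real k * (- (2 * x) * u ^ (k - 1)))) / (u ^ k * u ^ k)) (at x)"
        using DERIV_divide[OF poly_DERIV[of p x] dk] u by (simp add: u_def)
      from DERIV_mult[OF this de] show ?thesis
        by (simp only: u_def add.commute mult.commute)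
    qed
    moreover have "(poly (pderiv p) x * u ^ k - poly p x * (real k * (- (2 * x) * u ^ (k - 1)))) / (u ^ k * u ^ k) * exp (- 1 / u)
        + poly p x / u ^ k * (exp (- 1 / u) * (- (2 * x) / u\<^sup>2))
        = bump (bump_deriv_poly p k) (k + 2) x"
    proof -
      have e: "real k * u ^ (k - 1) = real k * u ^ k / u" using u by (cases k) auto
      have "bump (bump_deriv_poly p k) (k + 2) x
         = (poly (pderiv p) x * u\<^sup>2 + 2 * real k * x * poly p x * u - 2 * x * poly p x) / (u ^ k * u\<^sup>2) * exp (- 1 / u)"
        using 1 by (simp add: bump_def bump_deriv_poly_def u_def power_add power2_eq_square algebra_simps)
      also have "\<dots> = (poly (pderiv p) x * u ^ k + 2 * x * poly p x * (real k * u ^ k / u)) / (u ^ k * u ^ k) * exp (- 1 / u)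
        + poly p x / u ^ k * (exp (- 1 / u) * (- (2 * x) / u\<^sup>2))"
        using u by (simp add: field_simps power2_eq_square)
      also have "\<dots> = (poly (pderiv p) x * u ^ k - poly p x * (real k * (- (2 * x) * u ^ (k - 1)))) / (u ^ k * u ^ k) * exp (- 1 / u)
        + poly p x / u ^ k * (exp (- 1 / u) * (- (2 * x) / u\<^sup>2))"
        unfolding e[symmetric] by (simp add: algebra_simps)
      finally show ?thesis by simp
    qed
    ultimately have "((\<lambda>x. poly p x / (1 - x\<^sup>2) ^ k * exp (- 1 / (1 - x\<^sup>2))) has_field_derivative
        bump (bump_deriv_poly p k) (k + 2) x) (at x)"
      by simp
    then show ?thesis
      by (rule has_field_derivative_transform_within_open[where S = "{-1<..<1}"])
        (use 1 in \<open>auto simp: bump_def\<close>)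
  next
    case 2
    have "((\<lambda>_. 0) has_field_derivative bump (bump_deriv_poly p k) (k + 2) x) (at x)"
      using 2 by (simp add: bump_def)
    then show ?thesis
      by (rule has_field_derivative_transform_within_open[where S = "- {-1..1}"])
        (use 2 in \<open>auto simp: bump_def\<close>)
  next
    case 3
    have "bounded (poly p ` {-1..1})"
      by (intro compact_imp_bounded compact_continuous_image continuous_intros) auto
    then obtain M where M: "M > 0" "\<And>y. y \<in> {-1..1} \<Longrightarrow> \<bar>poly p y\<bar> \<le> M"
      by (auto simp: bounded_pos)
    define C where "C = M * fact (k + 2) * 4"
    have bd: "\<bar>bump p k y\<bar> \<le> C * \<bar>y - x\<bar>\<^sup>2" for y
    proof (cases "\<bar>y\<bar> < 1")
      case True
      define u where "u = 1 - y\<^sup>2"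
      have u: "u > 0" using abs_less_1_imp_pos[OF True] by (simp add: u_def)
      have "u = \<bar>y - x\<bar> * \<bar>y + x\<bar>"
      proof -
        have "x\<^sup>2 = 1" using 3 by (metis power2_abs power_one)
        then have "u = - ((y - x) * (y + x))" by (simp add: u_def algebra_simps power2_eq_square)
        then show ?thesis using u by (metis abs_minus_cancel abs_mult abs_of_pos)
      qed
      also have "\<dots> \<le> \<bar>y - x\<bar> * 2" using True 3 by (intro mult_left_mono) linarith+
      finally have u2: "u \<le> \<bar>y - x\<bar> * 2" .
      have My: "\<bar>poly p y\<bar> \<le> M" by (rule M(2)) (use True in auto)
      have "\<bar>bump p k y\<bar> = \<bar>poly p y\<bar> / u ^ k * exp (- 1 / u)"
        using True u by (simp add: bump_def u_def abs_mult)
      also have "\<dots> \<le> M / u ^ k * (fact (k + 2) * u ^ (k + 2))"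
        using u M(1) My by (intro mult_mono divide_right_mono exp_inverse_bound) auto
      also have "\<dots> = M * fact (k + 2) * u\<^sup>2"
        using u by (simp add: power_add power2_eq_square)
      also have "\<dots> \<le> M * fact (k + 2) * (\<bar>y - x\<bar> * 2)\<^sup>2"
        using u u2 M(1) by (intro mult_left_mono power_mono) auto
      also have "\<dots> = C * \<bar>y - x\<bar>\<^sup>2" by (simp add: C_def power_mult_distrib)
      finally show ?thesis .
    next
      case False
      then show ?thesis using M(1) by (simp add: bump_def C_def)
    qed
    have x0: "bump p k x = 0" "bump (bump_deriv_poly p k) (k + 2) x = 0" using 3 by (auto simp: bump_def)
    have "((\<lambda>y. (bump p k y - bump p k x) / (y - x)) \<longlongrightarrow> 0) (at x)"
    proof (rule Lim_null_comparison)
      show "\<forall>\<^sub>F y in at x. norm ((bump p k y - bump p k x) / (y - x)) \<le> C * \<bar>y - x\<bar>"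
      proof (rule eventually_at_filter[THEN iffD2], rule always_eventually, intro allI impI)
        fix y assume "y \<noteq> x"
        then show "norm ((bump p k y - bump p k x) / (y - x)) \<le> C * \<bar>y - x\<bar>"
          using bd[of y] by (simp add: x0 power2_eq_square pos_divide_le_eq mult.assoc)
      qed
      have "((\<lambda>y. C * \<bar>y - x\<bar>) \<longlongrightarrow> C * \<bar>x - x\<bar>) (at x)" by (intro tendsto_intros)
      then show "((\<lambda>y. C * \<bar>y - x\<bar>) \<longlongrightarrow> 0) (at x)" by simp
    qed
    then show ?thesis unfolding has_field_derivative_iff x0(2) .
  qed
qed

lemma ex_nonzero_test_fun: "\<exists>\<phi>. tapp \<phi> 0 \<noteq> 0"
proof -
  have "deriv (bump p k) = bump (bump_deriv_poly p k) (k + 2)" for p k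
    using bump_has_derivative by (intro ext DERIV_imp_deriv)
  then have "smooth (bump 1 0)"
    using bump_has_derivative real_differentiable_def
    by (intro smooth_coinduct[of _ "{bump p k |p k. True}"]) blast+
  moreover have "compact (fsupp (bump 1 0))"
    by (rule compact_fsuppI[of "{-1..1}"]) (auto simp: bump_def)
  ultimately have "tapp (Abs_test_fun (bump 1 0)) = bump 1 0"
    by (simp add: Abs_test_fun_inverse)
  moreover have "bump 1 0 0 \<noteq> 0" by (simp add: bump_def)
  ultimately show ?thesis by metis
qed

lemma ex_test_fun_affine:
  assumes "b \<noteq> 0" shows "\<exists>\<psi>. tapp \<psi> = (\<lambda>y. tapp \<phi> (a + b * y))"
proof -
  have "compact ((\<lambda>z. (z - a) / b) ` fsupp (tapp \<phi>))"
    by (intro compact_continuous_image continuous_intros compact_fsupp_tapp) (use assms in auto)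
  moreover have "tapp \<phi> (a + b * y) = 0" if "y \<notin> (\<lambda>z. (z - a) / b) ` fsupp (tapp \<phi>)" for y
  proof (rule not_in_fsupp[of "a + b * y" "tapp \<phi>"], rule notI)
    assume "a + b * y \<in> fsupp (tapp \<phi>)"
    then have "y \<in> (\<lambda>z. (z - a) / b) ` fsupp (tapp \<phi>)"
      by (rule rev_image_eqI) (use assms in simp)
    then show False using that by blast
  qed
  ultimately have "compact (fsupp (\<lambda>y. tapp \<phi> (a + b * y)))"
    by (rule compact_fsuppI)
  moreover have "smooth (\<lambda>y. tapp \<phi> (a + b * y))"
    using smooth_affine[OF smooth_tapp[of \<phi>], of 1 a b] by simp
  ultimately show ?thesis
    using Abs_test_fun_inverse[of "\<lambda>y. tapp \<phi> (a + b * y)"] by auto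
qed

lemma tderiv_eq_0: assumes "tderiv \<phi> = 0" shows "\<phi> = 0"
proof (rule test_fun_eqI)
  fix x
  have "(tapp \<phi> has_field_derivative 0) (at y)" for y
    using smooth_DERIV[OF smooth_tapp[of \<phi>], of y] assms by (metis tapp_tderiv tapp_zero)
  then have c: "tapp \<phi> y = tapp \<phi> x" for y by (metis DERIV_isconst_all)
  have "bounded (fsupp (tapp \<phi>))" by (simp add: compact_imp_bounded)
  then obtain y where "y \<notin> fsupp (tapp \<phi>)"
    using not_bounded_UNIV by (metis UNIV_eq_I)
  then show "tapp \<phi> x = tapp 0 x" using c[of y] not_in_fsupp[of y "tapp \<phi>"] by simp
qed

lemma dapp_funpow_dderiv: "dapp ((dderiv ^^ n) T) \<phi> = (-1) ^ n * dapp T ((tderiv ^^ n) \<phi>)"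
proof (induction n arbitrary: \<phi>)
  case (Suc n)
  then show ?case by (simp add: dapp_dderiv) (simp add: funpow_swap1)
qed simp

lemma dapp_odo_app: "dapp (odo_app p T) \<phi> = (\<Sum>n\<le>degree p. coeff p n * (-1) ^ n * dapp T ((tderiv ^^ n) \<phi>))"
proof -
  have "dapp (\<Sum>n\<in>A. f n) \<phi> = (\<Sum>n\<in>A. dapp (f n) \<phi>)" for f :: "nat \<Rightarrow> distribution" and A
    by (induction A rule: infinite_finite_induct) auto
  then show ?thesis by (simp add: odo_app_def dapp_funpow_dderiv mult.assoc)
qed

lemma odo_app_eq_0: assumes "odo_app p dirac = 0" shows "p = 0"
proof (rule ccontr)
  assume "p \<noteq> 0"
  define m where "m = degree p"
  have m: "coeff p m \<noteq> 0" using \<open>p \<noteq> 0\<close> by (simp add: m_def)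
  have z: "(deriv ^^ m) (tapp \<phi>) a = 0" for \<phi> a
  proof -
    define q where "q = (\<Sum>n\<le>m. monom (coeff p n * (-1) ^ n * (deriv ^^ n) (tapp \<phi>) a) n)"
    have "poly q b = 0" if b: "b \<noteq> 0" for b
    proof -
      obtain \<psi> where \<psi>: "tapp \<psi> = (\<lambda>y. tapp \<phi> (a + b * y))"
        using ex_test_fun_affine[OF b] by blast
      have d: "(deriv ^^ n) (tapp \<psi>) 0 = b ^ n * (deriv ^^ n) (tapp \<phi>) a" for n
        using fun_cong[OF funpow_deriv_affine[OF smooth_tapp[of \<phi>], where n = n and c = 1 and a = a and b = b], of 0]
        by (simp add: \<psi>)
      have "0 = dapp (odo_app p dirac) \<psi>" by (simp add: assms)
      also have "\<dots> = (\<Sum>n\<le>m. coeff p n * (-1) ^ n * (b ^ n * (deriv ^^ n) (tapp \<phi>) a))"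
        by (simp add: dapp_odo_app dapp_dirac tapp_funpow_tderiv d m_def)
      also have "\<dots> = poly q b"
        by (simp add: q_def poly_sum poly_monom mult_ac)
      finally show ?thesis by simp
    qed
    then have "- {0} \<subseteq> {b. poly q b = 0}" by auto
    moreover have "infinite (- {0 :: real})" using infinite_UNIV_char_0 by (simp add: finite_compl)
    ultimately have "q = 0" using poly_roots_finite finite_subset by blast
    then have "coeff q m = 0" by simp
    then show ?thesis using m by (simp add: q_def coeff_sum sum.delta)
  qed
  have "\<phi> = 0" for \<phi> :: test_fun
  proof -
    have "(tderiv ^^ m) \<phi> = 0" by (rule test_fun_eqI) (simp add: tapp_funpow_tderiv z)
    then show ?thesis by (induction m) (auto dest: tderiv_eq_0)
  qed
  then show False using ex_nonzero_test_fun by (metis tapp_zero)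
qed

lemma odo_app_inject: "odo_app p = odo_app q \<longleftrightarrow> p = q"
proof
  assume "odo_app p = odo_app q"
  then have "odo_app (p - q) dirac = 0" by (simp add: odo_app_diff)
  then show "p = q" using odo_app_eq_0 by fastforce
qed simp

definition odo_adjoint :: "odo \<Rightarrow> odo" where
  "odo_adjoint p = (\<Sum>n\<le>degree p. monom ((-1) ^ n * coeff p n) n)"

definition causal :: "distribution \<Rightarrow> bool" where
  "causal T \<longleftrightarrow> dsupp T \<subseteq> {0..}"

definition anticausal :: "distribution \<Rightarrow> bool" where
  "anticausal T \<longleftrightarrow> dsupp T \<subseteq> {..0}"

definition causal_green :: "odo \<Rightarrow> distribution" where
  "causal_green p = (THE g. causal g \<and> odo_app p g = dirac)"


section \<open>Matrix differential operators\<close>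

text \<open>By the above, \<open>A ** B\<close> and \<open>det A\<close> from the library are the composition and the determinant of
  matrix differential operators. A type \<open>'a ^ 'c ^ 'r\<close> consists of the matrices with rows indexed
  by \<open>'r\<close> and columns indexed by \<open>'c\<close>.\<close>

type_synonym 'd mdo = "odo ^ 'd ^ 'd"

definition mdo_app :: "'d::finite mdo \<Rightarrow> distribution ^ 'm ^ 'd \<Rightarrow> distribution ^ 'm ^ 'd" where
  "mdo_app L G = (\<chi> r c. \<Sum>d\<in>UNIV. odo_app (L $ r $ d) (G $ d $ c))"

definition mdo_invertible :: "'d::finite mdo \<Rightarrow> bool" where
  "mdo_invertible L \<longleftrightarrow> det L \<noteq> 0"

definition mdo_adjoint :: "'d::finite mdo \<Rightarrow> 'd mdo" where
  "mdo_adjoint L = (\<chi> r c. odo_adjoint (L $ c $ r))"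

text \<open>The library's \<open>invertible\<close> is the existence of a two-sided inverse matrix with entries in the
  same ring, here the ring of differential operators; \<open>matrix_inv\<close> denotes this inverse.\<close>

definition unimodular :: "'d::finite mdo \<Rightarrow> bool" where
  "unimodular V \<longleftrightarrow> invertible V"

definition diag_mdo :: "odo ^ 'd \<Rightarrow> 'd::finite mdo" where
  "diag_mdo p = (\<chi> r c. if r = c then p $ r else 0)"

definition id_dirac :: "distribution ^ 'd ^ 'd" where
  "id_dirac = (\<chi> r c. if r = c then dirac else 0)"

definition is_green_matrix :: "'d::finite mdo \<Rightarrow> distribution ^ 'd ^ 'd \<Rightarrow> bool" where
  "is_green_matrix L G \<longleftrightarrow> mdo_app L G = id_dirac"

definition causal_matrix :: "distribution ^ 'm ^ 'd \<Rightarrow> bool" where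
  "causal_matrix G \<longleftrightarrow> (\<forall>r c. causal (G $ r $ c))"

definition anticausal_matrix :: "distribution ^ 'm ^ 'd \<Rightarrow> bool" where
  "anticausal_matrix G \<longleftrightarrow> (\<forall>r c. anticausal (G $ r $ c))"

text \<open>The inverse of \<open>diag_mdo p\<close> on distributions with support bounded from below.\<close>

definition diag_inv :: "odo ^ 'd \<Rightarrow> distribution ^ 'm ^ 'd \<Rightarrow> distribution ^ 'm ^ 'd" where
  "diag_inv p G = (\<chi> d c. dconv (causal_green (p $ d)) (G $ d $ c))"

definition matrix_conv_test :: "distribution ^ 'd ^ 'd \<Rightarrow> test_fun ^ 'd \<Rightarrow> 'd::finite \<Rightarrow> real \<Rightarrow> real" where
  "matrix_conv_test G \<phi> i x = (\<Sum>k\<in>UNIV. conv_test (G $ i $ k) (\<phi> $ k) x)"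

definition is_adjoint_kernel :: "distribution ^ 'd ^ 'd \<Rightarrow> distribution ^ 'd ^ 'd \<Rightarrow> bool" where
  "is_adjoint_kernel G H \<longleftrightarrow> (\<forall>\<phi> \<psi> :: test_fun ^ 'd.
     (\<Sum>i\<in>UNIV. LINT x|lborel. matrix_conv_test G \<phi> i x * tapp (\<psi> $ i) x)
   = (\<Sum>i\<in>UNIV. LINT x|lborel. tapp (\<phi> $ i) x * matrix_conv_test H \<psi> i x))"

definition dreflect_matrix :: "distribution ^ 'm ^ 'd \<Rightarrow> distribution ^ 'm ^ 'd" where
  "dreflect_matrix G = (\<chi> r c. dreflect (G $ r $ c))"

end

theory Submission
  imports Defs "HOL-Computational_Algebra.Fundamental_Theorem_Algebra"
begin

text \<open>
  Everything is reduced to scalar operators, where two facts about a nonzero operator \<open>p\<close> matter.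
  First, \<open>p\<close> is injective on causal distributions (\<open>causal_odo_app_eq_0\<close>). Second, it has a causal
  Green's function (\<open>ex_causal_green\<close>). Both come from solving the adjoint equation \<open>p* \<phi> = \<psi>\<close> for a test
  function \<open>\<psi>\<close> backwards in time, by a smooth \<open>\<phi>\<close> that vanishes far to the right. Such a \<open>\<phi>\<close> exists,
  is unique and is bounded by \<open>\<psi>\<close> (\<open>right_solvable_stable\<close>): split \<open>p*\<close> into real linear and quadratic
  factors, shift each factor by an exponential so that it becomes \<open>D\<close> or \<open>D\<^sup>2 + b\<^sup>2\<close>, and integrate.
  The Green's function is then \<open>\<psi> \<mapsto> \<phi>(0)\<close>. If \<open>p T = 0\<close> with \<open>T\<close> causal, then cutting \<open>\<phi>\<close> off to the
  left of the origin gives a test function \<open>\<eta>\<close> such that \<open>p* \<eta>\<close> agrees with \<open>\<psi>\<close> near the support of \<open>T\<close>, so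
  \<open>T \<psi> = T (p* \<eta>) = (p T) \<eta> = 0\<close>.

  For the matrix operator, \<open>L{G} = I\<delta>\<close> with \<open>L = U D V\<close> is equivalent to \<open>D{V{G}} = U\<^sup>-\<^sup>1{I\<delta>}\<close>, a family of scalar
  equations. None of the diagonal entries is zero because \<open>det L\<close> is not. The entries of
  \<open>U\<^sup>-\<^sup>1{I\<delta>}\<close> are combinations of derivatives of \<open>\<delta>\<close>, so the convolutions in \<open>D\<^sup>-\<^sup>1\<close> only differentiate Green's functions
  (\<open>dconv_odo_dirac\<close>), and \<open>causal_green_matrix_iff\<close> follows. The formula for \<open>G\<close> also shows that
  its transpose is what the same formula gives for the factorization \<open>V\<^sup>T D U\<^sup>T\<close> of the transposed operator.
  Reflection turns this transposed operator into \<open>L*\<close> and causal into anti-causal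
  distributions, which proves the claims about \<open>L*\<close>.

  That the adjoint kernel is \<open>G\<^sup>T(-\<cdot>)\<close> is true for every matrix \<open>G\<close> of distributions: both pairings
  evaluate \<open>G\<close> on the correlations of the entries of \<open>\<phi>\<close> and \<open>\<psi>\<close>, once the distribution has been
  interchanged with the integral (\<open>dapp_integral\<close>). It is unique because a smooth function that is
  orthogonal to all test functions is zero.
\<close>

section \<open>Smooth functions and cutoffs\<close>

lemma smooth_imp_isCont: "smooth f \<Longrightarrow> isCont f x"
  using smooth_DERIV DERIV_isCont by blast

lemma smooth_imp_continuous_on: "smooth f \<Longrightarrow> continuous_on S f"
  by (simp add: smooth_imp_isCont continuous_at_imp_continuous_on)

text \<open>A class of functions that contains the products of smooth functions and is closed under
  differentiation; products alone are not, by Leibniz' rule.\<close>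

inductive sum_of_products :: "(real \<Rightarrow> real) \<Rightarrow> bool" where
  product: "smooth f \<Longrightarrow> smooth g \<Longrightarrow> sum_of_products (\<lambda>x. f x * g x)"
| sum: "sum_of_products f \<Longrightarrow> sum_of_products g \<Longrightarrow> sum_of_products (\<lambda>x. f x + g x)"

lemma sum_of_products_deriv:
  assumes "sum_of_products h"
  shows "\<exists>h'. sum_of_products h' \<and> (\<forall>x. (h has_field_derivative h' x) (at x))"
  using assms
proof induction
  case (product f g)
  have "sum_of_products (\<lambda>x. deriv f x * g x + f x * deriv g x)"
    using product by (intro sum_of_products.intros smooth_deriv)
  moreover have "((\<lambda>x. f x * g x) has_field_derivative deriv f x * g x + f x * deriv g x) (at x)" for x
    using DERIV_mult[OF smooth_DERIV[OF product(1)] smooth_DERIV[OF product(2)], of x]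
    by (simp add: mult.commute add.commute)
  ultimately show ?case by blast
next
  case (sum f g)
  then obtain f' g' where D: "sum_of_products f'" "sum_of_products g'"
      "\<And>x. (f has_field_derivative f' x) (at x)" "\<And>x. (g has_field_derivative g' x) (at x)"
    by blast
  show ?case
    by (rule exI[of _ "\<lambda>x. f' x + g' x"]) (auto intro: D sum_of_products.sum DERIV_add)
qed

lemma smooth_mult:
  assumes "smooth f" "smooth g" shows "smooth (\<lambda>x. f x * g x)"
proof (rule smooth_coinduct[of _ "Collect sum_of_products"])
  show "(\<lambda>x. f x * g x) \<in> Collect sum_of_products"
    using assms by (simp add: sum_of_products.product)
next
  fix h assume "h \<in> Collect sum_of_products"
  then obtain h' where h': "sum_of_products h'" "\<And>x. (h has_field_derivative h' x) (at x)"
    using sum_of_products_deriv by blast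
  then show "h differentiable at x" for x
    using real_differentiable_def by blast
  have "deriv h = h'" using h'(2) by (intro ext DERIV_imp_deriv)
  then show "deriv h \<in> Collect sum_of_products" using h'(1) by simp
qed

lemma smooth_if_DERIV:
  assumes "smooth f" "\<And>x. (F has_field_derivative f x) (at x)"
  shows "smooth F"
proof (rule smooth_coinduct[of _ "insert F {f. smooth f}"])
  have "deriv F = f" using assms(2) by (intro ext DERIV_imp_deriv)
  then show "deriv h \<in> insert F {f. smooth f}" if "h \<in> insert F {f. smooth f}" for h
    using that assms(1) smooth_deriv by auto
  show "h differentiable at x" if "h \<in> insert F {f. smooth f}" for h x
    using that assms(2) real_differentiable_def smooth_differentiable by auto
qed simp

lemma smooth_const: "smooth (\<lambda>x. c)"
  by (rule smooth_if_DERIV[OF smooth_zero]) simp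

lemma smooth_minus: "smooth f \<Longrightarrow> smooth (\<lambda>x. - f x)"
  using smooth_cmult[of f "-1"] by simp

lemma smooth_diff: "smooth f \<Longrightarrow> smooth g \<Longrightarrow> smooth (\<lambda>x. f x - g x)"
  using smooth_add[of f "\<lambda>x. - g x"] smooth_minus by simp

lemma smooth_sum: "(\<And>i. i \<in> I \<Longrightarrow> smooth (f i)) \<Longrightarrow> smooth (\<lambda>x. \<Sum>i\<in>I. f i x)"
  by (induction I rule: infinite_finite_induct) (auto intro: smooth_const smooth_add)

lemma smooth_exp: "smooth (\<lambda>x. exp (a * x))"
proof -
  have D: "((\<lambda>x. c * exp (a * x)) has_field_derivative (c * a) * exp (a * x)) (at x)" for c x
    by (auto intro!: derivative_eq_intros)
  have "deriv (\<lambda>x. c * exp (a * x)) = (\<lambda>x. (c * a) * exp (a * x))" for c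
    by (intro ext DERIV_imp_deriv D)
  then have "smooth (\<lambda>x. 1 * exp (a * x))"
    by (intro smooth_coinduct[of _ "range (\<lambda>c x. c * exp (a * x))"])
      (use D real_differentiable_def in blast)+
  then show ?thesis by simp
qed

lemma smooth_sin: "smooth (\<lambda>x. sin (b * x))" and smooth_cos: "smooth (\<lambda>x. cos (b * x))"
proof -
  define S where "S = (\<lambda>(c, d) x. c * cos (b * x) + d * sin (b * x)) ` UNIV"
  have SI: "(\<lambda>x. c * cos (b * x) + d * sin (b * x)) \<in> S" for c d
    unfolding S_def by (rule image_eqI[of _ _ "(c, d)"]) auto
  have D: "((\<lambda>x. c * cos (b * x) + d * sin (b * x)) has_field_derivative
      (d * b) * cos (b * x) + (- c * b) * sin (b * x)) (at x)" for c d x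
    by (auto intro!: derivative_eq_intros)
  have D': "deriv (\<lambda>x. c * cos (b * x) + d * sin (b * x)) =
      (\<lambda>x. (d * b) * cos (b * x) + (- c * b) * sin (b * x))" for c d
    by (intro ext DERIV_imp_deriv D)
  have "smooth f" if "f \<in> S" for f
    using that
  proof (rule smooth_coinduct)
    fix h assume "h \<in> S"
    then obtain c d where h: "h = (\<lambda>x. c * cos (b * x) + d * sin (b * x))"
      by (auto simp: S_def)
    show "h differentiable at x" for x
      unfolding h using D real_differentiable_def by blast
    show "deriv h \<in> S" unfolding h D' by (rule SI)
  qed
  from this[OF SI[of 0 1]] this[OF SI[of 1 0]]
  show "smooth (\<lambda>x. sin (b * x))" "smooth (\<lambda>x. cos (b * x))" by auto
qed

lemma ex_smooth_antiderivative:
  assumes "smooth f"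
  obtains F where "smooth F" "\<And>x. (F has_field_derivative f x) (at x)" "F c = 0"
proof -
  have "\<exists>F. \<forall>x :: real. -\<infinity> < ereal x \<longrightarrow> ereal x < \<infinity> \<longrightarrow> (F has_vector_derivative f x) (at x)"
    by (rule einterval_antiderivative) (use smooth_imp_isCont[OF assms] in auto)
  then obtain F where F: "\<And>x. (F has_field_derivative f x) (at x)"
    by (auto simp: has_real_derivative_iff_has_vector_derivative)
  define G where "G = (\<lambda>x. F x - F c)"
  have G: "(G has_field_derivative f x) (at x)" for x
    unfolding G_def by (auto intro!: derivative_eq_intros F)
  show ?thesis using that[of G] G smooth_if_DERIV[OF assms G] by (simp add: G_def)
qed

lemma eq_if_zero_deriv_on:
  fixes F :: "real \<Rightarrow> real"
  assumes "convex S" "\<And>x. x \<in> S \<Longrightarrow> (F has_field_derivative 0) (at x)" "x \<in> S" "y \<in> S"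
  shows "F x = F y"
proof -
  have "\<exists>c. \<forall>x\<in>S. F x = c"
    by (rule has_field_derivative_zero_constant[OF assms(1)])
      (rule has_field_derivative_at_within[OF assms(2)])
  then show ?thesis using assms(3,4) by metis
qed

lemma ex_smooth_antiderivative_right:
  assumes "smooth f" "\<And>x. x > R \<Longrightarrow> f x = 0"
  obtains F where "smooth F" "\<And>x. (F has_field_derivative f x) (at x)" "\<And>x. x > R \<Longrightarrow> F x = 0"
proof -
  obtain F where F: "smooth F" "\<And>x. (F has_field_derivative f x) (at x)" "F (R + 1) = 0"
    using ex_smooth_antiderivative[OF assms(1)] by metis
  have "(F has_field_derivative 0) (at x)" if "x \<in> {R<..}" for x
    using F(2)[of x] assms(2)[of x] that by simp
  note D0 = this
  have "F x = F (R + 1)" if "x > R" for x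
    by (rule eq_if_zero_deriv_on[of "{R<..}"]) (use D0 that in auto)
  then show ?thesis using that F by metis
qed

lemma test_fun_vanishes_outside: "\<exists>r>0. \<forall>x. \<bar>x\<bar> \<ge> r \<longrightarrow> tapp \<phi> x = 0"
proof -
  have "bounded (fsupp (tapp \<phi>))" by (simp add: compact_imp_bounded)
  then obtain r where "r > 0" "\<And>x. x \<in> fsupp (tapp \<phi>) \<Longrightarrow> \<bar>x\<bar> \<le> r"
    by (auto simp: bounded_pos)
  then show ?thesis using not_in_fsupp[of _ "tapp \<phi>"]
    by (intro exI[of _ "r + 1"]) force
qed

text \<open>The normalized antiderivative of the square of a test function increases from 0 to 1 on a bounded
  interval; an affine change of variables moves that interval to \<open>[a, b]\<close>.\<close>

lemma ex_smooth_step: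
  fixes a b :: real
  assumes "a < b"
  obtains \<theta> where "smooth \<theta>" "\<And>x. x \<le> a \<Longrightarrow> \<theta> x = 0" "\<And>x. x \<ge> b \<Longrightarrow> \<theta> x = 1"
proof -
  obtain \<phi> where \<phi>: "tapp \<phi> 0 \<noteq> 0" using ex_nonzero_test_fun by blast
  obtain r where r: "r > 0" "\<And>x. \<bar>x\<bar> \<ge> r \<Longrightarrow> tapp \<phi> x = 0"
    using test_fun_vanishes_outside by blast
  define f where "f = (\<lambda>x. tapp \<phi> x * tapp \<phi> x)"
  have f: "smooth f" by (simp add: f_def smooth_mult)
  obtain F where F: "smooth F" "\<And>x. (F has_field_derivative f x) (at x)" "F (- r) = 0"
    using ex_smooth_antiderivative[OF f] by metis
  have D0: "(F has_field_derivative 0) (at x)" if "\<bar>x\<bar> \<ge> r" for x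
    using F(2)[of x] r(2)[OF that] by (simp add: f_def)
  have left: "F x = 0" if "x \<le> - r" for x
  proof -
    have "F x = F (- r)"
      by (rule eq_if_zero_deriv_on[of "{..-r}"]) (use D0 r(1) that in auto)
    then show ?thesis using F(3) by simp
  qed
  have right: "F x = F r" if "x \<ge> r" for x
    by (rule eq_if_zero_deriv_on[of "{r..}"]) (use D0 r(1) that in auto)
  have mono: "F x \<le> F y" if "x \<le> y" for x y
    by (rule DERIV_nonneg_imp_nondecreasing[OF that], rule exI, rule conjI, rule F(2)) (simp add: f_def)
  \<comment> \<open>otherwise \<open>F\<close> would be zero on \<open>(-r, r)\<close>, and so would its derivative \<open>f\<close>\<close>
  have "F r \<noteq> 0"
  proof
    assume "F r = 0"
    then have "F x = 0" if "x \<in> {-r<..<r}" for x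
      using mono[of "-r" x] mono[of x r] F(3) that by auto
    then have "(F has_field_derivative 0) (at 0)"
      by (intro has_field_derivative_transform_within_open[of "\<lambda>_. 0" 0 0 "{-r<..<r}" F]) (use r(1) in auto)
    then have "f 0 = 0" using F(2) DERIV_unique by blast
    then show False using \<phi> by (simp add: f_def)
  qed
  define \<theta> where "\<theta> = (\<lambda>x. (1 / F r) * F ((- r - 2 * r / (b - a) * a) + (2 * r / (b - a)) * x))"
  have aff: "(- r - 2 * r / (b - a) * a) + (2 * r / (b - a)) * x = - r + 2 * r * ((x - a) / (b - a))" for x
    by (simp add: right_diff_distrib diff_divide_distrib)
  have "\<theta> x = 0" if "x \<le> a" for x
    unfolding \<theta>_def aff using that assms r(1)
    by (subst left) (auto simp: divide_nonpos_pos mult_nonneg_nonpos)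
  moreover have "\<theta> x = 1" if "x \<ge> b" for x
  proof -
    have "(x - a) / (b - a) \<ge> 1" using that assms by simp
    then have "- r + 2 * r * ((x - a) / (b - a)) \<ge> r"
      using mult_left_mono[of 1 "(x - a) / (b - a)" "2 * r"] r(1) by linarith
    then have "F (- r + 2 * r * ((x - a) / (b - a))) = F r" by (rule right)
    then show ?thesis unfolding \<theta>_def aff using \<open>F r \<noteq> 0\<close> by simp
  qed
  moreover have "smooth \<theta>" unfolding \<theta>_def by (rule smooth_affine[OF F(1)])
  ultimately show ?thesis using that by blast
qed

lemma ex_smooth_cutoff:
  fixes x\<^sub>0 r :: real
  assumes "r > 0"
  obtains \<theta> where "smooth \<theta>" "\<And>x. \<bar>x - x\<^sub>0\<bar> \<le> r \<Longrightarrow> \<theta> x = 1" "\<And>x. \<bar>x - x\<^sub>0\<bar> \<ge> 2 * r \<Longrightarrow> \<theta> x = 0"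
proof -
  obtain f where f: "smooth f" "\<And>x. x \<le> x\<^sub>0 - 2 * r \<Longrightarrow> f x = 0" "\<And>x. x \<ge> x\<^sub>0 - r \<Longrightarrow> f x = 1"
    using ex_smooth_step[of "x\<^sub>0 - 2 * r" "x\<^sub>0 - r"] assms by auto
  obtain g where g: "smooth g" "\<And>x. x \<le> x\<^sub>0 + r \<Longrightarrow> g x = 0" "\<And>x. x \<ge> x\<^sub>0 + 2 * r \<Longrightarrow> g x = 1"
    using ex_smooth_step[of "x\<^sub>0 + r" "x\<^sub>0 + 2 * r"] assms by auto
  show ?thesis
  proof (rule that[of "\<lambda>x. f x * (1 - g x)"])
    show "smooth (\<lambda>x. f x * (1 - g x))"
      by (intro smooth_mult smooth_diff smooth_const f g)
    show "f x * (1 - g x) = 1" if "\<bar>x - x\<^sub>0\<bar> \<le> r" for x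
      using f(3)[of x] g(2)[of x] that by auto
    show "f x * (1 - g x) = 0" if "\<bar>x - x\<^sub>0\<bar> \<ge> 2 * r" for x
      using f(2)[of x] g(3)[of x] that by (cases "x \<le> x\<^sub>0") auto
  qed
qed

definition tmult :: "(real \<Rightarrow> real) \<Rightarrow> test_fun \<Rightarrow> test_fun" where
  "tmult f \<phi> = Abs_test_fun (\<lambda>x. f x * tapp \<phi> x)"

lemma tapp_Abs_test_fun:
  assumes "smooth f" "\<And>x. \<bar>x\<bar> > r \<Longrightarrow> f x = 0"
  shows "tapp (Abs_test_fun f) = f"
proof -
  have "compact (fsupp f)"
    by (rule compact_fsuppI[of "{-r..r}"]) (use assms(2) in auto)
  then show ?thesis using assms(1) by (simp add: Abs_test_fun_inverse)
qed

lemma tapp_tmult: assumes "smooth f" shows "tapp (tmult f \<phi>) = (\<lambda>x. f x * tapp \<phi> x)"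
proof -
  obtain r where r: "\<And>x. \<bar>x\<bar> \<ge> r \<Longrightarrow> tapp \<phi> x = 0" using test_fun_vanishes_outside by blast
  show ?thesis
    unfolding tmult_def
    by (rule tapp_Abs_test_fun[of _ r]) (simp_all add: smooth_mult assms r)
qed

section \<open>Locality of distributions\<close>

lemma fsupp_subsetI:
  assumes "closed K" "\<And>x. x \<notin> K \<Longrightarrow> f x = 0" shows "fsupp f \<subseteq> K"
  unfolding fsupp_def by (rule closure_minimal) (use assms in auto)

lemma dapp_zero_right [simp]: "dapp T 0 = 0"
  and dapp_add_right: "dapp T (\<phi> + \<psi>) = dapp T \<phi> + dapp T \<psi>"
  and dapp_diff_right: "dapp T (\<phi> - \<psi>) = dapp T \<phi> - dapp T \<psi>"
  and dapp_scaleR_right: "dapp T (c *\<^sub>R \<phi>) = c * dapp T \<phi>"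
  and dapp_sum_right: "dapp T (\<Sum>i\<in>I. f i) = (\<Sum>i\<in>I. dapp T (f i))"
  using linear_dapp[of T]
  by (simp_all add: linear_0 linear_add linear_diff linear_scale linear_sum)

text \<open>In place of a partition of unity, the balls are removed one at a time: with a cutoff \<open>\<theta>\<close> for the
  ball \<open>i\<close>, the part \<open>\<theta> \<phi>\<close> lives on the doubled ball, where \<open>T\<close> vanishes, and \<open>(1 - \<theta>) \<phi>\<close> is
  supported outside the ball, hence in the union of the others.\<close>

lemma dapp_eq_0_if_covered:
  assumes "finite I" and "\<And>i. i \<in> I \<Longrightarrow> r i > 0"
    and null: "\<And>i \<phi>. i \<in> I \<Longrightarrow> fsupp (tapp \<phi>) \<subseteq> cball (c i) (2 * r i) \<Longrightarrow> dapp T \<phi> = 0"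
    and "fsupp (tapp \<phi>) \<subseteq> (\<Union>i\<in>I. ball (c i) (r i))"
  shows "dapp T \<phi> = 0"
  using assms
proof (induction I arbitrary: \<phi> rule: finite_induct)
  case empty
  then have "\<phi> = 0" by (intro test_fun_eqI) (simp add: not_in_fsupp)
  then show ?case by simp
next
  case (insert i I)
  obtain \<theta> where \<theta>: "smooth \<theta>" "\<And>x. \<bar>x - c i\<bar> \<le> r i \<Longrightarrow> \<theta> x = 1" "\<And>x. \<bar>x - c i\<bar> \<ge> 2 * r i \<Longrightarrow> \<theta> x = 0"
    using ex_smooth_cutoff[of "r i" "c i"] insert.prems(1) by auto
  have \<theta>': "smooth (\<lambda>x. 1 - \<theta> x)" by (intro smooth_diff smooth_const \<theta>)
  have "\<phi> = tmult \<theta> \<phi> + tmult (\<lambda>x. 1 - \<theta> x) \<phi>"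
    by (rule test_fun_eqI) (simp add: tapp_tmult \<theta> \<theta>' algebra_simps)
  moreover have "dapp T (tmult \<theta> \<phi>) = 0"
  proof (rule insert.prems(2)[of i])
    show "fsupp (tapp (tmult \<theta> \<phi>)) \<subseteq> cball (c i) (2 * r i)"
    proof (rule fsupp_subsetI)
      fix x assume "x \<notin> cball (c i) (2 * r i)"
      then have "\<bar>x - c i\<bar> \<ge> 2 * r i" by (simp add: dist_real_def)
      then show "tapp (tmult \<theta> \<phi>) x = 0" by (simp add: tapp_tmult \<theta>)
    qed simp
  qed simp
  moreover have "dapp T (tmult (\<lambda>x. 1 - \<theta> x) \<phi>) = 0"
  proof (rule insert.IH)
    have "fsupp (tapp (tmult (\<lambda>x. 1 - \<theta> x) \<phi>)) \<subseteq> fsupp (tapp \<phi>) - ball (c i) (r i)"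
    proof (rule fsupp_subsetI)
      show "closed (fsupp (tapp \<phi>) - ball (c i) (r i))"
        by (intro closed_Diff) (auto simp: fsupp_def)
      fix x assume "x \<notin> fsupp (tapp \<phi>) - ball (c i) (r i)"
      then show "tapp (tmult (\<lambda>x. 1 - \<theta> x) \<phi>) x = 0"
        using \<theta>(2)[of x] not_in_fsupp[of x "tapp \<phi>"]
        by (auto simp: tapp_tmult \<theta>' dist_real_def abs_minus_commute)
    qed
    then show "fsupp (tapp (tmult (\<lambda>x. 1 - \<theta> x) \<phi>)) \<subseteq> (\<Union>i\<in>I. ball (c i) (r i))"
      using insert.prems(3) by auto
  qed (use insert.prems in auto)
  ultimately show ?case by (metis dapp_add_right add_0)
qed

lemma dapp_eq_0_if_disjoint:
  assumes "fsupp (tapp \<phi>) \<inter> dsupp T = {}"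
  shows "dapp T \<phi> = 0"
proof -
  let ?K = "fsupp (tapp \<phi>)"
  have "\<exists>r>0. \<forall>\<psi>. fsupp (tapp \<psi>) \<subseteq> cball x (2 * r) \<longrightarrow> dapp T \<psi> = 0" if x: "x \<in> ?K" for x
  proof -
    obtain W where W: "open W" "x \<in> W" "\<And>\<psi>. fsupp (tapp \<psi>) \<subseteq> W \<Longrightarrow> dapp T \<psi> = 0"
    proof -
      have "x \<notin> dsupp T" using x assms by blast
      then show ?thesis using that unfolding dsupp_def by auto
    qed
    obtain e where "e > 0" "cball x e \<subseteq> W" using W open_contains_cball by blast
    then show ?thesis using W(3) by (intro exI[of _ "e / 2"]) auto
  qed
  then obtain r where r: "\<And>x. x \<in> ?K \<Longrightarrow> r x > 0"
      "\<And>x \<psi>. x \<in> ?K \<Longrightarrow> fsupp (tapp \<psi>) \<subseteq> cball x (2 * r x) \<Longrightarrow> dapp T \<psi> = 0" by metis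
  have "?K \<subseteq> (\<Union>x\<in>?K. ball x (r x))" using r(1) by force
  then obtain I where I: "I \<subseteq> ?K" "finite I" "?K \<subseteq> (\<Union>x\<in>I. ball x (r x))"
    using compactE_image[OF compact_fsupp_tapp[of \<phi>], of ?K "\<lambda>x. ball x (r x)"] by auto
  show ?thesis
  proof (rule dapp_eq_0_if_covered[of I r "\<lambda>x. x"])
    show "finite I" "fsupp (tapp \<phi>) \<subseteq> (\<Union>i\<in>I. ball i (r i))" by (fact I)+
  qed (use I(1) r in blast)+
qed

lemma tapp_diff [simp]: "tapp (\<phi> - \<psi>) = (\<lambda>x. tapp \<phi> x - tapp \<psi> x)"
  unfolding minus_test_fun_def uminus_test_fun_def by (simp only: tapp_add tapp_scaleR) simp

lemma dapp_cong_open: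
  assumes "open W" "dsupp T \<subseteq> W" "\<And>x. x \<in> W \<Longrightarrow> tapp \<phi> x = tapp \<psi> x"
  shows "dapp T \<phi> = dapp T \<psi>"
proof -
  have "fsupp (tapp (\<phi> - \<psi>)) \<subseteq> - W"
    using assms by (intro fsupp_subsetI) auto
  then have "dapp T (\<phi> - \<psi>) = 0"
    using assms(2) by (intro dapp_eq_0_if_disjoint) auto
  then show ?thesis by (simp add: dapp_diff_right)
qed

text \<open>The pairing with functions of noncompact support is consistent with the original one; this
  is the uniqueness of the value that \<open>dapp_ext\<close> selects.\<close>

lemma dapp_ext_test_fun: "dapp_ext T (tapp \<eta>) = dapp T \<eta>"
  unfolding dapp_ext_def
proof (rule the_equality)
  show "\<exists>\<eta>' W. open W \<and> dsupp T \<subseteq> W \<and> (\<forall>x\<in>W. tapp \<eta>' x = tapp \<eta> x) \<and> dapp T \<eta> = dapp T \<eta>'"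
    by (rule exI[of _ \<eta>], rule exI[of _ UNIV]) simp
qed (use dapp_cong_open in blast)

section \<open>Differential operators acting on smooth functions\<close>

text \<open>The backward solutions below are smooth but not compactly supported on the left, so operators have
  to act on all smooth functions and not just on test functions.\<close>

definition odo_fun :: "odo \<Rightarrow> (real \<Rightarrow> real) \<Rightarrow> real \<Rightarrow> real" where
  "odo_fun p f x = (\<Sum>n\<le>degree p. coeff p n * (deriv ^^ n) f x)"

lemma odo_fun_altdef:
  assumes "degree p \<le> N" shows "odo_fun p f x = (\<Sum>n\<le>N. coeff p n * (deriv ^^ n) f x)"
  unfolding odo_fun_def
  by (rule sum.mono_neutral_left) (use assms in \<open>auto simp: coeff_eq_0\<close>)

lemma odo_fun_0 [simp]: "odo_fun 0 f x = 0"
  by (simp add: odo_fun_def)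

lemma odo_fun_add: "odo_fun (p + q) f x = odo_fun p f x + odo_fun q f x"
proof -
  define N where "N = max (degree p) (degree q)"
  have "degree (p + q) \<le> N" "degree p \<le> N" "degree q \<le> N"
    by (auto simp: N_def degree_add_le_max)
  then show ?thesis
    by (simp add: odo_fun_altdef[of _ N] distrib_right sum.distrib)
qed

lemma odo_fun_smult: "odo_fun (smult c p) f x = c * odo_fun p f x"
  by (simp add: odo_fun_altdef[of _ "degree p"] degree_smult_le sum_distrib_left mult.assoc)

lemma smooth_odo_fun: "smooth f \<Longrightarrow> smooth (odo_fun p f)"
  unfolding odo_fun_def[abs_def] by (intro smooth_sum smooth_cmult smooth_funpow_deriv)

lemma odo_fun_pCons:
  assumes "smooth f" shows "odo_fun (pCons a p) f x = a * f x + deriv (odo_fun p f) x"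
proof -
  have "odo_fun (pCons a p) f x = (\<Sum>n\<le>Suc (degree p). coeff (pCons a p) n * (deriv ^^ n) f x)"
    by (rule odo_fun_altdef) (rule degree_pCons_le)
  also have "\<dots> = a * f x + (\<Sum>n\<le>degree p. coeff p n * deriv ((deriv ^^ n) f) x)"
    by (simp only: sum.atMost_Suc_shift coeff_pCons_0 coeff_pCons_Suc funpow.simps(2) comp_apply funpow_0)
  also have "(odo_fun p f has_field_derivative
      (\<Sum>n\<le>degree p. coeff p n * deriv ((deriv ^^ n) f) x)) (at x)"
    unfolding odo_fun_def[abs_def]
    by (intro DERIV_sum DERIV_cmult smooth_DERIV smooth_funpow_deriv assms)
  then have "(\<Sum>n\<le>degree p. coeff p n * deriv ((deriv ^^ n) f) x) = deriv (odo_fun p f) x"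
    by (rule DERIV_imp_deriv[symmetric])
  finally show ?thesis .
qed

lemma odo_fun_mult:
  assumes "smooth f" shows "odo_fun (p * q) f = odo_fun p (odo_fun q f)"
proof (induction p)
  case 0
  show ?case by (simp add: fun_eq_iff)
next
  case (pCons a p)
  have "odo_fun (pCons 0 (p * q)) f x = deriv (odo_fun (p * q) f) x" for x
    by (simp add: odo_fun_pCons assms)
  then show ?case
    by (intro ext) (simp add: odo_fun_add odo_fun_smult odo_fun_pCons smooth_odo_fun assms pCons.IH)
qed

lemma odo_fun_linear:
  assumes "smooth f" "smooth g"
  shows "odo_fun p (\<lambda>x. f x + g x) = (\<lambda>x. odo_fun p f x + odo_fun p g x)"
    and "odo_fun p (\<lambda>x. c * f x) = (\<lambda>x. c * odo_fun p f x)"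
proof -
  show "odo_fun p (\<lambda>x. f x + g x) = (\<lambda>x. odo_fun p f x + odo_fun p g x)"
    unfolding odo_fun_def[abs_def]
    by (simp add: funpow_deriv_add assms distrib_left sum.distrib)
  have "(deriv ^^ n) (\<lambda>x. c * f x) = (\<lambda>x. c * (deriv ^^ n) f x)" for n
    using funpow_deriv_affine[OF assms(1), of n c 0 1] by simp
  then show "odo_fun p (\<lambda>x. c * f x) = (\<lambda>x. c * odo_fun p f x)"
    unfolding odo_fun_def[abs_def] by (simp add: sum_distrib_left mult.left_commute)
qed

lemma funpow_deriv_cong_open:
  assumes "open W" "\<And>x. x \<in> W \<Longrightarrow> f x = g x" "x \<in> W"
  shows "(deriv ^^ n) f x = (deriv ^^ n) g x"
  using assms(3)
proof (induction n arbitrary: x)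
  case (Suc n)
  have "eventually (\<lambda>y. (deriv ^^ n) f y = (deriv ^^ n) g y) (nhds x)"
    using Suc assms(1) unfolding eventually_nhds by blast
  then show ?case by (simp add: deriv_cong_ev)
qed (use assms(2) in simp)

lemma odo_fun_cong_open:
  assumes "open W" "\<And>x. x \<in> W \<Longrightarrow> f x = g x" "x \<in> W"
  shows "odo_fun p f x = odo_fun p g x"
  unfolding odo_fun_def by (simp add: funpow_deriv_cong_open[OF assms])

lemma odo_fun_zero: "odo_fun p (\<lambda>x. 0) = (\<lambda>x. 0)"
proof -
  have "(deriv ^^ n) (\<lambda>x. 0 :: real) = (\<lambda>x. 0)" for n by (induction n) auto
  then show ?thesis by (simp add: odo_fun_def fun_eq_iff)
qed

lemma odo_fun_right_vanishing:
  assumes "\<And>x. x > R \<Longrightarrow> f x = 0" "x > R" shows "odo_fun p f x = 0"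
  using odo_fun_cong_open[of "{R<..}" f "\<lambda>x. 0" x p] assms by (simp add: odo_fun_zero)

definition odo_test :: "odo \<Rightarrow> test_fun \<Rightarrow> test_fun" where
  "odo_test p \<phi> = (\<Sum>n\<le>degree p. coeff p n *\<^sub>R (tderiv ^^ n) \<phi>)"

lemma tapp_sum: "tapp (\<Sum>i\<in>I. f i) = (\<lambda>x. \<Sum>i\<in>I. tapp (f i) x)"
  by (induction I rule: infinite_finite_induct) auto

lemma tapp_odo_test: "tapp (odo_test p \<phi>) = odo_fun p (tapp \<phi>)"
  by (simp add: odo_test_def odo_fun_def tapp_sum tapp_funpow_tderiv fun_eq_iff)

lemma coeff_odo_adjoint: "coeff (odo_adjoint p) n = (-1) ^ n * coeff p n"
  by (auto simp: odo_adjoint_def coeff_sum not_le coeff_eq_0)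

lemma degree_odo_adjoint: "degree (odo_adjoint p) = degree p"
proof -
  have "coeff (odo_adjoint p) n = 0 \<longleftrightarrow> coeff p n = 0" for n by (simp add: coeff_odo_adjoint)
  then show ?thesis unfolding degree_def by simp
qed

lemma odo_adjoint_eq_0_iff [simp]: "odo_adjoint p = 0 \<longleftrightarrow> p = 0"
  by (simp add: poly_eq_iff coeff_odo_adjoint)

lemma odo_adjoint_odo_adjoint [simp]: "odo_adjoint (odo_adjoint p) = p"
  by (simp add: poly_eq_iff coeff_odo_adjoint)

lemma dapp_odo_app_adjoint: "dapp (odo_app p T) \<phi> = dapp T (odo_test (odo_adjoint p) \<phi>)"
  by (simp add: dapp_odo_app odo_test_def degree_odo_adjoint coeff_odo_adjoint
      dapp_sum_right dapp_scaleR_right mult_ac)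

section \<open>Solutions that vanish on the right\<close>

text \<open>Vanishing on the open half line \<open>{R<..}\<close> is a local property there, so it passes on to derivatives without
  a continuity argument at \<open>R\<close>. The bound in \<open>right_stable\<close> is required for all solutions: with \<open>M = 0\<close>
  it becomes uniqueness, and that it only refers to \<open>x \<ge> a\<close> says that the values to the right of \<open>a\<close> depend
  on the data there only, which is what makes the Green's function causal.\<close>

definition right_solvable :: "odo \<Rightarrow> bool" where
  "right_solvable p \<longleftrightarrow> (\<forall>\<psi> R. smooth \<psi> \<longrightarrow> (\<forall>x>R. \<psi> x = 0) \<longrightarrow>
     (\<exists>\<phi>. smooth \<phi> \<and> (\<forall>x>R. \<phi> x = 0) \<and> odo_fun p \<phi> = \<psi>))"

definition right_stable :: "odo \<Rightarrow> bool" where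
  "right_stable p \<longleftrightarrow> (\<forall>a R. \<exists>C\<ge>0. \<forall>\<phi> M. smooth \<phi> \<longrightarrow> (\<forall>x>R. \<phi> x = 0) \<longrightarrow>
     (\<forall>x\<ge>a. \<bar>odo_fun p \<phi> x\<bar> \<le> M) \<longrightarrow> (\<forall>x\<ge>a. \<bar>\<phi> x\<bar> \<le> C * M))"

lemma right_stableE:
  assumes "right_stable p"
  obtains C where "C \<ge> 0" "\<And>\<phi> M x. smooth \<phi> \<Longrightarrow> (\<And>x. x > R \<Longrightarrow> \<phi> x = 0) \<Longrightarrow>
    (\<And>x. x \<ge> a \<Longrightarrow> \<bar>odo_fun p \<phi> x\<bar> \<le> M) \<Longrightarrow> x \<ge> a \<Longrightarrow> \<bar>\<phi> x\<bar> \<le> C * M"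
proof -
  obtain C where "C \<ge> 0" "\<forall>\<phi> M. smooth \<phi> \<longrightarrow> (\<forall>x>R. \<phi> x = 0) \<longrightarrow>
     (\<forall>x\<ge>a. \<bar>odo_fun p \<phi> x\<bar> \<le> M) \<longrightarrow> (\<forall>x\<ge>a. \<bar>\<phi> x\<bar> \<le> C * M)"
    using assms unfolding right_stable_def by blast
  then show ?thesis by (intro that[of C]) auto
qed

lemma right_solvableE:
  assumes "right_solvable p" "smooth \<psi>" "\<And>x. x > R \<Longrightarrow> \<psi> x = 0"
  obtains \<phi> where "smooth \<phi>" "\<And>x. x > R \<Longrightarrow> \<phi> x = 0" "odo_fun p \<phi> = \<psi>"
  using assms unfolding right_solvable_def by blast

lemma right_solvable_mult:
  assumes "right_solvable p" "right_solvable q" shows "right_solvable (p * q)"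
  unfolding right_solvable_def
proof (intro allI impI)
  fix \<psi> :: "real \<Rightarrow> real" and R assume \<psi>: "smooth \<psi>" "\<forall>x>R. \<psi> x = 0"
  obtain \<omega> where \<omega>: "smooth \<omega>" "\<And>x. x > R \<Longrightarrow> \<omega> x = 0" "odo_fun p \<omega> = \<psi>"
    by (rule right_solvableE[OF assms(1) \<psi>(1), of R]) (use \<psi>(2) in auto)
  obtain \<phi> where \<phi>: "smooth \<phi>" "\<And>x. x > R \<Longrightarrow> \<phi> x = 0" "odo_fun q \<phi> = \<omega>"
    by (rule right_solvableE[OF assms(2) \<omega>(1), of R]) (use \<omega>(2) in auto)
  show "\<exists>\<phi>. smooth \<phi> \<and> (\<forall>x>R. \<phi> x = 0) \<and> odo_fun (p * q) \<phi> = \<psi>"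
    using \<phi> \<omega> by (intro exI[of _ \<phi>]) (simp add: odo_fun_mult)
qed

lemma right_stable_mult:
  assumes "right_stable p" "right_stable q" shows "right_stable (p * q)"
  unfolding right_stable_def
proof (intro allI)
  fix a R :: real
  obtain C where C: "C \<ge> 0" "\<And>\<phi> M x. smooth \<phi> \<Longrightarrow> (\<And>x. x > R \<Longrightarrow> \<phi> x = 0) \<Longrightarrow>
      (\<And>x. x \<ge> a \<Longrightarrow> \<bar>odo_fun p \<phi> x\<bar> \<le> M) \<Longrightarrow> x \<ge> a \<Longrightarrow> \<bar>\<phi> x\<bar> \<le> C * M"
    by (rule right_stableE[OF assms(1)]) blast
  obtain D where D: "D \<ge> 0" "\<And>\<phi> M x. smooth \<phi> \<Longrightarrow> (\<And>x. x > R \<Longrightarrow> \<phi> x = 0) \<Longrightarrow>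
      (\<And>x. x \<ge> a \<Longrightarrow> \<bar>odo_fun q \<phi> x\<bar> \<le> M) \<Longrightarrow> x \<ge> a \<Longrightarrow> \<bar>\<phi> x\<bar> \<le> D * M"
    by (rule right_stableE[OF assms(2)]) blast
  have "\<bar>\<phi> x\<bar> \<le> (D * C) * M"
    if \<phi>: "smooth \<phi>" "\<forall>x>R. \<phi> x = 0" "\<forall>x\<ge>a. \<bar>odo_fun (p * q) \<phi> x\<bar> \<le> M" "x \<ge> a" for \<phi> M x
  proof -
    have "\<bar>odo_fun q \<phi> x\<bar> \<le> C * M" if "x \<ge> a" for x
    proof (rule C(2)[of "odo_fun q \<phi>"])
      show "odo_fun q \<phi> x = 0" if "x > R" for x
        using \<phi>(2) that by (intro odo_fun_right_vanishing) auto
    qed (use \<phi> that in \<open>auto simp: smooth_odo_fun odo_fun_mult\<close>)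
    then show ?thesis
      using D(2)[of \<phi> "C * M" x] \<phi> by (simp add: mult.assoc)
  qed
  then show "\<exists>C\<ge>0. \<forall>\<phi> M. smooth \<phi> \<longrightarrow> (\<forall>x>R. \<phi> x = 0) \<longrightarrow>
     (\<forall>x\<ge>a. \<bar>odo_fun (p * q) \<phi> x\<bar> \<le> M) \<longrightarrow> (\<forall>x\<ge>a. \<bar>\<phi> x\<bar> \<le> C * M)"
    using C(1) D(1) by (intro exI[of _ "D * C"]) auto
qed

lemma odo_fun_const: "odo_fun [:c:] f x = c * f x"
  by (simp add: odo_fun_def)

lemma odo_fun_D: "odo_fun [:0, 1:] f x = deriv f x"
  by (simp add: odo_fun_def)

lemma odo_fun_quadratic: "odo_fun [:c, 0, 1:] f x = c * f x + deriv (deriv f) x"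
  by (simp add: odo_fun_def numeral_2_eq_2)

text \<open>The exponential shift \<open>p(D) e\<^sup>c\<^sup>x = e\<^sup>c\<^sup>x p(D + c)\<close>.\<close>

lemma odo_fun_exp_mult:
  assumes "smooth f"
  shows "odo_fun p (\<lambda>x. exp (c * x) * f x) = (\<lambda>x. exp (c * x) * odo_fun (pcompose p [:c, 1:]) f x)"
proof (induction p)
  case 0
  show ?case by (simp add: fun_eq_iff)
next
  case (pCons a p)
  let ?q = "pcompose p [:c, 1:]"
  have sm: "smooth (\<lambda>x. exp (c * x) * f x)" by (intro smooth_mult smooth_exp assms)
  have "((\<lambda>x. exp (c * x) * odo_fun ?q f x) has_field_derivative
      exp (c * x) * (c * odo_fun ?q f x + deriv (odo_fun ?q f) x)) (at x)" for x
    by (auto intro!: derivative_eq_intros smooth_DERIV smooth_odo_fun assms simp: algebra_simps)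
  then have D: "deriv (\<lambda>x. exp (c * x) * odo_fun ?q f x)
      = (\<lambda>x. exp (c * x) * (c * odo_fun ?q f x + deriv (odo_fun ?q f) x))"
    by (intro ext DERIV_imp_deriv)
  have "odo_fun ([:c, 1:] * ?q) f x = c * odo_fun ?q f x + deriv (odo_fun ?q f) x" for x
    by (simp add: odo_fun_add odo_fun_smult odo_fun_pCons assms)
  then show ?case
    by (intro ext, subst odo_fun_pCons[OF sm], subst pCons.IH, subst D)
      (simp add: pcompose_pCons odo_fun_add odo_fun_const algebra_simps del: mult_pCons_left)
qed

lemma right_solvable_shift:
  assumes "right_solvable (pcompose p [:c, 1:])" shows "right_solvable p"
  unfolding right_solvable_def
proof (intro allI impI)
  fix \<psi> :: "real \<Rightarrow> real" and R assume \<psi>: "smooth \<psi>" "\<forall>x>R. \<psi> x = 0"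
  have sm: "smooth (\<lambda>x. exp ((- c) * x) * \<psi> x)" by (intro smooth_mult smooth_exp \<psi>)
  obtain \<phi> where \<phi>: "smooth \<phi>" "\<And>x. x > R \<Longrightarrow> \<phi> x = 0"
      "odo_fun (pcompose p [:c, 1:]) \<phi> = (\<lambda>x. exp ((- c) * x) * \<psi> x)"
    by (rule right_solvableE[OF assms sm, of R]) (use \<psi>(2) in auto)
  have "odo_fun p (\<lambda>x. exp (c * x) * \<phi> x) = \<psi>"
    unfolding odo_fun_exp_mult[OF \<phi>(1)] \<phi>(3) by (simp add: exp_minus field_simps)
  then show "\<exists>\<phi>. smooth \<phi> \<and> (\<forall>x>R. \<phi> x = 0) \<and> odo_fun p \<phi> = \<psi>"
    using \<phi>(2) smooth_mult[OF smooth_exp \<phi>(1)] by (intro exI[of _ "\<lambda>x. exp (c * x) * \<phi> x"]) simp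
qed

text \<open>The exponential factors are bounded only on bounded intervals. This is enough, since everything
  is zero beyond \<open>R\<close> and only points right of \<open>a\<close> are considered.\<close>

lemma right_stable_shift:
  assumes "right_stable (pcompose p [:c, 1:])" shows "right_stable p"
  unfolding right_stable_def
proof (intro allI)
  fix a R :: real
  let ?q = "pcompose p [:c, 1:]"
  obtain C where C: "C \<ge> 0" "\<And>\<phi> M x. smooth \<phi> \<Longrightarrow> (\<And>x. x > R \<Longrightarrow> \<phi> x = 0) \<Longrightarrow>
      (\<And>x. x \<ge> a \<Longrightarrow> \<bar>odo_fun ?q \<phi> x\<bar> \<le> M) \<Longrightarrow> x \<ge> a \<Longrightarrow> \<bar>\<phi> x\<bar> \<le> C * M"
    by (rule right_stableE[OF assms]) blast
  define K where "K = exp (\<bar>c\<bar> * (\<bar>a\<bar> + \<bar>R\<bar>))"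
  have K: "exp (c * x) \<le> K" "exp ((- c) * x) \<le> K" if "x \<ge> a" "x \<le> R" for x
  proof -
    have "\<bar>c * x\<bar> \<le> \<bar>c\<bar> * (\<bar>a\<bar> + \<bar>R\<bar>)"
      unfolding abs_mult using that by (intro mult_left_mono) auto
    then show "exp (c * x) \<le> K" "exp ((- c) * x) \<le> K" by (auto simp: K_def)
  qed
  have K0: "K > 0" by (simp add: K_def)
  have "\<bar>\<phi> x\<bar> \<le> (K * C * K) * M"
    if \<phi>: "smooth \<phi>" "\<forall>x>R. \<phi> x = 0" "\<forall>x\<ge>a. \<bar>odo_fun p \<phi> x\<bar> \<le> M" "x \<ge> a" for \<phi> M x
  proof (cases "x \<le> R")
    case True
    have M: "M \<ge> 0" using \<phi>(3,4) by (meson abs_ge_zero order_trans)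
    define f where "f = (\<lambda>x. exp ((- c) * x) * \<phi> x)"
    have f: "smooth f" unfolding f_def by (intro smooth_mult smooth_exp \<phi>)
    have \<phi>f: "\<phi> = (\<lambda>x. exp (c * x) * f x)" by (simp add: f_def exp_minus field_simps)
    have q: "odo_fun ?q f y = exp ((- c) * y) * odo_fun p \<phi> y" for y
      unfolding \<phi>f odo_fun_exp_mult[OF f] by (simp add: exp_minus field_simps)
    have "\<bar>f x\<bar> \<le> C * (K * M)"
    proof (rule C(2)[OF f])
      fix y assume y: "y \<ge> a"
      show "\<bar>odo_fun ?q f y\<bar> \<le> K * M"
      proof (cases "y \<le> R")
        case True
        then show ?thesis
          unfolding q abs_mult using K(2)[of y] y \<phi>(3) M K0 by (intro mult_mono) auto
      next
        case False
        then have "odo_fun p \<phi> y = 0" using \<phi>(2) by (intro odo_fun_right_vanishing[of R]) auto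
        then show ?thesis using M K0 by (simp add: q)
      qed
    qed (use \<phi> in \<open>auto simp: f_def\<close>)
    then have "exp (c * x) * \<bar>f x\<bar> \<le> K * (C * (K * M))"
      using K(1)[of x] True \<phi>(4) K0 by (intro mult_mono) auto
    moreover have "exp (c * x) * \<bar>f x\<bar> = \<bar>\<phi> x\<bar>"
      by (simp add: \<phi>f abs_mult)
    ultimately show ?thesis by (simp add: mult.assoc)
  next
    case False
    moreover have "M \<ge> 0" using \<phi>(3,4) by (meson abs_ge_zero order_trans)
    ultimately show ?thesis using \<phi>(2) K0 C(1) by simp
  qed
  then show "\<exists>C\<ge>0. \<forall>\<phi> M. smooth \<phi> \<longrightarrow> (\<forall>x>R. \<phi> x = 0) \<longrightarrow>
     (\<forall>x\<ge>a. \<bar>odo_fun p \<phi> x\<bar> \<le> M) \<longrightarrow> (\<forall>x\<ge>a. \<bar>\<phi> x\<bar> \<le> C * M)"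
    using C(1) K0 by (intro exI[of _ "K * C * K"]) auto
qed

lemma right_solvable_const: assumes "c \<noteq> 0" shows "right_solvable [:c:]"
  unfolding right_solvable_def
proof (intro allI impI)
  fix \<psi> R assume "smooth \<psi>" "\<forall>x>R. \<psi> x = (0::real)"
  then show "\<exists>\<phi>. smooth \<phi> \<and> (\<forall>x>R. \<phi> x = 0) \<and> odo_fun [:c:] \<phi> = \<psi>"
    using assms by (intro exI[of _ "\<lambda>x. (1 / c) * \<psi> x"]) (auto simp: odo_fun_const fun_eq_iff smooth_cmult simp del: times_divide_eq_left)
qed

lemma right_stable_const: assumes "c \<noteq> 0" shows "right_stable [:c:]"
  unfolding right_stable_def
proof (intro allI exI[of _ "1 / \<bar>c\<bar>"] conjI impI)
  fix a R M x :: real and \<phi> :: "real \<Rightarrow> real"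
  assume "\<forall>x\<ge>a. \<bar>odo_fun [:c:] \<phi> x\<bar> \<le> M" "x \<ge> a"
  then show "\<bar>\<phi> x\<bar> \<le> 1 / \<bar>c\<bar> * M"
    using assms by (simp add: odo_fun_const abs_mult pos_le_divide_eq mult.commute)
qed simp

lemma right_vanishing_bound:
  fixes F f :: "real \<Rightarrow> real"
  assumes D: "\<And>x. (F has_field_derivative f x) (at x)"
    and "\<And>x. x > R \<Longrightarrow> F x = 0" and f: "\<And>x. x \<ge> a \<Longrightarrow> \<bar>f x\<bar> \<le> M" and "x \<ge> a"
  shows "\<bar>F x\<bar> \<le> (\<bar>R\<bar> + 1 + \<bar>a\<bar>) * M"
proof -
  have M: "M \<ge> 0" using f[of a] abs_ge_zero[of "f a"] by linarith
  show ?thesis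
  proof (cases "x > R")
    case False
    define r where "r = R + 1"
    have r: "x < r" "F r = 0" using False assms(2) by (auto simp: r_def)
    obtain z where z: "x < z" "F r - F x = (r - x) * f z"
      using MVT2[OF r(1), of F f] D by blast
    have "\<bar>F x\<bar> = (r - x) * \<bar>f z\<bar>"
      using z(2) r by (metis abs_minus_cancel abs_mult abs_of_pos diff_0 diff_gt_0_iff_gt)
    also have "\<dots> \<le> (\<bar>R\<bar> + 1 + \<bar>a\<bar>) * M"
      using f[of z] z(1) assms(4) r(1) by (intro mult_mono) (auto simp: r_def)
    finally show ?thesis .
  qed (use assms(2) M in simp)
qed

lemma right_solvable_D: "right_solvable [:0, 1:]"
  unfolding right_solvable_def
proof (intro allI impI)
  fix \<psi> :: "real \<Rightarrow> real" and R assume \<psi>: "smooth \<psi>" "\<forall>x>R. \<psi> x = 0"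
  then obtain F where F: "smooth F" "\<And>x. (F has_field_derivative \<psi> x) (at x)" "\<And>x. x > R \<Longrightarrow> F x = 0"
    using ex_smooth_antiderivative_right[of \<psi> R] by metis
  then show "\<exists>\<phi>. smooth \<phi> \<and> (\<forall>x>R. \<phi> x = 0) \<and> odo_fun [:0, 1:] \<phi> = \<psi>"
    by (intro exI[of _ F]) (auto simp: odo_fun_D DERIV_imp_deriv)
qed

lemma right_stable_D: "right_stable [:0, 1:]"
  unfolding right_stable_def
proof (intro allI exI conjI impI)
  fix a R M x :: real and \<phi> :: "real \<Rightarrow> real"
  assume "smooth \<phi>" "\<forall>x>R. \<phi> x = 0" "\<forall>x\<ge>a. \<bar>odo_fun [:0, 1:] \<phi> x\<bar> \<le> M" "x \<ge> a"
  then show "\<bar>\<phi> x\<bar> \<le> (\<bar>R\<bar> + 1 + \<bar>a\<bar>) * M"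
    by (intro right_vanishing_bound[of \<phi> "deriv \<phi>"] smooth_DERIV) (auto simp: odo_fun_D)
qed simp

text \<open>Variation of constants, with the antiderivatives \<open>A\<close> and \<open>B\<close> that vanish on the right.\<close>

lemma right_solvable_oscillator: assumes "b \<noteq> 0" shows "right_solvable [:b\<^sup>2, 0, 1:]"
  unfolding right_solvable_def
proof (intro allI impI)
  fix \<psi> :: "real \<Rightarrow> real" and R assume \<psi>: "smooth \<psi>" "\<forall>x>R. \<psi> x = 0"
  obtain A where A: "smooth A" "\<And>x. (A has_field_derivative cos (b * x) * \<psi> x) (at x)" "\<And>x. x > R \<Longrightarrow> A x = 0"
    by (rule ex_smooth_antiderivative_right[of "\<lambda>x. cos (b * x) * \<psi> x" R])
      (use \<psi> in \<open>auto intro!: smooth_mult smooth_cos\<close>)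
  obtain B where B: "smooth B" "\<And>x. (B has_field_derivative sin (b * x) * \<psi> x) (at x)" "\<And>x. x > R \<Longrightarrow> B x = 0"
    by (rule ex_smooth_antiderivative_right[of "\<lambda>x. sin (b * x) * \<psi> x" R])
      (use \<psi> in \<open>auto intro!: smooth_mult smooth_sin\<close>)
  define \<phi> where "\<phi> = (\<lambda>x. (1 / b) * (sin (b * x) * A x - cos (b * x) * B x))"
  have "(\<phi> has_field_derivative cos (b * x) * A x + sin (b * x) * B x) (at x)" for x
    unfolding \<phi>_def using assms
    by (auto intro!: derivative_eq_intros A(2) B(2) simp: field_simps)
  then have D1: "deriv \<phi> = (\<lambda>x. cos (b * x) * A x + sin (b * x) * B x)"
    by (intro ext DERIV_imp_deriv)
  have "((\<lambda>x. cos (b * x) * A x + sin (b * x) * B x) has_field_derivative - b\<^sup>2 * \<phi> x + \<psi> x) (at x)" for x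
  proof -
    have "((\<lambda>x. cos (b * x) * A x + sin (b * x) * B x) has_field_derivative
        - b * (sin (b * x) * A x - cos (b * x) * B x) + ((cos (b * x))\<^sup>2 + (sin (b * x))\<^sup>2) * \<psi> x) (at x)"
      by (auto intro!: derivative_eq_intros A(2) B(2) simp: algebra_simps power2_eq_square
          simp del: sin_cos_squared_add sin_cos_squared_add2 sin_cos_squared_add3)
    then show ?thesis using assms by (simp add: \<phi>_def power2_eq_square)
  qed
  then have "deriv (deriv \<phi>) x = - b\<^sup>2 * \<phi> x + \<psi> x" for x
    unfolding D1 by (rule DERIV_imp_deriv)
  then have "odo_fun [:b\<^sup>2, 0, 1:] \<phi> = \<psi>"
    by (intro ext) (simp add: odo_fun_quadratic)
  moreover have "smooth \<phi>" unfolding \<phi>_def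
    by (intro smooth_cmult smooth_diff smooth_mult smooth_sin smooth_cos A B)
  ultimately show "\<exists>\<phi>. smooth \<phi> \<and> (\<forall>x>R. \<phi> x = 0) \<and> odo_fun [:b\<^sup>2, 0, 1:] \<phi> = \<psi>"
    using A(3) B(3) by (intro exI[of _ \<phi>]) (simp add: \<phi>_def)
qed

text \<open>The functions \<open>A\<close> and \<open>B\<close> are the coefficients from variation of constants, recovered from the
  solution by rotating the vector \<open>(b \<phi>, \<phi>')\<close>. Their derivatives are \<open>cos (b x) \<psi>\<close> and \<open>sin (b x) \<psi>\<close>.\<close>

lemma right_stable_oscillator: assumes "b \<noteq> 0" shows "right_stable [:b\<^sup>2, 0, 1:]"
  unfolding right_stable_def
proof (intro allI exI conjI impI)
  fix a R M x :: real and \<phi> :: "real \<Rightarrow> real"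
  assume \<phi>: "smooth \<phi>" "\<forall>x>R. \<phi> x = 0" "\<forall>x\<ge>a. \<bar>odo_fun [:b\<^sup>2, 0, 1:] \<phi> x\<bar> \<le> M" and "x \<ge> a"
  define \<psi> where "\<psi> = odo_fun [:b\<^sup>2, 0, 1:] \<phi>"
  define A where "A = (\<lambda>x. sin (b * x) * (b * \<phi> x) + cos (b * x) * deriv \<phi> x)"
  define B where "B = (\<lambda>x. sin (b * x) * deriv \<phi> x - cos (b * x) * (b * \<phi> x))"
  have \<psi>: "\<bar>sin (b * x) * \<psi> x\<bar> \<le> M" "\<bar>cos (b * x) * \<psi> x\<bar> \<le> M" if "x \<ge> a" for x
    using mult_mono[of "\<bar>sin (b * x)\<bar>" 1 "\<bar>\<psi> x\<bar>" M] mult_mono[of "\<bar>cos (b * x)\<bar>" 1 "\<bar>\<psi> x\<bar>" M]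
      \<phi>(3) that by (auto simp: abs_mult \<psi>_def)
  have d0: "deriv \<phi> x = 0" if "x > R" for x
    using odo_fun_right_vanishing[of R \<phi> x "[:0, 1:]"] \<phi>(2) that by (simp add: odo_fun_D)
  have "\<bar>A x\<bar> \<le> (\<bar>R\<bar> + 1 + \<bar>a\<bar>) * M"
  proof (rule right_vanishing_bound[where F = A and f = "\<lambda>x. cos (b * x) * \<psi> x"])
    show "(A has_field_derivative cos (b * x) * \<psi> x) (at x)" for x
      unfolding A_def \<psi>_def odo_fun_quadratic
      by (auto intro!: derivative_eq_intros smooth_DERIV smooth_deriv \<phi>(1) simp: algebra_simps power2_eq_square)
  qed (use \<psi>(2) \<open>x \<ge> a\<close> \<phi>(2) d0 in \<open>auto simp: A_def\<close>)
  moreover have "\<bar>B x\<bar> \<le> (\<bar>R\<bar> + 1 + \<bar>a\<bar>) * M"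
  proof (rule right_vanishing_bound[where F = B and f = "\<lambda>x. sin (b * x) * \<psi> x"])
    show "(B has_field_derivative sin (b * x) * \<psi> x) (at x)" for x
      unfolding B_def \<psi>_def odo_fun_quadratic
      by (auto intro!: derivative_eq_intros smooth_DERIV smooth_deriv \<phi>(1) simp: algebra_simps power2_eq_square)
  qed (use \<psi>(1) \<open>x \<ge> a\<close> \<phi>(2) d0 in \<open>auto simp: B_def\<close>)
  moreover have "\<bar>b\<bar> * \<bar>\<phi> x\<bar> \<le> \<bar>A x\<bar> + \<bar>B x\<bar>"
  proof -
    have "b * \<phi> x = ((sin (b * x))\<^sup>2 + (cos (b * x))\<^sup>2) * (b * \<phi> x)" by simp
    also have "\<dots> = sin (b * x) * A x - cos (b * x) * B x"
      unfolding A_def B_def by (simp only: algebra_simps power2_eq_square)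
    also have "\<bar>\<dots>\<bar> \<le> \<bar>sin (b * x)\<bar> * \<bar>A x\<bar> + \<bar>cos (b * x)\<bar> * \<bar>B x\<bar>"
      unfolding abs_mult[symmetric] by (rule abs_triangle_ineq4)
    also have "\<dots> \<le> 1 * \<bar>A x\<bar> + 1 * \<bar>B x\<bar>"
      by (intro add_mono mult_right_mono) auto
    finally show ?thesis by (simp add: abs_mult)
  qed
  ultimately have "\<bar>b\<bar> * \<bar>\<phi> x\<bar> \<le> (\<bar>R\<bar> + 1 + \<bar>a\<bar>) * M + (\<bar>R\<bar> + 1 + \<bar>a\<bar>) * M"
    by linarith
  then have "\<bar>\<phi> x\<bar> * \<bar>b\<bar> \<le> 2 * (\<bar>R\<bar> + 1 + \<bar>a\<bar>) * M"
    by (simp add: algebra_simps)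
  then show "\<bar>\<phi> x\<bar> \<le> (2 * (\<bar>R\<bar> + 1 + \<bar>a\<bar>) / \<bar>b\<bar>) * M"
    using assms by (simp add: pos_le_divide_eq)
qed simp

lemma map_poly_of_real_mult:
  "map_poly of_real (p * q) = map_poly of_real p * (map_poly of_real q :: complex poly)"
  by (rule poly_eqI) (simp add: coeff_map_poly coeff_mult)

lemma map_poly_of_real_add:
  "map_poly of_real (p + q) = map_poly of_real p + (map_poly of_real q :: complex poly)"
  by (rule poly_eqI) (simp add: coeff_map_poly)

text \<open>The remainder modulo the quadratic has degree at most 1, real coefficients and the nonreal root
  \<open>z\<close>, so it is zero.\<close>

lemma real_poly_quadratic_factor:
  fixes p :: "real poly" and z :: complex
  assumes "poly (map_poly of_real p) z = 0" "Im z \<noteq> 0"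
  shows "[:(Re z)\<^sup>2 + (Im z)\<^sup>2, - 2 * Re z, 1:] dvd p"
proof -
  define q where "q = [:(Re z)\<^sup>2 + (Im z)\<^sup>2, - 2 * Re z, 1:]"
  define r where "r = p mod q"
  have "degree r < 2"
    using degree_mod_less[of q p] by (auto simp: q_def r_def)
  then obtain c d where r: "r = [:c, d:]"
  proof -
    assume *: "\<And>c d. r = [:c, d:] \<Longrightarrow> thesis"
    have "r = [:coeff r 0, coeff r 1:]"
    proof (rule poly_eqI)
      fix n show "coeff r n = coeff [:coeff r 0, coeff r 1:] n"
        using coeff_eq_0[of r n] \<open>degree r < 2\<close> by (cases "n \<le> 1") (auto simp: coeff_pCons le_Suc_eq split: nat.split)
    qed
    then show thesis by (rule *)
  qed
  have "poly (map_poly of_real q) z = 0"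
    by (simp add: q_def complex_eq_iff power2_eq_square algebra_simps map_poly_pCons)
  moreover have "map_poly of_real p = map_poly of_real (p div q) * map_poly of_real q + map_poly (of_real :: real \<Rightarrow> complex) r"
    unfolding r_def
    by (metis div_mult_mod_eq map_poly_of_real_mult map_poly_of_real_add)
  ultimately have "poly (map_poly of_real r) z = 0" using assms(1) by simp
  then have "c = 0" "d = 0" using assms(2) by (auto simp: r complex_eq_iff map_poly_pCons)
  then show ?thesis using r unfolding r_def q_def by (simp add: dvd_eq_mod_eq_0)
qed

lemma real_poly_factor:
  fixes p :: "real poly"
  assumes "degree p > 0"
  obtains q r where "p = q * r" "\<exists>a b. q = [:- a, 1:] \<or> b \<noteq> 0 \<and> q = [:a\<^sup>2 + b\<^sup>2, - 2 * a, 1:]"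
proof -
  have "\<not> constant (poly (map_poly complex_of_real p))"
    using assms by (simp add: constant_degree degree_map_poly)
  then obtain z where z: "poly (map_poly complex_of_real p) z = 0"
    using fundamental_theorem_of_algebra by blast
  show ?thesis
  proof (cases "Im z = 0")
    case True
    then obtain x where x: "z = of_real x" by (metis complex_is_Real_iff Reals_cases)
    have "complex_of_real (poly p x) = 0"
      using z by (simp add: x poly_altdef coeff_map_poly degree_map_poly)
    then have "[:- x, 1:] dvd p" by (simp add: poly_eq_0_iff_dvd)
    then obtain r where "p = [:- x, 1:] * r" by (rule dvdE)
    then show ?thesis using that by blast
  next
    case False
    then obtain r where "p = [:(Re z)\<^sup>2 + (Im z)\<^sup>2, - 2 * Re z, 1:] * r"
      using real_poly_quadratic_factor[OF z] by (auto elim: dvdE)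
    then show ?thesis using that False by blast
  qed
qed

text \<open>By induction over a factorization into linear and quadratic real factors; the shift by the real
  part of the root turns these into \<open>D\<close> and \<open>D\<^sup>2 + b\<^sup>2\<close>.\<close>

lemma right_solvable_stable:
  assumes "p \<noteq> 0" shows "right_solvable p \<and> right_stable p"
  using assms
proof (induction "degree p" arbitrary: p rule: less_induct)
  case less
  show ?case
  proof (cases "degree p = 0")
    case True
    then obtain c where "p = [:c:]" by (elim degree_eq_zeroE)
    then show ?thesis using less.prems by (simp add: right_solvable_const right_stable_const)
  next
    case False
    then obtain q r where p: "p = q * r"
      and q: "\<exists>a b. q = [:- a, 1:] \<or> b \<noteq> 0 \<and> q = [:a\<^sup>2 + b\<^sup>2, - 2 * a, 1:]"
      using real_poly_factor[of p] by auto
    have "q \<noteq> 0" "degree q > 0" "r \<noteq> 0" using q less.prems p by auto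
    then have "right_solvable r \<and> right_stable r"
      by (intro less.hyps) (auto simp: p degree_mult_eq)
    moreover have "right_solvable q \<and> right_stable q"
    proof -
      obtain a b where "q = [:- a, 1:] \<or> b \<noteq> 0 \<and> q = [:a\<^sup>2 + b\<^sup>2, - 2 * a, 1:]" using q by blast
      then have "pcompose q [:a, 1:] = [:0, 1:] \<or> b \<noteq> 0 \<and> pcompose q [:a, 1:] = [:b\<^sup>2, 0, 1:]"
        by (auto simp: pcompose_pCons power2_eq_square algebra_simps)
      then show ?thesis
        using right_solvable_shift[of q a] right_stable_shift[of q a] right_solvable_D right_stable_D
          right_solvable_oscillator[of b] right_stable_oscillator[of b] by metis
    qed
    ultimately show ?thesis by (simp add: p right_solvable_mult right_stable_mult)
  qed
qed

lemma right_vanishing_unique: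
  assumes "p \<noteq> 0" and f: "smooth f" "\<And>x. x > R \<Longrightarrow> f x = 0" and g: "smooth g" "\<And>x. x > R' \<Longrightarrow> g x = 0"
    and eq: "\<And>x. x \<ge> a \<Longrightarrow> odo_fun p f x = odo_fun p g x" and "x \<ge> a"
  shows "f x = g x"
proof -
  obtain C where C: "\<And>\<phi> M x. smooth \<phi> \<Longrightarrow> (\<And>x. x > max R R' \<Longrightarrow> \<phi> x = 0) \<Longrightarrow>
      (\<And>x. x \<ge> a \<Longrightarrow> \<bar>odo_fun p \<phi> x\<bar> \<le> M) \<Longrightarrow> x \<ge> a \<Longrightarrow> \<bar>\<phi> x\<bar> \<le> C * M"
    by (rule right_stableE[of p "max R R'" a]) (use right_solvable_stable[OF assms(1)] in blast)+
  have g': "smooth (\<lambda>x. (-1) * g x)" by (rule smooth_cmult[OF g(1)])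
  have "\<bar>f x + (-1) * g x\<bar> \<le> C * 0"
  proof (rule C[of "\<lambda>x. f x + (-1) * g x" 0 x])
    show "\<bar>odo_fun p (\<lambda>x. f x + (-1) * g x) x\<bar> \<le> 0" if "x \<ge> a" for x
      using eq[OF that] by (simp only: odo_fun_linear(1)[OF f(1) g'] odo_fun_linear(2)[OF g(1) g(1)])
  qed (use f g g' assms(7) in \<open>auto intro: smooth_diff\<close>)
  then show ?thesis by simp
qed

lemma test_fun_right_vanishing: "\<exists>R. \<forall>x>R. tapp \<phi> x = 0"
proof -
  obtain r where r: "\<And>x. \<bar>x\<bar> \<ge> r \<Longrightarrow> tapp \<phi> x = 0" using test_fun_vanishes_outside by blast
  have "tapp \<phi> x = 0" if "x > r" for x by (rule r) (use that in auto)
  then show ?thesis by blast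
qed

section \<open>Causal distributions\<close>

lemma causal_iff: "causal T \<longleftrightarrow> (\<forall>\<phi>. fsupp (tapp \<phi>) \<subseteq> {..<0} \<longrightarrow> dapp T \<phi> = 0)"
proof
  assume "causal T"
  then show "\<forall>\<phi>. fsupp (tapp \<phi>) \<subseteq> {..<0} \<longrightarrow> dapp T \<phi> = 0"
    unfolding causal_def by (intro allI impI dapp_eq_0_if_disjoint) force
next
  assume "\<forall>\<phi>. fsupp (tapp \<phi>) \<subseteq> {..<0} \<longrightarrow> dapp T \<phi> = 0"
  then have "{..<0} \<subseteq> - dsupp T" unfolding dsupp_def by (auto intro!: exI[of _ "{..<0}"])
  then show "causal T"
    unfolding causal_def by (meson ComplD atLeast_iff lessThan_iff not_le subsetD subsetI)
qed

lemma anticausal_iff: "anticausal T \<longleftrightarrow> (\<forall>\<phi>. fsupp (tapp \<phi>) \<subseteq> {0<..} \<longrightarrow> dapp T \<phi> = 0)"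
proof
  assume "anticausal T"
  then show "\<forall>\<phi>. fsupp (tapp \<phi>) \<subseteq> {0<..} \<longrightarrow> dapp T \<phi> = 0"
    unfolding anticausal_def by (intro allI impI dapp_eq_0_if_disjoint) force
next
  assume "\<forall>\<phi>. fsupp (tapp \<phi>) \<subseteq> {0<..} \<longrightarrow> dapp T \<phi> = 0"
  then have "{0<..} \<subseteq> - dsupp T" unfolding dsupp_def by (auto intro!: exI[of _ "{0<..}"])
  then show "anticausal T"
    unfolding anticausal_def by (meson ComplD atMost_iff greaterThan_iff not_le subsetD subsetI)
qed

lemma treflect_treflect [simp]: "treflect (treflect \<phi>) = \<phi>"
  by (rule test_fun_eqI) (simp add: tapp_treflect)

lemma dreflect_dreflect [simp]: "dreflect (dreflect T) = T"
  by (rule distribution_eqI) (simp add: dapp_dreflect)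

lemma anticausal_dreflect: assumes "causal T" shows "anticausal (dreflect T)"
  unfolding anticausal_iff dapp_dreflect
proof (intro allI impI)
  fix \<phi> assume "fsupp (tapp \<phi>) \<subseteq> {0<..}"
  then have "fsupp (tapp (treflect \<phi>)) \<subseteq> {..<0}" using fsupp_treflect[of \<phi>] by force
  then show "dapp T (treflect \<phi>) = 0" using assms by (simp add: causal_iff)
qed

lemma causal_dreflect: assumes "anticausal T" shows "causal (dreflect T)"
  unfolding causal_iff dapp_dreflect
proof (intro allI impI)
  fix \<phi> assume "fsupp (tapp \<phi>) \<subseteq> {..<0}"
  then have "fsupp (tapp (treflect \<phi>)) \<subseteq> {0<..}" using fsupp_treflect[of \<phi>] by force
  then show "dapp T (treflect \<phi>) = 0" using assms by (simp add: anticausal_iff)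
qed

lemma fsupp_odo_test: "fsupp (tapp (odo_test p \<phi>)) \<subseteq> fsupp (tapp \<phi>)"
proof (rule fsupp_subsetI)
  fix x assume "x \<notin> fsupp (tapp \<phi>)"
  then have "odo_fun p (tapp \<phi>) x = odo_fun p (\<lambda>x. 0) x"
    by (intro odo_fun_cong_open[of "- fsupp (tapp \<phi>)"] not_in_fsupp[of _ "tapp \<phi>"])
      (auto simp: fsupp_def)
  then show "tapp (odo_test p \<phi>) x = 0" by (simp add: tapp_odo_test odo_fun_zero)
qed (simp add: fsupp_def)

lemma causal_sum: "(\<And>i. i \<in> I \<Longrightarrow> causal (f i)) \<Longrightarrow> causal (\<Sum>i\<in>I. f i)"
  by (induction I rule: infinite_finite_induct) (auto simp: causal_iff)

lemma causal_odo_app: "causal T \<Longrightarrow> causal (odo_app p T)"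
  unfolding causal_iff dapp_odo_app_adjoint using fsupp_odo_test by (meson subset_trans)

section \<open>Causal Green's functions\<close>

text \<open>\<open>T\<close> is tested with \<open>p* \<eta>\<close>, where \<open>\<eta>\<close> is the backward solution \<open>\<phi>\<close> of \<open>p* \<phi> = \<psi>\<close> cut off on \<open>[-2, -1]\<close>.
  The cutoff destroys the equation only to the left of -1, where \<open>T\<close> does not see it.\<close>

lemma causal_odo_app_eq_0:
  assumes "p \<noteq> 0" "causal T" "odo_app p T = 0"
  shows "T = 0"
proof (rule distribution_eqI)
  fix \<psi>
  define p' where "p' = odo_adjoint p"
  obtain R where R: "\<And>x. x > R \<Longrightarrow> tapp \<psi> x = 0" using test_fun_right_vanishing by blast
  obtain \<phi> where \<phi>: "smooth \<phi>" "\<And>x. x > R \<Longrightarrow> \<phi> x = 0" "odo_fun p' \<phi> = tapp \<psi>"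
    by (rule right_solvableE[of p' "tapp \<psi>" R]) (use right_solvable_stable[of p'] assms(1) R in \<open>auto simp: p'_def\<close>)
  obtain \<theta> where \<theta>: "smooth \<theta>" "\<And>x. x \<le> - 2 \<Longrightarrow> \<theta> x = 0" "\<And>x. x \<ge> - 1 \<Longrightarrow> \<theta> x = 1"
    using ex_smooth_step[of "-2" "-1"] by auto
  have "tapp (Abs_test_fun (\<lambda>x. \<theta> x * \<phi> x)) = (\<lambda>x. \<theta> x * \<phi> x)"
    by (rule tapp_Abs_test_fun[of _ "max 2 \<bar>R\<bar>"])
      (use smooth_mult[OF \<theta>(1) \<phi>(1)] \<theta>(2) \<phi>(2) in \<open>auto simp: abs_if split: if_splits\<close>)
  then obtain \<eta> where \<eta>: "tapp \<eta> = (\<lambda>x. \<theta> x * \<phi> x)" by blast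
  have "tapp (odo_test p' \<eta>) x = tapp \<psi> x" if "x \<in> {-1<..}" for x
    unfolding tapp_odo_test \<phi>(3)[symmetric] \<eta>
    by (rule odo_fun_cong_open[of "{-1<..}"]) (use that \<theta>(3) in auto)
  moreover have "dsupp T \<subseteq> {-1<..}" using assms(2) by (force simp: causal_def)
  ultimately have "dapp T \<psi> = dapp T (odo_test p' \<eta>)"
    by (intro dapp_cong_open[of "{-1<..}"]) auto
  also have "\<dots> = dapp (odo_app p T) \<eta>" by (simp add: dapp_odo_app_adjoint p'_def)
  finally show "dapp T \<psi> = dapp 0 \<psi>" using assms(3) by simp
qed

text \<open>The Green's function maps \<open>\<psi>\<close> to \<open>\<phi>(0)\<close>, where \<open>\<phi>\<close> is the backward solution of \<open>p* \<phi> = \<psi>\<close>. Linearity and the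
  Green's equation hold by uniqueness, continuity holds by stability, and it is causal because \<open>\<phi>(0)\<close> depends on
  \<open>\<psi>\<close> only at points to the right of 0.\<close>

lemma ex_causal_green:
  assumes "p \<noteq> 0" obtains g where "causal g" "odo_app p g = dirac"
proof -
  define q where "q = odo_adjoint p"
  have q: "q \<noteq> 0" using assms by (simp add: q_def)
  have q': "right_solvable q" "right_stable q" using right_solvable_stable[OF q] by auto
  have "\<forall>\<psi>. \<exists>\<phi>. smooth \<phi> \<and> (\<forall>R. (\<forall>x>R. tapp \<psi> x = 0) \<longrightarrow> (\<forall>x>R. \<phi> x = 0)) \<and> odo_fun q \<phi> = tapp \<psi>"
  proof
    fix \<psi>
    obtain R where R: "\<And>x. x > R \<Longrightarrow> tapp \<psi> x = 0" using test_fun_right_vanishing by blast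
    obtain \<phi> where \<phi>: "smooth \<phi>" "\<And>x. x > R \<Longrightarrow> \<phi> x = 0" "odo_fun q \<phi> = tapp \<psi>"
      by (rule right_solvableE[OF q'(1) smooth_tapp R]) blast+
    have "\<phi> x = 0" if R': "\<forall>x>R'. tapp \<psi> x = 0" "x > R'" for R' x
      by (rule right_vanishing_unique[OF q \<phi>(1,2) smooth_zero, where R' = 0 and a = x])
        (use R' \<phi>(3) in \<open>auto simp: odo_fun_zero\<close>)
    then show "\<exists>\<phi>. smooth \<phi> \<and> (\<forall>R. (\<forall>x>R. tapp \<psi> x = 0) \<longrightarrow> (\<forall>x>R. \<phi> x = 0)) \<and> odo_fun q \<phi> = tapp \<psi>"
      using \<phi> by blast
  qed
  from choice[OF this] obtain S where S: "\<And>\<psi>. smooth (S \<psi>)"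
      "\<And>\<psi> R x. \<forall>x>R. tapp \<psi> x = 0 \<Longrightarrow> x > R \<Longrightarrow> S \<psi> x = 0" "\<And>\<psi>. odo_fun q (S \<psi>) = tapp \<psi>"
    by blast
  \<comment> \<open>equality of the data on \<open>[a, \<infinity>)\<close> is enough, by uniqueness on that half line\<close>
  have S_unique: "S \<psi> x = f x"
    if "smooth f" "\<And>x. x > R \<Longrightarrow> f x = 0" "\<And>x. x \<ge> a \<Longrightarrow> odo_fun q f x = tapp \<psi> x" "x \<ge> a" for \<psi> f R a x
  proof -
    obtain R' where R': "\<forall>x>R'. tapp \<psi> x = 0" using test_fun_right_vanishing by blast
    have van: "S \<psi> x = 0" if "x > R'" for x using S(2)[OF R' that] .
    show ?thesis
      by (rule right_vanishing_unique[of q "S \<psi>" R' f R a])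
        (simp_all add: q S(1,3) van that)
  qed
  have S_vanish: "\<exists>R. \<forall>x>R. S \<psi> x = 0" for \<psi> using test_fun_right_vanishing[of \<psi>] S(2) by blast
  have lin: "linear (\<lambda>\<psi>. S \<psi> 0)"
  proof (rule linearI)
    fix \<phi> \<psi> :: test_fun and c :: real
    obtain R R' where R: "\<forall>x>R. S \<phi> x = 0" "\<forall>x>R'. S \<psi> x = 0" using S_vanish by meson
    show "S (\<phi> + \<psi>) 0 = S \<phi> 0 + S \<psi> 0"
      by (rule S_unique[of "\<lambda>x. S \<phi> x + S \<psi> x" "max R R'" 0])
        (use R in \<open>auto simp: S odo_fun_linear intro: smooth_add\<close>)
    have "S (c *\<^sub>R \<phi>) 0 = c * S \<phi> 0"
      by (rule S_unique[of "\<lambda>x. c * S \<phi> x" R 0])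
        (use R in \<open>auto simp: odo_fun_linear(2)[OF S(1) S(1)] S(1,3) smooth_cmult\<close>)
    then show "S (c *\<^sub>R \<phi>) 0 = c *\<^sub>R S \<phi> 0" by simp
  qed
  have cont: "dist_continuous (\<lambda>\<psi>. S \<psi> 0)"
    unfolding dist_continuous_def
  proof (intro allI impI)
    fix K :: "real set" assume "compact K"
    then obtain r where r: "\<And>x. x \<in> K \<Longrightarrow> \<bar>x\<bar> \<le> r"
      using compact_imp_bounded by (force simp: bounded_iff)
    obtain C where C: "\<And>\<phi> M x. smooth \<phi> \<Longrightarrow> (\<And>x. x > r \<Longrightarrow> \<phi> x = 0) \<Longrightarrow>
        (\<And>x. x \<ge> 0 \<Longrightarrow> \<bar>odo_fun q \<phi> x\<bar> \<le> M) \<Longrightarrow> x \<ge> 0 \<Longrightarrow> \<bar>\<phi> x\<bar> \<le> C * M"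
      by (rule right_stableE[OF q'(2), of r 0]) blast
    have "\<bar>S \<psi> 0\<bar> \<le> C * (\<Sum>n\<le>0. sup_deriv n \<psi>)" if \<psi>: "fsupp (tapp \<psi>) \<subseteq> K" for \<psi>
    proof -
      have "\<bar>S \<psi> 0\<bar> \<le> C * sup_deriv 0 \<psi>"
      proof (rule C[OF S(1)])
        have "\<forall>x>r. tapp \<psi> x = 0" using \<psi> r not_in_fsupp[of _ "tapp \<psi>"] by force
        then show "S \<psi> x = 0" if "x > r" for x using S(2) that by blast
        show "\<bar>odo_fun q (S \<psi>) x\<bar> \<le> sup_deriv 0 \<psi>" for x
          using sup_deriv_bound[of 0 \<psi> x] by (simp add: S(3))
      qed simp
      then show ?thesis by simp
    qed
    then show "\<exists>C N. \<forall>\<phi>. fsupp (tapp \<phi>) \<subseteq> K \<longrightarrow> \<bar>S \<phi> 0\<bar> \<le> C * (\<Sum>n\<le>N. sup_deriv n \<phi>)" by blast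
  qed
  define g where "g = Abs_distribution (\<lambda>\<psi>. S \<psi> 0)"
  have g: "dapp g \<psi> = S \<psi> 0" for \<psi>
    using lin cont by (simp add: g_def Abs_distribution_inverse)
  have "causal g"
    unfolding causal_iff g
  proof (intro allI impI)
    fix \<psi> assume "fsupp (tapp \<psi>) \<subseteq> {..<0}"
    then have "tapp \<psi> x = 0" if "x \<ge> 0" for x using not_in_fsupp[of x "tapp \<psi>"] that by force
    then show "S \<psi> 0 = 0"
      by (intro S_unique[of "\<lambda>x. 0" 0 0 \<psi>]) (simp_all add: smooth_zero odo_fun_zero)
  qed
  moreover have "odo_app p g = dirac"
  proof (rule distribution_eqI)
    fix \<phi>
    obtain R where "\<forall>x>R. tapp \<phi> x = 0" using test_fun_right_vanishing by blast
    then have "S (odo_test q \<phi>) 0 = tapp \<phi> 0"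
      by (intro S_unique[of "tapp \<phi>" R 0]) (simp_all add: tapp_odo_test)
    then show "dapp (odo_app p g) \<phi> = dapp dirac \<phi>"
      by (simp add: dapp_odo_app_adjoint dapp_dirac g flip: q_def)
  qed
  ultimately show ?thesis using that by blast
qed

lemma odo_app_add_right: "odo_app p (S + T) = odo_app p S + odo_app p T"
  by (rule distribution_eqI) (simp add: dapp_odo_app_adjoint)

lemma odo_app_zero_right [simp]: "odo_app p 0 = 0"
  by (rule distribution_eqI) (simp add: dapp_odo_app_adjoint)

lemma odo_app_diff_right: "odo_app p (S - T) = odo_app p S - odo_app p T"
  using odo_app_add_right[of p "S - T" T] by simp

lemma odo_app_sum_right: "odo_app p (\<Sum>i\<in>I. f i) = (\<Sum>i\<in>I. odo_app p (f i))"
  by (induction I rule: infinite_finite_induct) (auto simp: odo_app_add_right)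

lemma odo_app_0 [simp]: "odo_app 0 T = 0"
  by (simp add: odo_app_def)

lemma odo_app_1 [simp]: "odo_app 1 T = T"
  by (simp add: odo_app_def)

lemma odo_app_sum: "odo_app (\<Sum>i\<in>I. f i) T = (\<Sum>i\<in>I. odo_app (f i) T)"
  by (induction I rule: infinite_finite_induct) (auto simp: odo_app_add)

lemma causal_diff: "causal S \<Longrightarrow> causal T \<Longrightarrow> causal (S - T)"
proof -
  have "dapp (S - T) \<phi> = dapp S \<phi> - dapp T \<phi>" for \<phi>
    using dapp_add[of "S - T" T \<phi>] by simp
  then show "causal S \<Longrightarrow> causal T \<Longrightarrow> causal (S - T)" by (simp add: causal_iff)
qed

lemma causal_green:
  assumes "p \<noteq> 0"
  shows "causal (causal_green p)" "odo_app p (causal_green p) = dirac"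
proof -
  obtain g where g: "causal g" "odo_app p g = dirac" using ex_causal_green[OF assms] by blast
  have "h = g" if "causal h \<and> odo_app p h = dirac" for h
  proof -
    have "h - g = 0"
      by (rule causal_odo_app_eq_0[OF assms]) (use that g in \<open>auto intro: causal_diff simp: odo_app_diff_right\<close>)
    then show ?thesis by simp
  qed
  then have "causal (causal_green p) \<and> odo_app p (causal_green p) = dirac"
    unfolding causal_green_def
    by (rule theI[of "\<lambda>g. causal g \<and> odo_app p g = dirac" g, rotated]) (use g in blast)+
  then show "causal (causal_green p)" "odo_app p (causal_green p) = dirac" by auto
qed

text \<open>Here \<open>x \<mapsto> \<langle>T, \<phi>(x + \<cdot>)\<rangle>\<close> is a test function, so that the convolution can be evaluated without
  extending the pairing.\<close>

lemma dconv_odo_dirac: "dconv S (odo_app q dirac) = odo_app q S"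
proof -
  have "(\<lambda>x. dapp (odo_app q dirac) (ttranslate x \<phi>)) = tapp (odo_test (odo_adjoint q) \<phi>)" for \<phi>
  proof
    fix x
    have "tapp (ttranslate x \<phi>) = (\<lambda>y. 1 * tapp \<phi> (x + 1 * y))"
      by (simp add: tapp_ttranslate fun_eq_iff add.commute)
    then have "(deriv ^^ n) (tapp (ttranslate x \<phi>)) 0 = (deriv ^^ n) (tapp \<phi>) x" for n
      using fun_cong[OF funpow_deriv_affine[OF smooth_tapp[of \<phi>], of n 1 x 1], of 0] by simp
    then show "dapp (odo_app q dirac) (ttranslate x \<phi>) = tapp (odo_test (odo_adjoint q) \<phi>) x"
      by (simp add: dapp_odo_app_adjoint dapp_dirac tapp_odo_test odo_fun_def)
  qed
  then have "dapp_ext S (\<lambda>x. dapp (odo_app q dirac) (ttranslate x \<phi>)) = dapp (odo_app q S) \<phi>" for \<phi>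
    by (simp add: dapp_ext_test_fun dapp_odo_app_adjoint)
  then show ?thesis
    unfolding dconv_def by (intro the_equality) (auto intro: distribution_eqI)
qed

section \<open>Differentiation of a distribution along a curve of test functions\<close>

lemma first_order_remainder_bound:
  fixes c d :: "real \<Rightarrow> real"
  assumes der: "\<And>t. \<bar>t - s\<bar> \<le> 1 \<Longrightarrow> (c has_field_derivative d t) (at t)"
    and lip: "\<And>t. \<bar>t - s\<bar> \<le> 1 \<Longrightarrow> \<bar>d t - d s\<bar> \<le> B * \<bar>t - s\<bar>" and t: "\<bar>t - s\<bar> \<le> 1" and "B \<ge> 0"
  shows "\<bar>c t - c s - (t - s) * d s\<bar> \<le> B * (t - s)\<^sup>2"
proof (cases "t = s")
  case False
  have "\<exists>z. \<bar>z - s\<bar> \<le> \<bar>t - s\<bar> \<and> c t - c s = (t - s) * d z"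
  proof (cases "s < t")
    case True
    obtain z where "s < z" "z < t" "c t - c s = (t - s) * d z"
      using MVT2[OF True, of c d] der t by force
    then show ?thesis by (intro exI[of _ z]) auto
  next
    case False
    then have "t < s" using \<open>t \<noteq> s\<close> by simp
    then obtain z where "t < z" "z < s" "c s - c t = (s - t) * d z"
      using MVT2[of t s c d] der t by force
    then show ?thesis by (intro exI[of _ z]) (auto simp: algebra_simps)
  qed
  then obtain z where z: "\<bar>z - s\<bar> \<le> \<bar>t - s\<bar>" "c t - c s = (t - s) * d z" by blast
  have "\<bar>c t - c s - (t - s) * d s\<bar> = \<bar>t - s\<bar> * \<bar>d z - d s\<bar>"
    unfolding z(2) by (simp add: abs_mult flip: right_diff_distrib)
  also have "\<dots> \<le> \<bar>t - s\<bar> * (B * \<bar>z - s\<bar>)"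
    using lip[of z] z(1) t by (intro mult_left_mono) auto
  also have "\<dots> \<le> \<bar>t - s\<bar> * (B * \<bar>t - s\<bar>)"
    using z(1) \<open>B \<ge> 0\<close> by (intro mult_left_mono) auto
  also have "\<dots> = B * (t - s)\<^sup>2" by (simp add: power2_eq_square flip: abs_mult)
  finally show ?thesis .
qed simp

lemma tderiv_diff: "tderiv (\<phi> - \<psi>) = tderiv \<phi> - tderiv \<psi>"
  and tderiv_scaleR: "tderiv (c *\<^sub>R \<phi>) = c *\<^sub>R tderiv \<phi>"
  by (rule test_fun_eqI, simp add: tapp_tderiv, rule DERIV_imp_deriv,
      intro DERIV_diff DERIV_cmult smooth_DERIV smooth_tapp)+

lemma funpow_tderiv_diff: "(tderiv ^^ n) (\<phi> - \<psi>) = (tderiv ^^ n) \<phi> - (tderiv ^^ n) \<psi>"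
  and funpow_tderiv_scaleR: "(tderiv ^^ n) (c *\<^sub>R \<phi>) = c *\<^sub>R (tderiv ^^ n) \<phi>"
  by (induction n) (simp_all add: tderiv_diff tderiv_scaleR)

lemma sup_deriv_least: "(\<And>x. \<bar>(deriv ^^ n) (tapp \<phi>) x\<bar> \<le> M) \<Longrightarrow> sup_deriv n \<phi> \<le> M"
  unfolding sup_deriv_def by (rule cSUP_least) auto

text \<open>Continuity of \<open>T\<close> on a fixed compact set reduces the claim to first-order expansions of all
  derivatives of \<open>\<Phi> t\<close>, uniformly in \<open>x\<close>. Those follow from Lipschitz bounds on the derivatives \<open>d n x\<close> in \<open>t\<close>.\<close>

lemma dapp_curve_DERIV:
  fixes \<Phi> :: "real \<Rightarrow> test_fun" and d :: "nat \<Rightarrow> real \<Rightarrow> real \<Rightarrow> real"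
  assumes van: "\<And>t x. \<bar>t - s\<bar> \<le> 1 \<Longrightarrow> \<bar>x\<bar> > r \<Longrightarrow> tapp (\<Phi> t) x = 0"
    and van': "\<And>x. \<bar>x\<bar> > r \<Longrightarrow> tapp \<Phi>' x = 0"
    and der: "\<And>n x t. \<bar>t - s\<bar> \<le> 1 \<Longrightarrow>
      ((\<lambda>t. (deriv ^^ n) (tapp (\<Phi> t)) x) has_field_derivative d n x t) (at t)"
    and lip: "\<And>n x t. \<bar>t - s\<bar> \<le> 1 \<Longrightarrow> \<bar>d n x t - d n x s\<bar> \<le> B n * \<bar>t - s\<bar>"
    and B: "\<And>n. B n \<ge> 0"
    and val: "\<And>n x. d n x s = (deriv ^^ n) (tapp \<Phi>') x"
  shows "((\<lambda>t. dapp T (\<Phi> t)) has_field_derivative dapp T \<Phi>') (at s)"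
proof -
  define \<theta> where "\<theta> t = \<Phi> t - \<Phi> s - (t - s) *\<^sub>R \<Phi>'" for t
  obtain C N where CN: "C \<ge> 0"
      "\<And>\<phi> M. fsupp (tapp \<phi>) \<subseteq> {-r..r} \<Longrightarrow> N \<le> M \<Longrightarrow> \<bar>dapp T \<phi>\<bar> \<le> C * (\<Sum>n\<le>M. sup_deriv n \<phi>)"
    by (rule dist_continuousE[OF dist_continuous_dapp[of T] compact_Icc[of "-r" r]]) blast
  define M where "M = C * (\<Sum>n\<le>N. B n)"
  have bound: "\<bar>dapp T (\<theta> t)\<bar> \<le> M * (t - s)\<^sup>2" if t: "\<bar>t - s\<bar> \<le> 1" for t
  proof -
    have "\<bar>(deriv ^^ n) (tapp (\<theta> t)) x\<bar> \<le> B n * (t - s)\<^sup>2" for n x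
    proof -
      have "(deriv ^^ n) (tapp (\<theta> t)) x
          = (deriv ^^ n) (tapp (\<Phi> t)) x - (deriv ^^ n) (tapp (\<Phi> s)) x - (t - s) * d n x s"
        unfolding val \<theta>_def tapp_funpow_tderiv[symmetric] funpow_tderiv_diff funpow_tderiv_scaleR
        by simp
      then show ?thesis
        using first_order_remainder_bound[OF der lip t B, of n x] by simp
    qed
    then have *: "sup_deriv n (\<theta> t) \<le> B n * (t - s)\<^sup>2" for n by (rule sup_deriv_least)
    have "fsupp (tapp (\<theta> t)) \<subseteq> {-r..r}"
    proof (rule fsupp_subsetI)
      fix x assume "x \<notin> {-r..r}"
      then have "\<bar>x\<bar> > r" by auto
      then show "tapp (\<theta> t) x = 0" using van[of t x] van[of s x] van'[of x] t by (simp add: \<theta>_def)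
    qed simp
    then have "\<bar>dapp T (\<theta> t)\<bar> \<le> C * (\<Sum>n\<le>N. sup_deriv n (\<theta> t))" by (rule CN(2)) simp
    also have "\<dots> \<le> C * (\<Sum>n\<le>N. B n * (t - s)\<^sup>2)"
      by (intro mult_left_mono sum_mono * CN(1))
    also have "\<dots> = M * (t - s)\<^sup>2" by (simp add: M_def sum_distrib_right mult.assoc)
    finally show ?thesis .
  qed
  have "((\<lambda>t. (dapp T (\<Phi> t) - dapp T (\<Phi> s)) / (t - s) - dapp T \<Phi>') \<longlongrightarrow> 0) (at s)"
  proof (rule Lim_null_comparison)
    have "eventually (\<lambda>t. t \<in> {s-1<..<s+1}) (at s)"
      by (rule eventually_at_in_open') auto
    moreover have "eventually (\<lambda>t. t \<noteq> s) (at s)" by (simp add: eventually_at_filter)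
    ultimately show "\<forall>\<^sub>F t in at s.
        norm ((dapp T (\<Phi> t) - dapp T (\<Phi> s)) / (t - s) - dapp T \<Phi>') \<le> M * \<bar>t - s\<bar>"
    proof eventually_elim
      case (elim t)
      have "(dapp T (\<Phi> t) - dapp T (\<Phi> s)) / (t - s) - dapp T \<Phi>' = dapp T (\<theta> t) / (t - s)"
        using elim by (simp add: \<theta>_def dapp_diff_right dapp_scaleR_right diff_divide_distrib)
      moreover have "\<bar>dapp T (\<theta> t)\<bar> \<le> M * \<bar>t - s\<bar> * \<bar>t - s\<bar>"
      proof -
        have "\<bar>t - s\<bar> \<le> 1" using elim by auto
        then show ?thesis using bound[of t] by (simp add: power2_eq_square mult.assoc flip: abs_mult)
      qed
      ultimately show ?case using elim by (simp add: pos_divide_le_eq)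
    qed
    have "((\<lambda>t. M * \<bar>t - s\<bar>) \<longlongrightarrow> M * \<bar>s - s\<bar>) (at s)" by (intro tendsto_intros)
    then show "((\<lambda>t. M * \<bar>t - s\<bar>) \<longlongrightarrow> 0) (at s)" by simp
  qed
  then show ?thesis unfolding has_field_derivative_iff by (rule LIM_zero_cancel)
qed

lemma lipschitz_if_DERIV_bound:
  fixes f :: "real \<Rightarrow> real"
  assumes "\<And>x. (f has_field_derivative f' x) (at x)" "\<And>x. \<bar>f' x\<bar> \<le> B"
  shows "\<bar>f t - f s\<bar> \<le> B * \<bar>t - s\<bar>"
  using field_differentiable_bound[of UNIV f f' B t s] assms by (auto simp: norm_minus_commute)

lemma funpow_deriv_ttranslate: "(deriv ^^ n) (tapp (ttranslate t \<phi>)) x = (deriv ^^ n) (tapp \<phi>) (x + t)"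
proof -
  have "tapp (ttranslate t \<phi>) = (\<lambda>y. 1 * tapp \<phi> (t + 1 * y))"
    by (simp add: tapp_ttranslate fun_eq_iff add.commute)
  then show ?thesis
    using fun_cong[OF funpow_deriv_affine[OF smooth_tapp[of \<phi>], of n 1 t 1], of x]
    by (simp add: add.commute)
qed

lemma funpow_deriv_tapp_DERIV:
  "((deriv ^^ n) (tapp \<phi>) has_field_derivative (deriv ^^ Suc n) (tapp \<phi>) x) (at x)"
  using smooth_DERIV[OF smooth_funpow_deriv[OF smooth_tapp[of \<phi>]]] by simp

lemma dapp_ttranslate_DERIV:
  "((\<lambda>t. dapp T (ttranslate t \<phi>)) has_field_derivative dapp T (ttranslate s (tderiv \<phi>))) (at s)"
proof -
  obtain r where r: "r > 0" "\<And>x. \<bar>x\<bar> \<ge> r \<Longrightarrow> tapp \<phi> x = 0"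
    using test_fun_vanishes_outside by blast
  have r': "tapp (tderiv \<phi>) x = 0" if "\<bar>x\<bar> > r" for x
  proof -
    have "fsupp (tapp \<phi>) \<subseteq> {-r..r}" by (rule fsupp_subsetI) (use r(2) in auto)
    then have "x \<notin> fsupp (tapp (tderiv \<phi>))" using fsupp_tderiv[of \<phi>] that by force
    then show ?thesis by (rule not_in_fsupp)
  qed
  show ?thesis
  proof (rule dapp_curve_DERIV[where r = "r + \<bar>s\<bar> + 1" and B = "\<lambda>n. sup_deriv (Suc (Suc n)) \<phi>"
        and d = "\<lambda>n x t. (deriv ^^ Suc n) (tapp \<phi>) (x + t)"])
    show "((\<lambda>t. (deriv ^^ n) (tapp (ttranslate t \<phi>)) x) has_field_derivative
        (deriv ^^ Suc n) (tapp \<phi>) (x + t)) (at t)" for n x t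
      unfolding funpow_deriv_ttranslate
      using DERIV_shift[of "(deriv ^^ n) (tapp \<phi>)" _ t x] funpow_deriv_tapp_DERIV[of n \<phi> "t + x"]
      by (simp add: add.commute)
    show "\<bar>(deriv ^^ Suc n) (tapp \<phi>) (x + t) - (deriv ^^ Suc n) (tapp \<phi>) (x + s)\<bar>
        \<le> sup_deriv (Suc (Suc n)) \<phi> * \<bar>t - s\<bar>" for n x t
      using lipschitz_if_DERIV_bound[OF funpow_deriv_tapp_DERIV sup_deriv_bound, of "Suc n" \<phi> "x + t" "x + s"]
      by simp
    show "(deriv ^^ Suc n) (tapp \<phi>) (x + s) = (deriv ^^ n) (tapp (ttranslate s (tderiv \<phi>))) x" for n x
      by (simp only: funpow_deriv_ttranslate tapp_tderiv funpow_Suc_right comp_apply)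
    show "tapp (ttranslate t \<phi>) x = 0" if "\<bar>t - s\<bar> \<le> 1" "\<bar>x\<bar> > r + \<bar>s\<bar> + 1" for t x
      unfolding tapp_ttranslate by (rule r(2)) (use that in linarith)
    show "tapp (ttranslate s (tderiv \<phi>)) x = 0" if "\<bar>x\<bar> > r + \<bar>s\<bar> + 1" for x
      unfolding tapp_ttranslate by (rule r') (use that in linarith)
  qed (rule sup_deriv_nonneg)
qed

lemma smooth_dapp_ttranslate: "smooth (\<lambda>t. dapp T (ttranslate t \<phi>))"
proof (rule smooth_coinduct[of _ "range (\<lambda>\<phi> t. dapp T (ttranslate t \<phi>))"])
  fix h assume "h \<in> range (\<lambda>\<phi> t. dapp T (ttranslate t \<phi>))"
  then obtain \<phi> where h: "h = (\<lambda>t. dapp T (ttranslate t \<phi>))" by blast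
  show "h differentiable at x" for x
    unfolding h real_differentiable_def using dapp_ttranslate_DERIV by blast
  have "deriv h = (\<lambda>t. dapp T (ttranslate t (tderiv \<phi>)))"
    unfolding h by (intro ext DERIV_imp_deriv dapp_ttranslate_DERIV)
  then show "deriv h \<in> range (\<lambda>\<phi> t. dapp T (ttranslate t \<phi>))" by blast
qed blast

lemma smooth_conv_test: "smooth (conv_test T \<phi>)"
  using smooth_affine[OF smooth_dapp_ttranslate[of T "treflect \<phi>"], of 1 0 "-1"]
  by (simp add: conv_test_def[abs_def])

section \<open>Interchanging a distribution with an integral\<close>

text \<open>The correlation of \<open>f\<close> and \<open>g\<close> with a variable upper limit \<open>s\<close>: as a curve in \<open>s\<close> its velocity is
  \<open>g(s) f(\<cdot> + s)\<close>.\<close>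

definition partial_corr :: "real \<Rightarrow> real \<Rightarrow> (real \<Rightarrow> real) \<Rightarrow> (real \<Rightarrow> real) \<Rightarrow> real \<Rightarrow> real" where
  "partial_corr a s f g y = integral {a..s} (\<lambda>x. f (y + x) * g x)"

lemma continuous_on_partial_corr:
  assumes "smooth f" "smooth g" shows "continuous_on S (\<lambda>x. f (y + x) * g x)"
  using smooth_mult[OF smooth_affine[OF assms(1), of 1 y 1] assms(2)]
  by (intro smooth_imp_continuous_on) simp

lemma partial_corr_DERIV:
  assumes "smooth f" "smooth g"
  shows "(partial_corr a s f g has_field_derivative partial_corr a s (deriv f) g y) (at y)"
proof -
  have "((\<lambda>y. integral (cbox a s) (\<lambda>x. f (y + x) * g x)) has_field_derivative
      integral (cbox a s) (\<lambda>x. deriv f (y + x) * g x)) (at y within UNIV)"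
  proof (rule leibniz_rule_field_derivative)
    show "((\<lambda>y. f (y + x) * g x) has_field_derivative deriv f (y + x) * g x) (at y within UNIV)" for y x
      using DERIV_cmult_right[of "\<lambda>y. f (y + x)" "deriv f (y + x)" y UNIV "g x"]
        DERIV_shift[of f "deriv f (y + x)" y x] smooth_DERIV[OF assms(1), of "y + x"] by simp
    show "(\<lambda>x. f (y + x) * g x) integrable_on cbox a s" for y
      by (intro integrable_continuous continuous_on_partial_corr assms)
    have cf: "continuous_on UNIV (deriv f)" and cg: "continuous_on UNIV g"
      using assms by (auto intro: smooth_imp_continuous_on smooth_deriv)
    have "continuous_on (UNIV \<times> cbox a s) (\<lambda>z. deriv f (fst z + snd z) * g (snd z))"
      by (rule continuous_on_mult[OF continuous_on_compose2[OF cf] continuous_on_compose2[OF cg]])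
        (auto intro!: continuous_on_add continuous_on_fst continuous_on_snd continuous_on_id)
    then show "continuous_on (UNIV \<times> cbox a s) (\<lambda>(y, x). deriv f (y + x) * g x)"
      by (simp add: case_prod_beta)
  qed auto
  then show ?thesis by (simp add: partial_corr_def[abs_def])
qed

lemma deriv_partial_corr:
  assumes "smooth f" "smooth g" shows "deriv (partial_corr a s f g) = partial_corr a s (deriv f) g"
  by (intro ext DERIV_imp_deriv partial_corr_DERIV assms)

lemma smooth_partial_corr:
  assumes "smooth f" "smooth g" shows "smooth (partial_corr a s f g)"
proof (rule smooth_coinduct[of _ "(\<lambda>f. partial_corr a s f g) ` Collect smooth"])
  fix h assume "h \<in> (\<lambda>f. partial_corr a s f g) ` Collect smooth"
  then obtain f where f: "smooth f" "h = partial_corr a s f g" by blast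
  show "h differentiable at x" for x
    unfolding f(2) real_differentiable_def using partial_corr_DERIV[OF f(1) assms(2)] by blast
  show "deriv h \<in> (\<lambda>f. partial_corr a s f g) ` Collect smooth"
    unfolding f(2) deriv_partial_corr[OF f(1) assms(2)] using smooth_deriv[OF f(1)] by blast
qed (use assms in blast)

lemma funpow_deriv_partial_corr:
  assumes "smooth f" "smooth g"
  shows "(deriv ^^ n) (partial_corr a s f g) = partial_corr a s ((deriv ^^ n) f) g"
  by (induction n) (simp_all add: deriv_partial_corr smooth_funpow_deriv assms)

lemma partial_corr_DERIV_upper:
  assumes "smooth f" "smooth g" "a < s"
  shows "((\<lambda>s. partial_corr a s f g y) has_field_derivative f (y + s) * g s) (at s)"
proof -
  have "((\<lambda>s. integral {a..s} (\<lambda>x. f (y + x) * g x)) has_field_derivative f (y + s) * g s)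
      (at s within {a..s + 1})"
    by (rule integral_has_real_derivative) (use continuous_on_partial_corr[OF assms(1,2)] assms(3) in auto)
  moreover have "at s within {a..s + 1} = at s"
    by (rule at_within_interior) (use assms(3) in auto)
  ultimately show ?thesis by (simp add: partial_corr_def)
qed

lemma LINT_compact_support:
  fixes h :: "real \<Rightarrow> real"
  assumes "continuous_on UNIV h" "\<And>x. \<bar>x\<bar> > r \<Longrightarrow> h x = 0"
  shows "integrable lborel h" "(LINT x|lborel. h x) = integral {-r..r} h"
proof -
  have eq: "(\<lambda>x. indicator {-r..r} x *\<^sub>R h x) = h"
  proof
    fix x show "indicator {-r..r} x *\<^sub>R h x = h x"
      using assms(2)[of x] by (cases "x \<in> {-r..r}") auto
  qed
  have "integrable lborel (\<lambda>x. indicator {-r..r} x *\<^sub>R h x)"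
    by (rule borel_integrable_compact) (use assms(1) continuous_on_subset in auto)
  then have "set_integrable lborel {-r..r} h" by (simp add: set_integrable_def)
  then show "integrable lborel h" "(LINT x|lborel. h x) = integral {-r..r} h"
    using set_borel_integral_eq_integral(2)[of "{-r..r}" h]
    by (simp_all only: set_integrable_def set_lebesgue_integral_def eq)
qed

text \<open>By the fundamental theorem of calculus in the upper limit \<open>s\<close>: the value of \<open>T\<close> on the partial
  correlations has derivative \<open>\<langle>T, f(\<cdot> + s)\<rangle> g(s)\<close>.\<close>

lemma dapp_integral:
  "\<exists>\<Phi>. (\<forall>y. tapp \<Phi> y = (LINT x|lborel. tapp f (y + x) * tapp g x)) \<and>
     (LINT x|lborel. dapp T (ttranslate x f) * tapp g x) = dapp T \<Phi>"
proof -
  obtain r1 where r1: "r1 > 0" "\<And>x. \<bar>x\<bar> \<ge> r1 \<Longrightarrow> tapp f x = 0"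
    using test_fun_vanishes_outside by blast
  obtain r where r: "r > 0" "\<And>x. \<bar>x\<bar> \<ge> r \<Longrightarrow> tapp g x = 0"
    using test_fun_vanishes_outside by blast
  \<comment> \<open>two units left of the support of \<open>g\<close>: every \<open>t\<close> within distance 1 of \<open>[-r, r]\<close> then exceeds \<open>a\<close>\<close>
  define a where "a = - r - 2"
  define \<Phi> where "\<Phi> s = Abs_test_fun (partial_corr a s (tapp f) (tapp g))" for s
  have van: "partial_corr a s (tapp f) (tapp g) y = 0" if "\<bar>y\<bar> > r1 + r" for s y
  proof -
    have "tapp f (y + x) * tapp g x = 0" for x
    proof (cases "\<bar>x\<bar> \<ge> r")
      case False
      then have "\<bar>y + x\<bar> \<ge> r1" using that by linarith
      then show ?thesis by (simp add: r1)
    qed (simp add: r)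
    then have "(\<lambda>x. tapp f (y + x) * tapp g x) = (\<lambda>x. 0)" by (rule ext)
    then show ?thesis unfolding partial_corr_def by (simp only: integral_0)
  qed
  have \<Phi>: "tapp (\<Phi> s) = partial_corr a s (tapp f) (tapp g)" for s
    unfolding \<Phi>_def by (rule tapp_Abs_test_fun[OF smooth_partial_corr van]) simp_all
  have D: "((\<lambda>s. dapp T (\<Phi> s)) has_field_derivative dapp T (tapp g s *\<^sub>R ttranslate s f)) (at s)"
    if s: "s \<in> {-r..r}" for s
  proof (rule dapp_curve_DERIV[where r = "r1 + r" and
        d = "\<lambda>n y t. (deriv ^^ n) (tapp f) (y + t) * tapp g t" and
        B = "\<lambda>n. sup_deriv (Suc n) f * sup_deriv 0 g + sup_deriv n f * sup_deriv 1 g"])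
    show "((\<lambda>t. (deriv ^^ n) (tapp (\<Phi> t)) y) has_field_derivative (deriv ^^ n) (tapp f) (y + t) * tapp g t) (at t)"
      if "\<bar>t - s\<bar> \<le> 1" for n y t
      unfolding \<Phi> funpow_deriv_partial_corr[OF smooth_tapp smooth_tapp]
      by (rule partial_corr_DERIV_upper) (use s that in \<open>auto simp: smooth_funpow_deriv a_def\<close>)
    show "\<bar>(deriv ^^ n) (tapp f) (y + t) * tapp g t - (deriv ^^ n) (tapp f) (y + s) * tapp g s\<bar>
        \<le> (sup_deriv (Suc n) f * sup_deriv 0 g + sup_deriv n f * sup_deriv 1 g) * \<bar>t - s\<bar>" for n y t
    proof (rule lipschitz_if_DERIV_bound[of "\<lambda>t. (deriv ^^ n) (tapp f) (y + t) * tapp g t"])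
      fix x
      have "((\<lambda>t. (deriv ^^ n) (tapp f) (y + t)) has_field_derivative (deriv ^^ Suc n) (tapp f) (y + x)) (at x)"
        using DERIV_shift[of "(deriv ^^ n) (tapp f)" _ x y] funpow_deriv_tapp_DERIV[of n f "x + y"]
        by (simp add: add.commute)
      from DERIV_mult[OF this funpow_deriv_tapp_DERIV[of 0 g x]]
      show "((\<lambda>t. (deriv ^^ n) (tapp f) (y + t) * tapp g t) has_field_derivative
          (deriv ^^ Suc n) (tapp f) (y + x) * tapp g x + (deriv ^^ 1) (tapp g) x * (deriv ^^ n) (tapp f) (y + x)) (at x)"
        by simp
      show "\<bar>(deriv ^^ Suc n) (tapp f) (y + x) * tapp g x + (deriv ^^ 1) (tapp g) x * (deriv ^^ n) (tapp f) (y + x)\<bar>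
          \<le> sup_deriv (Suc n) f * sup_deriv 0 g + sup_deriv n f * sup_deriv 1 g"
      proof (rule order_trans[OF abs_triangle_ineq add_mono])
        show "\<bar>(deriv ^^ Suc n) (tapp f) (y + x) * tapp g x\<bar> \<le> sup_deriv (Suc n) f * sup_deriv 0 g"
          unfolding abs_mult
          by (rule mult_mono[OF sup_deriv_bound _ sup_deriv_nonneg abs_ge_zero]) (use sup_deriv_bound[of 0 g x] in simp)
        show "\<bar>(deriv ^^ 1) (tapp g) x * (deriv ^^ n) (tapp f) (y + x)\<bar> \<le> sup_deriv n f * sup_deriv 1 g"
          unfolding abs_mult mult.commute[of "sup_deriv n f"]
          by (rule mult_mono[OF sup_deriv_bound sup_deriv_bound sup_deriv_nonneg abs_ge_zero])
      qed
    qed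
    show "(deriv ^^ n) (tapp f) (y + s) * tapp g s = (deriv ^^ n) (tapp (tapp g s *\<^sub>R ttranslate s f)) y" for n y
    proof -
      have "(deriv ^^ n) (tapp (tapp g s *\<^sub>R ttranslate s f)) y = tapp g s * (deriv ^^ n) (tapp (ttranslate s f)) y"
        unfolding tapp_funpow_tderiv[symmetric] funpow_tderiv_scaleR by simp
      then show ?thesis by (simp add: funpow_deriv_ttranslate)
    qed
    show "tapp (tapp g s *\<^sub>R ttranslate s f) x = 0" if "\<bar>x\<bar> > r1 + r" for x
    proof -
      have "\<bar>x + s\<bar> \<ge> r1" using that s by auto
      then show ?thesis by (simp add: tapp_ttranslate r1)
    qed
  qed (auto simp: \<Phi> van intro!: add_nonneg_nonneg mult_nonneg_nonneg sup_deriv_nonneg)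
  have "((\<lambda>s. dapp T (tapp g s *\<^sub>R ttranslate s f)) has_integral dapp T (\<Phi> r) - dapp T (\<Phi> (- r))) {-r..r}"
    by (rule fundamental_theorem_of_calculus)
      (use D r(1) in \<open>auto intro: has_field_derivative_at_within simp flip: has_real_derivative_iff_has_vector_derivative\<close>)
  moreover have "\<Phi> (- r) = 0"
  proof (rule test_fun_eqI)
    fix y
    have "integral {a..-r} (\<lambda>x. tapp f (y + x) * tapp g x) = integral {a..-r} (\<lambda>x. 0)"
      by (rule integral_cong) (use r in auto)
    then show "tapp (\<Phi> (- r)) y = tapp 0 y" by (simp add: \<Phi> partial_corr_def)
  qed
  ultimately have "integral {-r..r} (\<lambda>s. dapp T (ttranslate s f) * tapp g s) = dapp T (\<Phi> r)"
    by (simp add: dapp_scaleR_right mult.commute integral_unique)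
  moreover have "continuous_on UNIV (\<lambda>s. dapp T (ttranslate s f) * tapp g s)"
    by (intro smooth_imp_continuous_on smooth_mult smooth_dapp_ttranslate smooth_tapp)
  then have "(LINT s|lborel. dapp T (ttranslate s f) * tapp g s)
      = integral {-r..r} (\<lambda>s. dapp T (ttranslate s f) * tapp g s)"
    by (rule LINT_compact_support) (use r in auto)
  moreover have "tapp (\<Phi> r) y = (LINT x|lborel. tapp f (y + x) * tapp g x)" for y
  proof -
    have c: "continuous_on S (\<lambda>x. tapp f (y + x) * tapp g x)" for S
      by (simp add: continuous_on_partial_corr)
    have "(LINT x|lborel. tapp f (y + x) * tapp g x) = integral {-(r+2)..r+2} (\<lambda>x. tapp f (y + x) * tapp g x)"
      by (rule LINT_compact_support[OF c]) (use r in auto)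
    also have "\<dots> = integral {a..r} (\<lambda>x. tapp f (y + x) * tapp g x)
        + integral {r..r+2} (\<lambda>x. tapp f (y + x) * tapp g x)"
    proof -
      have "integral {a..r} (\<lambda>x. tapp f (y + x) * tapp g x) + integral {r..r+2} (\<lambda>x. tapp f (y + x) * tapp g x)
          = integral {a..r+2} (\<lambda>x. tapp f (y + x) * tapp g x)"
        by (rule Henstock_Kurzweil_Integration.integral_combine)
          (use r(1) in \<open>auto simp: a_def intro: integrable_continuous_real c\<close>)
      then show ?thesis by (simp add: a_def)
    qed
    also have "integral {r..r+2} (\<lambda>x. tapp f (y + x) * tapp g x) = integral {r..r+2} (\<lambda>x. 0)"
      by (rule integral_cong) (use r in auto)
    finally show ?thesis by (simp add: \<Phi> partial_corr_def)
  qed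
  ultimately show ?thesis by (intro exI[of _ "\<Phi> r"]) simp
qed

section \<open>The adjoint kernel\<close>

lemma treflect_ttranslate_treflect: "treflect (ttranslate (- x) (treflect \<psi>)) = ttranslate x \<psi>"
  by (rule test_fun_eqI) (simp add: tapp_treflect tapp_ttranslate add.commute)

lemma LINT_reflect_shift: "(LINT x|lborel. f x) = (LINT x|lborel. f (c - x))" for f :: "real \<Rightarrow> real"
  using lborel_integral_real_affine[of "-1" f c] by simp

text \<open>Both sides are \<open>T\<close> applied to \<open>y \<mapsto> \<integral> \<phi>(x) \<psi>(x + y) dx\<close>.\<close>

lemma LINT_conv_test_adjoint:
  "(LINT x|lborel. conv_test T \<phi> x * tapp \<psi> x) = (LINT x|lborel. tapp \<phi> x * conv_test (dreflect T) \<psi> x)"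
proof -
  obtain \<Phi> where \<Phi>: "\<And>y. tapp \<Phi> y = (LINT x|lborel. tapp (treflect \<phi>) (y + x) * tapp (treflect \<psi>) x)"
      "(LINT x|lborel. dapp T (ttranslate x (treflect \<phi>)) * tapp (treflect \<psi>) x) = dapp T \<Phi>"
    using dapp_integral[of "treflect \<phi>" "treflect \<psi>" T] by blast
  obtain \<Psi> where \<Psi>: "\<And>y. tapp \<Psi> y = (LINT x|lborel. tapp \<psi> (y + x) * tapp \<phi> x)"
      "(LINT x|lborel. dapp T (ttranslate x \<psi>) * tapp \<phi> x) = dapp T \<Psi>"
    using dapp_integral[of \<psi> \<phi> T] by blast
  have "\<Phi> = \<Psi>"
  proof (rule test_fun_eqI)
    fix y
    have "tapp \<Psi> y = (LINT x|lborel. tapp \<psi> (y + (- y - x)) * tapp \<phi> (- y - x))"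
      unfolding \<Psi>(1) by (rule LINT_reflect_shift)
    also have "\<dots> = tapp \<Phi> y"
      unfolding \<Phi>(1) by (simp add: tapp_treflect mult.commute)
    finally show "tapp \<Phi> y = tapp \<Psi> y" by simp
  qed
  have "(LINT x|lborel. conv_test T \<phi> x * tapp \<psi> x)
      = (LINT x|lborel. conv_test T \<phi> (0 - x) * tapp \<psi> (0 - x))"
    by (rule LINT_reflect_shift)
  also have "\<dots> = dapp T \<Phi>"
    unfolding \<Phi>(2)[symmetric] by (simp add: conv_test_def tapp_treflect)
  also have "\<dots> = (LINT x|lborel. tapp \<phi> x * conv_test (dreflect T) \<psi> x)"
    unfolding \<open>\<Phi> = \<Psi>\<close> \<Psi>(2)[symmetric]
    by (simp add: conv_test_def dapp_dreflect treflect_ttranslate_treflect mult.commute)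
  finally show ?thesis .
qed

lemma integrable_smooth_tapp:
  assumes "smooth f" shows "integrable lborel (\<lambda>x. f x * tapp \<phi> x)"
proof -
  obtain r where r: "\<And>x. \<bar>x\<bar> \<ge> r \<Longrightarrow> tapp \<phi> x = 0" using test_fun_vanishes_outside by blast
  have "continuous_on UNIV (\<lambda>x. f x * tapp \<phi> x)"
    by (intro smooth_imp_continuous_on smooth_mult assms smooth_tapp)
  then show ?thesis by (rule LINT_compact_support(1)[of _ r]) (simp add: r)
qed

text \<open>Test \<open>h\<close> with \<open>\<theta>\<^sup>2 h\<close>, where \<open>\<theta>\<close> is a test function with \<open>\<theta> a \<noteq> 0\<close>: the integral of \<open>(\<theta> h)\<^sup>2\<close> is zero.\<close>

lemma smooth_eq_0_if_LINT_eq_0: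
  assumes h: "smooth h" and "\<And>\<phi>. (LINT x|lborel. tapp \<phi> x * h x) = 0"
  shows "h a = 0"
proof -
  obtain \<theta>\<^sub>0 where "tapp \<theta>\<^sub>0 0 \<noteq> 0" using ex_nonzero_test_fun by blast
  then obtain \<theta> where \<theta>: "tapp \<theta> a \<noteq> 0"
    using tapp_ttranslate[of "- a" \<theta>\<^sub>0 a] by (metis add.right_inverse)
  obtain r where r: "r > 0" "\<And>x. \<bar>x\<bar> \<ge> r \<Longrightarrow> tapp \<theta> x = 0"
    using test_fun_vanishes_outside by blast
  define f where "f = (\<lambda>x. (tapp \<theta> x * h x)\<^sup>2)"
  have f: "continuous_on UNIV f"
    unfolding f_def by (intro continuous_intros smooth_imp_continuous_on h smooth_tapp)
  have "tapp (tmult (tapp \<theta>) (tmult h \<theta>)) x * h x = f x" for x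
    by (simp add: tapp_tmult h f_def power2_eq_square mult_ac)
  then have "(LINT x|lborel. f x) = 0" using assms(2)[of "tmult (tapp \<theta>) (tmult h \<theta>)"] by simp
  moreover have "(LINT x|lborel. f x) = integral {-r..r} f"
    by (rule LINT_compact_support(2)[OF f]) (simp add: f_def r)
  ultimately have "\<forall>x\<in>{-r..r}. f x = 0"
    using integral_eq_0_iff[of "-r" r f] continuous_on_subset[OF f] r(1) by (simp add: f_def)
  moreover have "a \<in> {-r..r}" using r(2)[of a] \<theta> by (cases "\<bar>a\<bar> \<ge> r") auto
  ultimately show ?thesis using \<theta> by (auto simp: f_def)
qed

lemma is_adjoint_kernel_dreflect_transpose:
  fixes G :: "distribution ^ 'd ^ 'd"
  shows "is_adjoint_kernel G (dreflect_matrix (transpose G))"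
  unfolding is_adjoint_kernel_def
proof (intro allI)
  fix \<phi> \<psi> :: "test_fun ^ 'd"
  let ?I = "\<lambda>i k. LINT x|lborel. conv_test (G $ i $ k) (\<phi> $ k) x * tapp (\<psi> $ i) x"
  have "(\<Sum>i\<in>UNIV. LINT x|lborel. matrix_conv_test G \<phi> i x * tapp (\<psi> $ i) x) = (\<Sum>i\<in>UNIV. \<Sum>k\<in>UNIV. ?I i k)"
    by (simp add: matrix_conv_test_def sum_distrib_right integrable_smooth_tapp smooth_conv_test)
  also have "\<dots> = (\<Sum>k\<in>UNIV. \<Sum>i\<in>UNIV. ?I i k)"
    by (rule sum.swap)
  also have "\<dots> = (\<Sum>k\<in>UNIV. \<Sum>i\<in>UNIV. LINT x|lborel.
      conv_test (dreflect (G $ i $ k)) (\<psi> $ i) x * tapp (\<phi> $ k) x)"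
    by (intro sum.cong refl, subst LINT_conv_test_adjoint) (simp only: mult.commute)
  also have "\<dots> = (\<Sum>k\<in>UNIV. LINT x|lborel. (\<Sum>i\<in>UNIV.
      conv_test (dreflect (G $ i $ k)) (\<psi> $ i) x * tapp (\<phi> $ k) x))"
    by (simp add: integrable_smooth_tapp smooth_conv_test)
  also have "\<dots> = (\<Sum>k\<in>UNIV. LINT x|lborel. tapp (\<phi> $ k) x * matrix_conv_test (dreflect_matrix (transpose G)) \<psi> k x)"
    by (simp add: matrix_conv_test_def dreflect_matrix_def transpose_def sum_distrib_left mult.commute)
  finally show "(\<Sum>i\<in>UNIV. LINT x|lborel. matrix_conv_test G \<phi> i x * tapp (\<psi> $ i) x)
      = (\<Sum>k\<in>UNIV. LINT x|lborel. tapp (\<phi> $ k) x * matrix_conv_test (dreflect_matrix (transpose G)) \<psi> k x)" .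
qed

lemma conv_test_zero [simp]: "conv_test T 0 x = 0"
proof -
  have "ttranslate (- x) (treflect 0) = 0"
    by (rule test_fun_eqI) (simp add: tapp_ttranslate tapp_treflect)
  then show ?thesis by (simp add: conv_test_def)
qed

text \<open>Testing with vectors that have one nonzero entry isolates the entry \<open>(i, k)\<close> of the kernel. The
  convolution with a test function, evaluated at 0, determines that distribution.\<close>

lemma is_adjoint_kernel_unique:
  fixes G H H' :: "distribution ^ 'd ^ 'd"
  assumes "is_adjoint_kernel G H" "is_adjoint_kernel G H'" shows "H = H'"
proof -
  have "dapp (H $ i $ k) \<psi>' = dapp (H' $ i $ k) \<psi>'" for i k \<psi>'
  proof -
    define \<psi> where "\<psi> = treflect \<psi>'"
    \<comment> \<open>\<open>e j \<omega>\<close> has the entry \<open>\<omega>\<close> at index \<open>j\<close> and is zero elsewhere\<close>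
    define e where "e j \<omega> = (\<chi> l. if l = j then \<omega> else 0)" for j :: 'd and \<omega> :: test_fun
    define h where "h = (\<lambda>x. conv_test (H $ i $ k) \<psi> x - conv_test (H' $ i $ k) \<psi> x)"
    have row: "matrix_conv_test M (e k \<psi>) i x = conv_test (M $ i $ k) \<psi> x" for M :: "distribution ^ 'd ^ 'd" and x
    proof -
      have "matrix_conv_test M (e k \<psi>) i x = (\<Sum>l\<in>UNIV. if l = k then conv_test (M $ i $ k) \<psi> x else 0)"
        unfolding matrix_conv_test_def by (intro sum.cong) (auto simp: e_def)
      then show ?thesis by simp
    qed
    have col: "(\<Sum>j\<in>UNIV. LINT x|lborel. tapp (e i \<phi> $ j) x * F j x) = (LINT x|lborel. tapp \<phi> x * F i x)"
      for \<phi> and F :: "'d \<Rightarrow> real \<Rightarrow> real"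
    proof -
      have "(\<Sum>j\<in>UNIV. LINT x|lborel. tapp (e i \<phi> $ j) x * F j x)
          = (\<Sum>j\<in>UNIV. if j = i then LINT x|lborel. tapp \<phi> x * F i x else 0)"
        by (intro sum.cong) (auto simp: e_def)
      then show ?thesis by simp
    qed
    have "(LINT x|lborel. tapp \<phi> x * h x) = 0" for \<phi>
    proof -
      have "(\<Sum>j\<in>UNIV. LINT x|lborel. tapp (e i \<phi> $ j) x * matrix_conv_test H (e k \<psi>) j x)
          = (\<Sum>j\<in>UNIV. LINT x|lborel. tapp (e i \<phi> $ j) x * matrix_conv_test H' (e k \<psi>) j x)"
        using assms unfolding is_adjoint_kernel_def by metis
      then have "(LINT x|lborel. conv_test (H $ i $ k) \<psi> x * tapp \<phi> x)
          = (LINT x|lborel. conv_test (H' $ i $ k) \<psi> x * tapp \<phi> x)"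
        unfolding col row by (simp only: mult.commute)
      moreover have "(LINT x|lborel. tapp \<phi> x * h x) = (LINT x|lborel. conv_test (H $ i $ k) \<psi> x * tapp \<phi> x)
          - (LINT x|lborel. conv_test (H' $ i $ k) \<psi> x * tapp \<phi> x)"
      proof -
        have "(LINT x|lborel. tapp \<phi> x * h x) = (LINT x|lborel.
            conv_test (H $ i $ k) \<psi> x * tapp \<phi> x - conv_test (H' $ i $ k) \<psi> x * tapp \<phi> x)"
          by (simp add: h_def algebra_simps)
        also have "\<dots> = (LINT x|lborel. conv_test (H $ i $ k) \<psi> x * tapp \<phi> x)
            - (LINT x|lborel. conv_test (H' $ i $ k) \<psi> x * tapp \<phi> x)"
          by (rule Bochner_Integration.integral_diff; rule integrable_smooth_tapp, rule smooth_conv_test)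
        finally show ?thesis .
      qed
      ultimately show ?thesis by simp
    qed
    note orth = this
    have "smooth h" unfolding h_def by (intro smooth_diff smooth_conv_test)
    then have "h 0 = 0" by (rule smooth_eq_0_if_LINT_eq_0) (rule orth)
    moreover have "ttranslate 0 \<psi>' = \<psi>'" by (rule test_fun_eqI) (simp add: tapp_ttranslate)
    ultimately show ?thesis by (simp add: h_def conv_test_def \<psi>_def)
  qed
  then show ?thesis by (simp add: vec_eq_iff distribution_eqI)
qed

section \<open>Reflection and adjoint operators\<close>

lemma treflect_odo_test: "treflect (odo_test p \<phi>) = odo_test (odo_adjoint p) (treflect \<phi>)"
proof (rule test_fun_eqI)
  fix x
  have "tapp (treflect \<phi>) = (\<lambda>x. 1 * tapp \<phi> (0 + (-1) * x))" by (simp add: tapp_treflect fun_eq_iff)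
  then have "(deriv ^^ n) (tapp (treflect \<phi>)) x = (-1) ^ n * (deriv ^^ n) (tapp \<phi>) (- x)" for n
    using fun_cong[OF funpow_deriv_affine[OF smooth_tapp[of \<phi>], of n 1 0 "-1"], of x] by simp
  then show "tapp (treflect (odo_test p \<phi>)) x = tapp (odo_test (odo_adjoint p) (treflect \<phi>)) x"
    by (simp add: tapp_treflect tapp_odo_test odo_fun_def degree_odo_adjoint coeff_odo_adjoint
        mult.assoc mult.left_commute flip: power_mult_distrib)
qed

lemma odo_app_adjoint_dreflect: "odo_app (odo_adjoint p) (dreflect T) = dreflect (odo_app p T)"
  by (rule distribution_eqI) (simp add: dapp_odo_app_adjoint dapp_dreflect treflect_odo_test)

lemma dreflect_dirac [simp]: "dreflect dirac = dirac"
  by (rule distribution_eqI) (simp add: dapp_dreflect dapp_dirac tapp_treflect)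

lemma dreflect_zero [simp]: "dreflect 0 = 0"
  by (rule distribution_eqI) (simp add: dapp_dreflect)

lemma dreflect_add: "dreflect (S + T) = dreflect S + dreflect T"
  by (rule distribution_eqI) (simp add: dapp_dreflect)

lemma dreflect_sum: "dreflect (\<Sum>i\<in>I. f i) = (\<Sum>i\<in>I. dreflect (f i))"
  by (induction I rule: infinite_finite_induct) (simp_all add: dreflect_add)

lemma dreflect_matrix_dreflect_matrix [simp]: "dreflect_matrix (dreflect_matrix G) = G"
  by (simp add: dreflect_matrix_def vec_eq_iff)

lemma dreflect_matrix_id_dirac [simp]: "dreflect_matrix id_dirac = id_dirac"
  by (simp add: dreflect_matrix_def id_dirac_def vec_eq_iff)

lemma mdo_app_adjoint_dreflect:
  "mdo_app (mdo_adjoint L) (dreflect_matrix G) = dreflect_matrix (mdo_app (transpose L) G)"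
  by (simp add: mdo_app_def mdo_adjoint_def dreflect_matrix_def transpose_def vec_eq_iff
      odo_app_adjoint_dreflect dreflect_sum)

text \<open>Reflection conjugates \<open>p*\<close> to \<open>p\<close>, so the adjoint matrix operator becomes the transposed one.\<close>

lemma is_green_matrix_adjoint_iff:
  "is_green_matrix (mdo_adjoint L) H \<longleftrightarrow> is_green_matrix (transpose L) (dreflect_matrix H)"
proof -
  have "mdo_app (mdo_adjoint L) H = dreflect_matrix (mdo_app (transpose L) (dreflect_matrix H))"
    using mdo_app_adjoint_dreflect[of L "dreflect_matrix H"] by simp
  then show ?thesis
    unfolding is_green_matrix_def by (metis dreflect_matrix_dreflect_matrix dreflect_matrix_id_dirac)
qed

lemma anticausal_matrix_iff: "anticausal_matrix H \<longleftrightarrow> causal_matrix (dreflect_matrix H)"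
  unfolding anticausal_matrix_def causal_matrix_def dreflect_matrix_def
  using anticausal_dreflect causal_dreflect by (metis dreflect_dreflect vec_lambda_beta)

section \<open>Causal Green's matrices\<close>

lemma mdo_app_matrix_mult: "mdo_app (A ** B) G = mdo_app A (mdo_app B G)"
proof -
  have "(\<Sum>d\<in>UNIV. odo_app (\<Sum>k\<in>UNIV. A $ r $ k * B $ k $ d) (G $ d $ c))
      = (\<Sum>k\<in>UNIV. odo_app (A $ r $ k) (\<Sum>d\<in>UNIV. odo_app (B $ k $ d) (G $ d $ c)))" for r c
    unfolding odo_app_sum odo_app_sum_right odo_app_mult by (rule sum.swap)
  then show ?thesis by (simp add: mdo_app_def matrix_matrix_mult_def vec_eq_iff)
qed

lemma mdo_app_mat_1 [simp]: "mdo_app (mat 1) G = G"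
proof -
  have "(\<Sum>d\<in>UNIV. odo_app (if r = d then 1 else 0) (G $ d $ c)) = (\<Sum>d\<in>UNIV. if d = r then G $ d $ c else 0)" for r c
    by (intro sum.cong) auto
  then show ?thesis by (simp add: mdo_app_def mat_def vec_eq_iff)
qed

lemma mdo_app_zero [simp]: "mdo_app A 0 = 0"
  by (simp add: mdo_app_def vec_eq_iff)

lemma mdo_app_diff: "mdo_app A (G - H) = mdo_app A G - mdo_app A H"
  by (simp add: mdo_app_def vec_eq_iff odo_app_diff_right sum_subtractf)

lemma mdo_app_diag: "mdo_app (diag_mdo p) G $ r $ c = odo_app (p $ r) (G $ r $ c)"
proof -
  have "(\<Sum>d\<in>UNIV. odo_app (if r = d then p $ r else 0) (G $ d $ c))
      = (\<Sum>d\<in>UNIV. if d = r then odo_app (p $ r) (G $ r $ c) else 0)"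
    by (intro sum.cong) auto
  then show ?thesis by (simp add: mdo_app_def diag_mdo_def)
qed

lemma mdo_app_id_dirac: "mdo_app B id_dirac $ r $ c = odo_app (B $ r $ c) dirac"
proof -
  have "(\<Sum>d\<in>UNIV. odo_app (B $ r $ d) (if d = c then dirac else 0))
      = (\<Sum>d\<in>UNIV. if d = c then odo_app (B $ r $ c) dirac else 0)"
    by (intro sum.cong) auto
  then show ?thesis by (simp add: mdo_app_def id_dirac_def)
qed

lemma causal_matrix_mdo_app: "causal_matrix G \<Longrightarrow> causal_matrix (mdo_app A G)"
  unfolding causal_matrix_def mdo_app_def by (auto intro!: causal_sum causal_odo_app)

lemma diag_inv_mdo_app_id_dirac:
  "diag_inv p (mdo_app B id_dirac) $ r $ c = odo_app (B $ r $ c) (causal_green (p $ r))"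
  by (simp add: diag_inv_def mdo_app_id_dirac dconv_odo_dirac)

lemma mdo_app_diag_inv_entry:
  "mdo_app A (diag_inv p (mdo_app B id_dirac)) $ r $ c
    = (\<Sum>e\<in>UNIV. odo_app (A $ r $ e * B $ e $ c) (causal_green (p $ e)))"
  by (simp add: mdo_app_def[of A] diag_inv_mdo_app_id_dirac odo_app_mult)

text \<open>The entry \<open>(r, c)\<close> is the sum of \<open>A\<^sub>r\<^sub>e B\<^sub>e\<^sub>c{g\<^sub>e}\<close> over \<open>e\<close>, and scalar operators commute.\<close>

lemma transpose_mdo_app_diag_inv:
  "transpose (mdo_app A (diag_inv p (mdo_app B id_dirac)))
    = mdo_app (transpose B) (diag_inv p (mdo_app (transpose A) id_dirac))"
  unfolding vec_eq_iff by (simp add: transpose_def mdo_app_diag_inv_entry mult.commute)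

text \<open>\<open>D\<close> is inverted entrywise by the scalar causal Green's functions. A causal \<open>G\<close> in the kernel of \<open>L\<close>
  satisfies \<open>D{V{G}} = 0\<close> entrywise, so \<open>V{G} = 0\<close> and \<open>G = 0\<close>.\<close>

lemma causal_green_matrix_iff:
  fixes L U V U' V' :: "'d::finite mdo" and p :: "odo ^ 'd"
  assumes L: "L = U ** diag_mdo p ** V" and p: "\<And>d. p $ d \<noteq> 0"
    and U: "U ** U' = mat 1" "U' ** U = mat 1" and V: "V ** V' = mat 1" "V' ** V = mat 1"
  shows "causal_matrix G \<and> is_green_matrix L G \<longleftrightarrow> G = mdo_app V' (diag_inv p (mdo_app U' id_dirac))"
proof -
  define X :: "distribution ^ 'd ^ 'd" where "X = diag_inv p (mdo_app U' id_dirac)"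
  have cX: "causal_matrix X"
    by (simp add: causal_matrix_def X_def diag_inv_mdo_app_id_dirac causal_odo_app causal_green p)
  have "mdo_app (diag_mdo p) X = mdo_app U' id_dirac"
  proof -
    have "odo_app (p $ r) (odo_app q (causal_green (p $ r))) = odo_app q dirac" for r q
      using causal_green(2)[OF p] by (metis odo_app_mult mult.commute)
    then show ?thesis
      by (simp add: vec_eq_iff mdo_app_diag X_def diag_inv_mdo_app_id_dirac mdo_app_id_dirac)
  qed
  moreover have "mdo_app L (mdo_app V' X) = mdo_app U (mdo_app (diag_mdo p) (mdo_app (V ** V') X))"
    by (simp only: L mdo_app_matrix_mult)
  moreover have "mdo_app U (mdo_app U' id_dirac) = id_dirac"
    by (simp add: U flip: mdo_app_matrix_mult)
  ultimately have green: "mdo_app L (mdo_app V' X) = id_dirac" by (simp add: V)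
  have kernel: "G = 0" if G: "causal_matrix G" "mdo_app L G = 0" for G
  proof -
    have "mdo_app (diag_mdo p) (mdo_app V G) = mdo_app (U' ** U) (mdo_app (diag_mdo p) (mdo_app V G))"
      by (simp add: U)
    also have "\<dots> = mdo_app U' (mdo_app L G)" by (simp only: L mdo_app_matrix_mult)
    finally have 0: "mdo_app (diag_mdo p) (mdo_app V G) = 0" by (simp add: G(2))
    have "mdo_app V G $ r $ c = 0" for r c
    proof (rule causal_odo_app_eq_0[OF p])
      show "causal (mdo_app V G $ r $ c)"
        using causal_matrix_mdo_app[OF G(1)] by (simp add: causal_matrix_def)
      show "odo_app (p $ r) (mdo_app V G $ r $ c) = 0"
        using 0 mdo_app_diag[of p "mdo_app V G" r c] by simp
    qed
    then have "mdo_app V G = 0" by (simp add: vec_eq_iff)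
    then show ?thesis using mdo_app_matrix_mult[of V' V G] by (simp add: V)
  qed
  show ?thesis
  proof
    assume G: "causal_matrix G \<and> is_green_matrix L G"
    have "G - mdo_app V' X = 0"
    proof (rule kernel)
      show "causal_matrix (G - mdo_app V' X)"
        using G causal_matrix_mdo_app[OF cX] by (simp add: causal_matrix_def causal_diff)
      show "mdo_app L (G - mdo_app V' X) = 0"
        using G by (simp add: mdo_app_diff green is_green_matrix_def)
    qed
    then show "G = mdo_app V' (diag_inv p (mdo_app U' id_dirac))" by (simp add: X_def)
  next
    assume "G = mdo_app V' (diag_inv p (mdo_app U' id_dirac))"
    then show "causal_matrix G \<and> is_green_matrix L G"
      using green causal_matrix_mdo_app[OF cX] by (simp add: X_def is_green_matrix_def)
  qed
qed

lemma diagonal_nonzero: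
  fixes U V :: "'d::finite mdo"
  assumes "mdo_invertible (U ** diag_mdo p ** V)" shows "p $ d \<noteq> 0"
proof -
  have "det (diag_mdo p) = (\<Prod>d\<in>UNIV. p $ d)"
    by (subst det_diagonal) (simp_all add: diag_mdo_def)
  moreover have "det (diag_mdo p) \<noteq> 0" using assms by (auto simp: mdo_invertible_def det_mul)
  ultimately show ?thesis by auto
qed

lemma transpose_factorization:
  fixes U V :: "'d::finite mdo"
  shows "transpose (U ** diag_mdo p ** V) = transpose V ** diag_mdo p ** transpose U"
proof -
  have "transpose (diag_mdo p) = diag_mdo p" by (auto simp: transpose_def diag_mdo_def vec_eq_iff)
  then show ?thesis by (simp add: matrix_transpose_mul matrix_mul_assoc)
qed

lemma unimodular_inverse:
  assumes "unimodular V" shows "V ** matrix_inv V = mat 1" "matrix_inv V ** V = mat 1"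
proof -
  have "V ** matrix_inv V = mat 1 \<and> matrix_inv V ** V = mat 1"
    using assms unfolding unimodular_def invertible_def matrix_inv_def by (rule someI_ex)
  then show "V ** matrix_inv V = mat 1" "matrix_inv V ** V = mat 1" by auto
qed

theorem theorem1:
  fixes L U V :: "'d::finite mdo" and p :: "odo ^ 'd"
  assumes "mdo_invertible L"
    and "unimodular U" and "unimodular V"
    and "L = U ** diag_mdo p ** V"
  shows "(\<exists>!G. causal_matrix G \<and> is_green_matrix L G) \<and>
    (\<forall>G. causal_matrix G \<and> is_green_matrix L G \<longrightarrow>
       G = mdo_app (matrix_inv V) (diag_inv p (mdo_app (matrix_inv U) id_dirac)) \<and>
       (\<exists>!G'. is_adjoint_kernel G G') \<and>
       (\<forall>G'. is_adjoint_kernel G G' \<longrightarrow>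
          G' = dreflect_matrix (transpose G) \<and>
          anticausal_matrix G' \<and> is_green_matrix (mdo_adjoint L) G' \<and>
          (\<forall>H. anticausal_matrix H \<and> is_green_matrix (mdo_adjoint L) H \<longrightarrow> H = G')))"
proof -
  define U' where "U' = matrix_inv U"
  define V' where "V' = matrix_inv V"
  have U: "U ** U' = mat 1" "U' ** U = mat 1" and V: "V ** V' = mat 1" "V' ** V = mat 1"
    using assms(2,3) unimodular_inverse by (auto simp: U'_def V'_def)
  have p: "p $ d \<noteq> 0" for d using diagonal_nonzero assms(1,4) by blast
  define G0 where "G0 = mdo_app V' (diag_inv p (mdo_app U' id_dirac))"
  have G0: "causal_matrix G \<and> is_green_matrix L G \<longleftrightarrow> G = G0" for G
    unfolding G0_def by (rule causal_green_matrix_iff[OF assms(4) p U V])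
  have Lt: "transpose L = transpose V ** diag_mdo p ** transpose U"
    unfolding assms(4) by (rule transpose_factorization)
  have "causal_matrix G \<and> is_green_matrix (transpose L) G \<longleftrightarrow> G = transpose G0" for G
    unfolding G0_def transpose_mdo_app_diag_inv
    by (rule causal_green_matrix_iff[OF Lt p])
      (simp_all add: U V transpose_mat flip: matrix_transpose_mul)
  then have adj: "anticausal_matrix H \<and> is_green_matrix (mdo_adjoint L) H \<longleftrightarrow> H = dreflect_matrix (transpose G0)" for H
    unfolding anticausal_matrix_iff is_green_matrix_adjoint_iff by (metis dreflect_matrix_dreflect_matrix)
  have kernel: "is_adjoint_kernel G0 G' \<longleftrightarrow> G' = dreflect_matrix (transpose G0)" for G'
    using is_adjoint_kernel_dreflect_transpose is_adjoint_kernel_unique by blast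
  show ?thesis
    unfolding G0 kernel U'_def[symmetric] V'_def[symmetric] using adj kernel G0_def by auto
qed

end
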